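(* Let $1<r<n$, let $\Omega\in L^{r,r^*}(\mathbb S^{n-1})$ have mean zero, and let $0<\alpha<1+\frac n{r'}$. Let $$\frac{r'n}{r'+n}<p<\frac n\alpha,\qquad \frac1q=\frac1p-\frac\alpha n,\qquad \alpha-\frac np<\lambda<1+\frac n{r'}-\frac np.$$ Then there is a constant $C$ such that for all $f\in C_c^\infty(\mathbb R^n)$ $$\Big(\int_{\mathbb R^n}\big(|x|^\lambda|T_{\Omega,\alpha}f(x)|\big)^q\,dx\Big)^{\frac1q}\le C\Big(\int_{\mathbb R^n}\big(|x|^\lambda|\nabla f(x)|\big)^p\,dx\Big)^{\frac1p}.$$
   Context: $n\ge2$ is an integer; $r'=\frac r{r-1}$, $r^*=\frac{nr}{n-r}$. $\sigma=\mathcal H^{n-1}$ is surface measure on $\mathbb S^{n-1}$; "mean zero" means $\int_{\mathbb S^{n-1}}\Omega\,d\sigma=0$. The Lorentz space $L^{r,r^*}(\mathbb S^{n-1})$ is normed by $$\|\Omega\|_{L^{r,r^*}(\mathbb S^{n-1})}=\Big(r\int_0^\infty t^{r^*}\sigma(\{y'\in\mathbb S^{n-1}:|\Omega(y')|>t\})^{\frac{r^*}r}\frac{dt}t\Big)^{\frac1{r^*}}.$$ $T_{\Omega,\alpha}f(x)=\mathrm{p.v.}\int_{\mathbb R^n}\frac{\Omega(y')}{|y|^{n+1-\alpha}}f(x-y)\,dy=\lim_{\varepsilon\to0^+}\int_{|y|>\varepsilon}\frac{\Omega(y')}{|y|^{n+1-\alpha}}f(x-y)\,dy$, with $y'=y/|y|$.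 *)

theory Defs
  imports "HOL-Analysis.Analysis"
begin

text \<open>
  Hausdorff measure of integer dimension \<open>k\<close>, normalised so that it agrees with Lebesgue
  measure on \<open>k\<close>-dimensional Euclidean space. Covering sets have to be required bounded, since
  \<^const>\<open>diameter\<close> is unspecified on unbounded sets; the case distinction only matters for \<open>k = 0\<close>,
  where \<open>0 ^ 0 = 1\<close>.
\<close>

definition hausdorff_gauge :: "nat \<Rightarrow> 'a::metric_space set \<Rightarrow> ennreal" where
  "hausdorff_gauge k U =
     (if U = {} then 0 else ennreal (unit_ball_vol (real k) * (diameter U / 2) ^ k))"

definition hausdorff_pre :: "nat \<Rightarrow> real \<Rightarrow> 'a::metric_space set \<Rightarrow> ennreal" where
  "hausdorff_pre k \<delta> A =
     (INF U \<in> {U :: nat \<Rightarrow> 'a set. A \<subseteq> (\<Union>i. U i) \<and> (\<forall>i. bounded (U i) \<and> diameter (U i) \<le> \<delta>)}.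
        \<Sum>i. hausdorff_gauge k (U i))"

definition hausdorff_outer :: "nat \<Rightarrow> 'a::metric_space set \<Rightarrow> ennreal" where
  "hausdorff_outer k A = (SUP \<delta> \<in> {0<..}. hausdorff_pre k \<delta> A)"

text \<open>The outer measure restricted to its Caratheodory-measurable sets.\<close>

definition hausdorff_measure :: "nat \<Rightarrow> 'a::metric_space measure" where
  "hausdorff_measure k =
     measure_of UNIV (lambda_system UNIV UNIV (hausdorff_outer k)) (hausdorff_outer k)"

definition surface_measure :: "'a::euclidean_space measure" where
  "surface_measure = restrict_space (hausdorff_measure (DIM('a) - 1)) (sphere 0 1)"

text \<open>
  The lemmas up to \<open>emeasure_surface_measure\<close> justify the uses of \<^const>\<open>measure_of\<close> and
  \<^const>\<open>restrict_space\<close> above: the Hausdorff outer measure is countably additive on its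
  measurable sets, and these include all Borel sets.
\<close>

lemma hausdorff_pre_mono: "A \<subseteq> B \<Longrightarrow> hausdorff_pre k \<delta> A \<le> hausdorff_pre k \<delta> B"
  unfolding hausdorff_pre_def by (rule INF_superset_mono) auto

lemma hausdorff_pre_antimono: "\<delta> \<le> \<epsilon> \<Longrightarrow> hausdorff_pre k \<epsilon> A \<le> hausdorff_pre k \<delta> A"
  unfolding hausdorff_pre_def by (rule INF_superset_mono) (auto intro: order_trans)

lemma hausdorff_pre_le:
  assumes "A \<subseteq> (\<Union>i. U i)" "\<And>i. bounded (U i)" "\<And>i. diameter (U i) \<le> \<delta>"
  shows "hausdorff_pre k \<delta> A \<le> (\<Sum>i. hausdorff_gauge k (U i))"
  unfolding hausdorff_pre_def by (rule INF_lower) (use assms in auto)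

lemma hausdorff_pre_empty: "0 < \<delta> \<Longrightarrow> hausdorff_pre k \<delta> {} = 0"
  using hausdorff_pre_le[of "{}" "\<lambda>_. {}" \<delta> k] by (simp add: hausdorff_gauge_def)

lemma hausdorff_pre_UN_le:
  fixes A :: "nat \<Rightarrow> 'a::metric_space set"
  shows "hausdorff_pre k \<delta> (\<Union>n. A n) \<le> (\<Sum>n. hausdorff_pre k \<delta> (A n))"
proof (rule ennreal_le_epsilon)
  fix e :: real assume e: "0 < e" and fin: "(\<Sum>n. hausdorff_pre k \<delta> (A n)) < top"
  have "\<exists>U. A n \<subseteq> (\<Union>i. U i) \<and> (\<forall>i. bounded (U i) \<and> diameter (U i) \<le> \<delta>) \<and>
          (\<Sum>i. hausdorff_gauge k (U i)) \<le> hausdorff_pre k \<delta> (A n) + e * (1/2) ^ Suc n" for n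
  proof -
    have "hausdorff_pre k \<delta> (A n) < top"
      using fin by (auto simp: less_top dest!: ennreal_suminf_lessD)
    then have "hausdorff_pre k \<delta> (A n) < hausdorff_pre k \<delta> (A n) + e * (1/2) ^ Suc n"
      using e by (auto simp: less_top)
    then obtain U where "A n \<subseteq> (\<Union>i. U i)" "\<forall>i. bounded (U i) \<and> diameter (U i) \<le> \<delta>"
        "(\<Sum>i. hausdorff_gauge k (U i)) < hausdorff_pre k \<delta> (A n) + e * (1/2) ^ Suc n"
      by (subst (asm) (1) hausdorff_pre_def) (auto simp: INF_less_iff)
    then show ?thesis by (blast intro: less_imp_le)
  qed
  then obtain U where U: "\<And>n. A n \<subseteq> (\<Union>i. U n i)" "\<And>n i. bounded (U n i)"
      "\<And>n i. diameter (U n i) \<le> \<delta>"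
      "\<And>n. (\<Sum>i. hausdorff_gauge k (U n i)) \<le> hausdorff_pre k \<delta> (A n) + e * (1/2) ^ Suc n"
    by metis
  define C where "C = case_prod U o prod_decode"
  have "(\<Union>n. A n) \<subseteq> (\<Union>i. C i)"
    using U(1) by (auto simp: C_def subset_eq) (metis prod.case prod_encode_inverse)
  then have "hausdorff_pre k \<delta> (\<Union>n. A n) \<le> (\<Sum>i. hausdorff_gauge k (C i))"
    by (rule hausdorff_pre_le) (auto simp: C_def U split: prod.split)
  also have "\<dots> = (\<Sum>n. \<Sum>i. hausdorff_gauge k (U n i))"
    unfolding C_def comp_def by (intro suminf_ennreal_2dimen) auto
  also have "\<dots> \<le> (\<Sum>n. hausdorff_pre k \<delta> (A n) + e * (1/2) ^ Suc n)"
    by (intro suminf_le allI U) auto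
  also have "\<dots> = (\<Sum>n. hausdorff_pre k \<delta> (A n)) + (\<Sum>n. ennreal e * ennreal ((1/2) ^ Suc n))"
    using e by (subst suminf_add[symmetric])
       (auto simp del: ennreal_suminf_cmult simp add: ennreal_mult[symmetric])
  also have "\<dots> = (\<Sum>n. hausdorff_pre k \<delta> (A n)) + e"
    unfolding ennreal_suminf_cmult
    by (subst suminf_ennreal_eq[OF zero_le_power power_half_series]) auto
  finally show "hausdorff_pre k \<delta> (\<Union>n. A n) \<le> (\<Sum>n. hausdorff_pre k \<delta> (A n)) + e" .
qed

lemma hausdorff_outer_mono: "A \<subseteq> B \<Longrightarrow> hausdorff_outer k A \<le> hausdorff_outer k B"
  unfolding hausdorff_outer_def by (intro SUP_mono) (auto intro: hausdorff_pre_mono)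

lemma hausdorff_outer_empty: "hausdorff_outer k {} = 0"
  by (simp add: hausdorff_outer_def hausdorff_pre_empty)

lemma hausdorff_outer_UN_le: "hausdorff_outer k (\<Union>n. A n) \<le> (\<Sum>n. hausdorff_outer k (A n))"
proof -
  have "hausdorff_pre k \<delta> (\<Union>n. A n) \<le> (\<Sum>n. hausdorff_outer k (A n))" if "0 < \<delta>" for \<delta>
    using that
    by (intro order_trans[OF hausdorff_pre_UN_le] suminf_le)
       (auto simp: hausdorff_outer_def intro: SUP_upper)
  then show ?thesis
    by (subst hausdorff_outer_def) (auto intro: SUP_least)
qed

lemma outer_measure_space_hausdorff: "outer_measure_space UNIV (hausdorff_outer k)"
  by (auto simp: outer_measure_space_def positive_def increasing_def countably_subadditive_def
      hausdorff_outer_empty hausdorff_outer_mono hausdorff_outer_UN_le)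

lemma measure_space_hausdorff:
  "measure_space UNIV (lambda_system UNIV UNIV (hausdorff_outer k)) (hausdorff_outer k)"
  by (rule sigma_algebra.caratheodory_lemma[OF sigma_algebra_Pow[of UNIV], unfolded Pow_UNIV])
     (rule outer_measure_space_hausdorff)

lemma space_hausdorff_measure [simp]: "space (hausdorff_measure k) = UNIV"
  by (simp add: hausdorff_measure_def space_measure_of_conv)

lemma sets_hausdorff_measure:
  "sets (hausdorff_measure k :: 'a::metric_space measure) = lambda_system UNIV UNIV (hausdorff_outer k)"
proof -
  have "sigma_algebra UNIV (lambda_system UNIV UNIV (hausdorff_outer k) :: 'a set set)"
    using measure_space_hausdorff[of k] unfolding measure_space_def by blast
  then show ?thesis
    unfolding hausdorff_measure_def by (rule sigma_algebra.sets_measure_of_eq)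
qed

lemma emeasure_hausdorff_measure:
  assumes "A \<in> sets (hausdorff_measure k)"
  shows "emeasure (hausdorff_measure k) A = hausdorff_outer k A"
proof (rule emeasure_measure_of[OF hausdorff_measure_def])
  show "countably_additive (sets (hausdorff_measure k)) (hausdorff_outer k)"
       "positive (sets (hausdorff_measure k)) (hausdorff_outer k)"
    using measure_space_hausdorff[of k] unfolding measure_space_def sets_hausdorff_measure by blast+
qed (use assms in auto)

lemma hausdorff_outer_Un_le:
  "hausdorff_outer k (A \<union> B) \<le> hausdorff_outer k A + hausdorff_outer k B"
proof -
  let ?F = "\<lambda>n::nat. if n = 0 then A else if n = 1 then B else {}"
  have "A \<union> B = (\<Union>n. ?F n)"
    by (auto split: if_splits)
  also have "hausdorff_outer k \<dots> \<le> (\<Sum>n. hausdorff_outer k (?F n))"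
    by (rule hausdorff_outer_UN_le)
  also have "\<dots> = (\<Sum>n\<in>{0,1}. hausdorff_outer k (?F n))"
    by (rule suminf_finite) (auto simp: hausdorff_outer_empty)
  finally show ?thesis by simp
qed

lemma hausdorff_pre_separated:
  fixes A B :: "'a::metric_space set"
  assumes "\<delta> < d" and sep: "\<And>a b. a \<in> A \<Longrightarrow> b \<in> B \<Longrightarrow> d \<le> dist a b" and "0 < \<delta>"
  shows "hausdorff_pre k \<delta> A + hausdorff_pre k \<delta> B \<le> hausdorff_pre k \<delta> (A \<union> B)"
  unfolding hausdorff_pre_def[of k \<delta> "A \<union> B"]
proof (rule INF_greatest)
  fix U :: "nat \<Rightarrow> 'a set"
  assume "U \<in> {U. A \<union> B \<subseteq> (\<Union>i. U i) \<and> (\<forall>i. bounded (U i) \<and> diameter (U i) \<le> \<delta>)}"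
  then have cov: "A \<union> B \<subseteq> (\<Union>i. U i)" and U: "\<And>i. bounded (U i)" "\<And>i. diameter (U i) \<le> \<delta>"
    by auto
  define V where "V S i = (if U i \<inter> S = {} then {} else U i)" for S i
  have V: "hausdorff_pre k \<delta> S \<le> (\<Sum>i. hausdorff_gauge k (V S i))" if "S \<subseteq> A \<union> B" for S
  proof (rule hausdorff_pre_le)
    show "S \<subseteq> (\<Union>i. V S i)"
    proof
      fix x assume "x \<in> S"
      with that cov obtain i where "x \<in> U i" by blast
      with \<open>x \<in> S\<close> show "x \<in> (\<Union>i. V S i)" by (auto simp: V_def intro!: exI[of _ i])
    qed
  qed (use U \<open>0 < \<delta>\<close> in \<open>auto simp: V_def\<close>)
  have "hausdorff_gauge k (V A i) + hausdorff_gauge k (V B i) \<le> hausdorff_gauge k (U i)" for i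
  proof -
    have "U i \<inter> A = {} \<or> U i \<inter> B = {}"
    proof (rule ccontr)
      assume "\<not> ?thesis"
      then obtain a b where "a \<in> A" "b \<in> B" "a \<in> U i" "b \<in> U i" by blast
      then show False
        using sep[of a b] diameter_bounded_bound[OF U(1), of a i b] U(2)[of i] \<open>\<delta> < d\<close> by simp
    qed
    then show ?thesis by (auto simp: V_def hausdorff_gauge_def)
  qed
  then have "(\<Sum>i. hausdorff_gauge k (V A i) + hausdorff_gauge k (V B i)) \<le> (\<Sum>i. hausdorff_gauge k (U i))"
    by (intro suminf_le) auto
  moreover have "(\<Sum>i. hausdorff_gauge k (V A i) + hausdorff_gauge k (V B i)) =
      (\<Sum>i. hausdorff_gauge k (V A i)) + (\<Sum>i. hausdorff_gauge k (V B i))"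
    by (intro suminf_add[symmetric]) auto
  ultimately show "hausdorff_pre k \<delta> A + hausdorff_pre k \<delta> B \<le> (\<Sum>i. hausdorff_gauge k (U i))"
    using add_mono[OF V[of A] V[of B]] by auto
qed

lemma hausdorff_outer_separated:
  fixes A B :: "'a::metric_space set"
  assumes "0 < d" and sep: "\<And>a b. a \<in> A \<Longrightarrow> b \<in> B \<Longrightarrow> d \<le> dist a b"
  shows "hausdorff_outer k A + hausdorff_outer k B \<le> hausdorff_outer k (A \<union> B)"
proof -
  have *: "hausdorff_pre k \<delta> A + hausdorff_pre k \<epsilon> B \<le> hausdorff_outer k (A \<union> B)"
    if "0 < \<delta>" "0 < \<epsilon>" for \<delta> \<epsilon>
  proof -
    define \<eta> where "\<eta> = min (min \<delta> \<epsilon>) (d / 2)"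
    have \<eta>: "0 < \<eta>" "\<eta> < d" "\<eta> \<le> \<delta>" "\<eta> \<le> \<epsilon>" using that \<open>0 < d\<close> by (auto simp: \<eta>_def)
    have "hausdorff_pre k \<delta> A + hausdorff_pre k \<epsilon> B \<le> hausdorff_pre k \<eta> A + hausdorff_pre k \<eta> B"
      using \<eta> by (intro add_mono hausdorff_pre_antimono)
    also have "\<dots> \<le> hausdorff_pre k \<eta> (A \<union> B)"
      using \<eta> sep by (intro hausdorff_pre_separated)
    also have "\<dots> \<le> hausdorff_outer k (A \<union> B)"
      unfolding hausdorff_outer_def using \<eta> by (intro SUP_upper) auto
    finally show ?thesis .
  qed
  have ne: "{0::real<..} \<noteq> {}" using greaterThan_non_empty by blast
  have "hausdorff_pre k \<delta> A + hausdorff_outer k B \<le> hausdorff_outer k (A \<union> B)" if "0 < \<delta>" for \<delta>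
  proof -
    have "hausdorff_pre k \<delta> A + hausdorff_outer k B =
        (SUP \<epsilon>\<in>{0<..}. hausdorff_pre k \<delta> A + hausdorff_pre k \<epsilon> B)"
      unfolding hausdorff_outer_def by (rule ennreal_SUP_add_right[OF ne])
    also have "\<dots> \<le> hausdorff_outer k (A \<union> B)"
      using that * by (intro SUP_least) auto
    finally show ?thesis .
  qed
  moreover have "hausdorff_outer k A + hausdorff_outer k B =
      (SUP \<delta>\<in>{0<..}. hausdorff_pre k \<delta> A + hausdorff_outer k B)"
    unfolding hausdorff_outer_def[of k A] by (rule ennreal_SUP_add_left[OF ne, symmetric])
  ultimately show ?thesis by (auto intro: SUP_least)
qed

lemma closed_in_sets_hausdorff_measure:
  fixes C :: "'a::metric_space set"
  assumes "closed C"
  shows "C \<in> sets (hausdorff_measure k)"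
proof -
  let ?H = "hausdorff_outer k :: 'a set \<Rightarrow> ennreal"
  have "?H (X \<inter> C) + ?H (X - C) \<le> ?H X" for X
  proof (cases "C = {} \<or> ?H X = top")
    case True
    then show ?thesis by (auto simp: hausdorff_outer_empty)
  next
    case False
    then have "C \<noteq> {}" and finX: "?H X < top" by (auto simp: less_top)
    define D where "D n = {x \<in> X. 1 / (real n + 1) \<le> infdist x C}" for n :: nat
    define R where "R n = D (Suc n) - D n" for n
    have DX: "D n \<subseteq> X" for n by (auto simp: D_def)
    have D_sep: "?H (X \<inter> C) + ?H (D n) \<le> ?H X" for n
    proof -
      have "?H (X \<inter> C) + ?H (D n) \<le> ?H ((X \<inter> C) \<union> D n)"
      proof (rule hausdorff_outer_separated)
        fix a b assume "a \<in> X \<inter> C" "b \<in> D n"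
        then show "1 / (real n + 1) \<le> dist a b"
          using infdist_le[of a C b] by (auto simp: D_def dist_commute)
      qed simp
      also have "\<dots> \<le> ?H X" using DX by (intro hausdorff_outer_mono) auto
      finally show ?thesis .
    qed
    have R_sum: "(\<Sum>i<N. ?H (R (2 * i + j))) \<le> ?H (\<Union>i<N. R (2 * i + j))" for N j
    proof (induction N)
      case (Suc N)
      have "(\<Sum>i<Suc N. ?H (R (2 * i + j))) \<le> ?H (\<Union>i<N. R (2 * i + j)) + ?H (R (2 * N + j))"
        using Suc.IH by (simp add: add_right_mono)
      also have "\<dots> \<le> ?H ((\<Union>i<N. R (2 * i + j)) \<union> R (2 * N + j))"
      proof (cases "N = 0")
        case False
        show ?thesis
        proof (rule hausdorff_outer_separated)
          let ?d = "1 / real (2 * N + j) - 1 / (real (2 * N + j) + 1)"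
          have "1 / (real (2 * N + j) + 1) < 1 / real (2 * N + j)"
            using False by (intro frac_less2) auto
          then show "0 < ?d" by simp
          fix a b assume a: "a \<in> (\<Union>i<N. R (2 * i + j))" and b: "b \<in> R (2 * N + j)"
          from a obtain i where i: "i < N" "a \<in> D (Suc (2 * i + j))" by (auto simp: R_def)
          have "1 / real (2 * N + j) \<le> 1 / (real (Suc (2 * i + j)) + 1)"
            using i(1) by (intro divide_left_mono) auto
          also have "\<dots> \<le> infdist a C" using i(2) by (auto simp: D_def)
          also have "\<dots> \<le> infdist b C + dist a b" by (rule infdist_triangle)
          also have "infdist b C \<le> 1 / (real (2 * N + j) + 1)"
            using b by (auto simp: R_def D_def)
          finally show "?d \<le> dist a b" by simp
        qed
      qed (simp add: hausdorff_outer_empty)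
      also have "(\<Union>i<N. R (2 * i + j)) \<union> R (2 * N + j) = (\<Union>i<Suc N. R (2 * i + j))"
        by (auto simp: lessThan_Suc)
      finally show ?case .
    qed (simp add: hausdorff_outer_empty)
    have R_sum': "(\<Sum>i<N. ?H (R (2 * i + j))) \<le> ?H X" for N j
      by (rule order_trans[OF R_sum hausdorff_outer_mono]) (use DX in \<open>auto simp: R_def\<close>)
    have "(\<Sum>i<N. ?H (R i)) \<le> ?H X + ?H X" for N
    proof -
      have "(\<Sum>i<N. ?H (R i)) \<le> (\<Sum>i<2 * N. ?H (R i))"
        by (intro sum_mono2) auto
      also have "\<dots> = (\<Sum>i<N. ?H (R (2 * i + 0))) + (\<Sum>i<N. ?H (R (2 * i + 1)))"
        by (induction N) (simp_all add: add_ac)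
      also have "\<dots> \<le> ?H X + ?H X" by (intro add_mono R_sum')
      finally show ?thesis .
    qed
    then have "(\<Sum>i. ?H (R i)) \<le> ?H X + ?H X" by (intro suminf_le_const) auto
    also have "\<dots> < top" using finX by simp
    finally have fin: "(\<Sum>i. ?H (R i)) < top" .
    have XC: "X - C \<subseteq> D N \<union> (\<Union>i. R (i + N))" for N
    proof
      fix x assume x: "x \<in> X - C"
      then have "0 < infdist x C"
        using \<open>closed C\<close> \<open>C \<noteq> {}\<close> by (simp add: infdist_pos_not_in_closed)
      then obtain m where m: "inverse (real (Suc m)) < infdist x C" using reals_Archimedean by blast
      define M where "M = (LEAST m. x \<in> D m)"
      have "x \<in> D m" using m x by (simp add: D_def inverse_eq_divide add.commute)
      then have M: "x \<in> D M" "\<And>i. i < M \<Longrightarrow> x \<notin> D i"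
        unfolding M_def by (rule LeastI, use not_less_Least in blast)
      show "x \<in> D N \<union> (\<Union>i. R (i + N))"
      proof (cases "M \<le> N")
        case True
        then have "1 / (real N + 1) \<le> 1 / (real M + 1)" by (simp add: field_simps)
        also have "\<dots> \<le> infdist x C" using M(1) by (simp add: D_def)
        finally have "x \<in> D N" using x by (simp add: D_def)
        then show ?thesis by simp
      next
        case False
        then have "x \<in> R ((M - 1 - N) + N)" using M by (simp add: R_def)
        then show ?thesis by blast
      qed
    qed
    have tail: "?H (X \<inter> C) + ?H (X - C) \<le> ?H X + (\<Sum>i. ?H (R (i + N)))" for N
    proof -
      have "?H (X - C) \<le> ?H (D N) + (\<Sum>i. ?H (R (i + N)))"
        by (rule order_trans[OF hausdorff_outer_mono[OF XC[of N]]],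
            rule order_trans[OF hausdorff_outer_Un_le add_left_mono[OF hausdorff_outer_UN_le]])
      then have "?H (X \<inter> C) + ?H (X - C) \<le> (?H (X \<inter> C) + ?H (D N)) + (\<Sum>i. ?H (R (i + N)))"
        by (simp add: add.assoc add_left_mono)
      also have "\<dots> \<le> ?H X + (\<Sum>i. ?H (R (i + N)))" by (intro add_right_mono D_sep)
      finally show ?thesis .
    qed
    have g: "summable (\<lambda>i. enn2real (?H (R i)))" and R_eq: "\<And>i. ?H (R i) = ennreal (enn2real (?H (R i)))"
    proof -
      show eq: "?H (R i) = ennreal (enn2real (?H (R i)))" for i
        using ennreal_suminf_lessD[OF fin, of i] by simp
      show "summable (\<lambda>i. enn2real (?H (R i)))"
        by (rule summable_suminf_not_top) (use fin eq in auto)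
    qed
    have "(\<lambda>N. ?H X + ennreal (\<Sum>i. enn2real (?H (R (i + N))))) \<longlonglongrightarrow> ?H X + ennreal 0"
      by (intro tendsto_add tendsto_const tendsto_ennrealI suminf_exist_split2 g)
    moreover have "(\<Sum>i. ?H (R (i + N))) = ennreal (\<Sum>i. enn2real (?H (R (i + N))))" for N
      using R_eq suminf_ennreal2[OF _ summable_ignore_initial_segment[OF g, of N]] by simp
    ultimately have "(\<lambda>N. ?H X + (\<Sum>i. ?H (R (i + N)))) \<longlonglongrightarrow> ?H X" by simp
    then show ?thesis by (rule LIMSEQ_le_const) (use tail in blast)
  qed
  moreover have "?H X \<le> ?H (X \<inter> C) + ?H (X - C)" for X
    using hausdorff_outer_Un_le[of k "X \<inter> C" "X - C"] by (simp add: Int_Diff_Un)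
  ultimately have "?H (X \<inter> C) + ?H (X - C) = ?H X" for X by (simp add: antisym)
  then show ?thesis
    by (simp add: sets_hausdorff_measure lambda_system_def Int_commute Diff_eq Int_ac)
qed

lemma borel_subset_sets_hausdorff_measure: "sets borel \<subseteq> sets (hausdorff_measure k :: 'a::metric_space measure)"
proof -
  have "sets borel = sigma_sets UNIV {C :: 'a set. closed C}"
    unfolding borel_eq_closed by (rule sets_measure_of) simp
  also have "\<dots> \<subseteq> sets (hausdorff_measure k)"
    using sets.sigma_sets_subset[of "{C. closed C}" "hausdorff_measure k :: 'a measure"]
      closed_in_sets_hausdorff_measure by auto
  finally show ?thesis .
qed

lemma emeasure_surface_measure:
  fixes A :: "'a::euclidean_space set"
  assumes "A \<in> sets borel" "A \<subseteq> sphere 0 1"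
  shows "emeasure surface_measure A = hausdorff_outer (DIM('a) - 1) A"
proof -
  have "A \<in> sets (hausdorff_measure (DIM('a) - 1))"
       "sphere 0 1 \<in> sets (hausdorff_measure (DIM('a) - 1) :: 'a measure)"
    using assms borel_subset_sets_hausdorff_measure[of "DIM('a) - 1"]
    by (auto intro: closed_in_sets_hausdorff_measure)
  then show ?thesis
    unfolding surface_measure_def
    using assms by (simp add: emeasure_restrict_space emeasure_hausdorff_measure)
qed

text \<open>Powers of extended nonnegative reals with a positive exponent.\<close>

definition ennpowr :: "ennreal \<Rightarrow> real \<Rightarrow> ennreal" where
  "ennpowr x a = (if x = top then top else ennreal (enn2real x powr a))"

definition lorentz_norm :: "'a measure \<Rightarrow> real \<Rightarrow> real \<Rightarrow> ('a \<Rightarrow> real) \<Rightarrow> ennreal" where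
  "lorentz_norm M p q g =
     ennpowr (ennreal p * (\<integral>\<^sup>+t\<in>{0<..}. ennreal (t powr q) *
        ennpowr (emeasure M {x \<in> space M. t < \<bar>g x\<bar>}) (q / p) * ennreal (1 / t) \<partial>lborel)) (1 / q)"

definition lorentz_space :: "'a measure \<Rightarrow> real \<Rightarrow> real \<Rightarrow> ('a \<Rightarrow> real) set" where
  "lorentz_space M p q = {g \<in> borel_measurable M. lorentz_norm M p q g < top}"

text \<open>
  \<open>C\<^sup>k\<close> functions via partial derivatives: \<open>frechet_derivative f (at x) b\<close> is the derivative of
  \<open>f\<close> at \<open>x\<close> in the direction \<open>b\<close>.
\<close>

fun C_diff :: "nat \<Rightarrow> ('a::euclidean_space \<Rightarrow> real) \<Rightarrow> bool" where
  "C_diff 0 f \<longleftrightarrow> continuous_on UNIV f"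
| "C_diff (Suc k) f \<longleftrightarrow> (\<forall>x. f differentiable at x) \<and>
     (\<forall>b\<in>Basis. C_diff k (\<lambda>x. frechet_derivative f (at x) b))"

definition test_functions :: "('a::euclidean_space \<Rightarrow> real) set" where
  "test_functions = {f. (\<forall>k. C_diff k f) \<and> compact (closure {x. f x \<noteq> 0})}"

definition grad :: "('a::real_inner \<Rightarrow> real) \<Rightarrow> 'a \<Rightarrow> 'a" where
  "grad f x = (THE D. GDERIV f x :> D)"

text \<open>
  The kernel has degree \<open>\<alpha> - n - 1\<close>, one more singular than the fractional integral of order
  \<open>\<alpha>\<close>. The integral is taken over \<^const>\<open>lebesgue\<close> rather than \<^const>\<open>lborel\<close> because \<open>\<Omega>\<close> need
  not be Borel measurable. For \<open>\<alpha> > 0\<close>, integrable mean-zero \<open>\<Omega>\<close> and test functions \<open>f\<close>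
  the limit exists at every \<open>x\<close>.
\<close>

definition rough_op ::
  "('a::euclidean_space \<Rightarrow> real) \<Rightarrow> real \<Rightarrow> ('a \<Rightarrow> real) \<Rightarrow> 'a \<Rightarrow> real" where
  "rough_op \<Omega> \<alpha> f x = Lim (at_right 0) (\<lambda>\<epsilon>.
     LINT y:{y. \<epsilon> < norm y}|lebesgue.
       \<Omega> (y /\<^sub>R norm y) / norm y powr (real DIM('a) + 1 - \<alpha>) * f (x - y))"

end

theory Submission
  imports Defs
begin

text \<open>
  Write \<open>n\<close> for the dimension, \<open>K(y) = \<Omega>(y/|y|) |y|^(\<alpha>-n-1)\<close> for the kernel of the operator \<open>T\<close> and \<open>g\<close>
  for the norm of the gradient of \<open>f\<close>. The kernel is one degree too singular to be a fractional
  integral of \<open>f\<close>; the mean-zero condition buys this degree back at the price of one derivative.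

  For fixed \<open>x\<close> let \<open>m(t)\<close> be the average of \<open>f(x - \<cdot>)\<close> over the ball of radius \<open>t\<close>. Since \<open>\<Omega>\<close> has mean
  zero, \<open>K\<close> is orthogonal to radial functions on every shell, so \<open>f(x - y)\<close> may be replaced by
  \<open>f(x - y) - m(|y|)\<close>. The representation formula behind the Poincare inequality (\<open>Poincare_potential\<close>) bounds
  this difference by a multiple of the integral of \<open>g(x - v) |v - y|^(1-n)\<close> over \<open>|v| \<le> |y|\<close>, and
  exchanging the integrals yields, uniformly in the truncation,
  \<open>|T f(x)| \<le> C \<integral> g(x - v) H(v) dv\<close> with
  \<open>H(v) = \<integral> |\<Omega>(y/|y|)| |y|^(\<alpha>-n-1) |v - y|^(1-n) dy\<close> over \<open>|y| \<ge> |v|\<close>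
  (\<open>rough_op_le_majorant\<close>). The kernel \<open>H\<close> is homogeneous of degree \<open>\<alpha> - n\<close>, and its restriction to a shell is
  a convolution of \<open>\<Omega>\<close> with \<open>|\<cdot>|^(1-n)\<close> up to a bounded term, hence has more integrability than \<open>\<Omega>\<close> by
  Young's inequality (\<open>majorant_power_integrable\<close>).

  All conditions on \<open>p\<close> and \<open>lam\<close> are strict, which leaves room to vary the exponents.
  The function \<open>\<Omega>\<close> lies in \<open>L^\<rho>\<close> for every \<open>\<rho> < r\<close>, and for \<open>\<rho>\<close> close to \<open>r\<close> the kernel \<open>H\<close> is locally in \<open>L^S\<close> with an
  exponent \<open>S\<close> slightly below \<open>n r / (n - r)\<close> that still satisfies \<open>S > p'\<close> and \<open>lam < n/p' - n/S\<close>.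

  It remains to bound convolution with a homogeneous kernel between weighted spaces (\<open>weighted_bound\<close>).
  Where \<open>|x|\<close> and \<open>|w|\<close> are comparable the weights cancel, and the bound is the Hardy--Littlewood--Sobolev
  inequality (\<open>nn_integral_weak_Young\<close>). Where \<open>|w| < |x|/2\<close> or \<open>|x| < |w|/2\<close> the kernel is not singular, and
  Hoelder's inequality with a small power of \<open>|w|/|x|\<close> split off suffices (\<open>nn_integral_Schur\<close>).

  The surface measure enters only through polar coordinates. It is proportional to the measure \<open>A \<mapsto> |cone over A|\<close>
  because both measures are invariant under reflections, which makes them uniformly distributed on the sphere,
  and uniformly distributed measures are proportional (\<open>uniform_measures_proportional\<close>).
\<close>

section \<open>Powers and Hoelder's inequality for extended reals\<close>

lemma ennpowr_ennreal: "0 \<le> x \<Longrightarrow> ennpowr (ennreal x) a = ennreal (x powr a)"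
  by (simp add: ennpowr_def)

lemma ennpowr_top [simp]: "ennpowr top a = top"
  by (simp add: ennpowr_def)

lemma ennpowr_0 [simp]: "ennpowr 0 a = 0"
  by (simp add: ennpowr_def)

lemma ennpowr_mono: "0 \<le> a \<Longrightarrow> x \<le> y \<Longrightarrow> ennpowr x a \<le> ennpowr y a"
  by (cases x; cases y) (auto simp: ennpowr_ennreal top_unique intro!: ennreal_leI powr_mono2)

lemma ennpowr_mult: "ennpowr (x * y) a = ennpowr x a * ennpowr y a"
  by (cases x; cases y)
     (auto simp: ennpowr_ennreal ennreal_mult[symmetric] powr_mult ennreal_top_mult ennreal_mult_top
       ennpowr_def)

lemma ennpowr_ennpowr: "ennpowr (ennpowr x a) b = ennpowr x (a * b)"
  by (cases x) (auto simp: ennpowr_ennreal powr_powr)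

lemma ennpowr_1 [simp]: "ennpowr x 1 = x"
  by (cases x) (auto simp: ennpowr_ennreal)

lemma ennpowr_plus: "ennpowr x (a + b) = ennpowr x a * ennpowr x b"
  by (cases x) (auto simp: ennpowr_ennreal powr_add ennreal_mult ennreal_mult_top)

lemma ennpowr_less_top: "x < top \<Longrightarrow> ennpowr x a < top"
  by (cases x) (auto simp: ennpowr_ennreal)

lemma borel_measurable_ennpowr [measurable]:
  assumes [measurable]: "f \<in> borel_measurable M"
  shows "(\<lambda>x. ennpowr (f x) a) \<in> borel_measurable M"
  unfolding ennpowr_def by measurable

lemma ennpowr_add_le:
  assumes "0 \<le> a"
  shows "ennpowr (x + y) a \<le> ennreal (2 powr a) * (ennpowr x a + ennpowr y a)"
proof -
  have "x + y \<le> ennreal 2 * max x y"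
    by (simp add: mult_2 add_mono)
  then have "ennpowr (x + y) a \<le> ennpowr (ennreal 2 * max x y) a"
    using assms by (rule ennpowr_mono[rotated])
  also have "\<dots> = ennreal (2 powr a) * ennpowr (max x y) a"
    by (simp only: ennpowr_mult ennpowr_ennreal)
  also have "ennpowr (max x y) a \<le> ennpowr x a + ennpowr y a"
    by (auto simp: max_def)
  finally show ?thesis by (simp add: mult_left_mono)
qed

lemma nn_integral_powr_from_0:
  assumes "-1 < a" "0 \<le> c"
  shows "(\<integral>\<^sup>+t. ennreal (t powr a) * indicator {0..c} t \<partial>lborel) = ennreal (c powr (a + 1) / (a + 1))"
proof -
  have "((\<lambda>t. if t \<in> {0..c} then t powr a else 0) has_integral (c powr (a + 1) / (a + 1))) UNIV"
    using has_integral_powr_from_0[OF assms] by (simp only: has_integral_restrict_UNIV)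
  from nn_integral_has_integral_lborel[OF _ _ this] show ?thesis
    by (simp add: indicator_def of_bool_def if_distrib cong: if_cong)
qed

lemma nn_integral_powr_to_inf:
  assumes "a < -1" "0 < c"
  shows "(\<integral>\<^sup>+t. ennreal (t powr a) * indicator {c..} t \<partial>lborel) = ennreal (c powr (a + 1) / -(a + 1))"
proof -
  have "((\<lambda>t. if t \<in> {c..} then t powr a else 0) has_integral (- (c powr (a + 1)) / (a + 1))) UNIV"
    using has_integral_powr_to_inf[OF assms] by (simp only: has_integral_restrict_UNIV)
  from nn_integral_has_integral_lborel[OF _ _ this] show ?thesis
    by (simp add: indicator_def of_bool_def if_distrib minus_divide_right cong: if_cong)
qed

lemma eq_top_if_ge_all:
  assumes "\<And>K::real. ennreal K \<le> X"
  shows "X = top"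
proof (cases X)
  case (real r)
  then show ?thesis using assms[of "r + 1"] by (simp add: ennreal_le_iff)
qed

text \<open>
  The layer-cake formula at a single value; it includes the value \<open>\<top>\<close>, where the integral diverges.
\<close>

lemma ennpowr_layer_cake:
  assumes "0 < q"
  shows "ennpowr x q = (\<integral>\<^sup>+t. ennreal (q * t powr (q - 1)) * indicator {t. 0 < t \<and> ennreal t < x} t \<partial>lborel)"
proof (cases x)
  case (real y)
  have "AE t in lborel. t \<noteq> 0 \<and> t \<noteq> y" using AE_lborel_singleton[of 0] AE_lborel_singleton[of y] by auto
  then have "(\<integral>\<^sup>+t. ennreal (q * t powr (q - 1)) * indicator {t. 0 < t \<and> ennreal t < x} t \<partial>lborel)
    = (\<integral>\<^sup>+t. ennreal q * (ennreal (t powr (q - 1)) * indicator {0..y} t) \<partial>lborel)"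
    using assms real by (intro nn_integral_cong_AE) (elim eventually_mono, auto simp: indicator_def ennreal_mult ennreal_less_iff)
  also have "\<dots> = ennreal q * ennreal (y powr q / q)"
    using assms real nn_integral_powr_from_0[of "q - 1" y] by (simp add: nn_integral_cmult)
  also have "\<dots> = ennpowr x q"
    using assms real by (simp add: ennpowr_ennreal flip: ennreal_mult)
  finally show ?thesis by simp
next
  case top
  have "ennreal (real m powr q) \<le> (\<integral>\<^sup>+t. ennreal (q * t powr (q - 1)) * indicator {t. 0 < t \<and> ennreal t < x} t \<partial>lborel)" for m :: nat
  proof -
    have "ennreal (real m powr q) = ennreal q * ennreal (real m powr q / q)"
      using assms by (simp flip: ennreal_mult)
    also have "\<dots> = (\<integral>\<^sup>+t. ennreal q * (ennreal (t powr (q - 1)) * indicator {0..real m} t) \<partial>lborel)"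
      using assms nn_integral_powr_from_0[of "q - 1" "real m"] by (simp add: nn_integral_cmult)
    also have "\<dots> \<le> (\<integral>\<^sup>+t. ennreal (q * t powr (q - 1)) * indicator {t. 0 < t \<and> ennreal t < x} t \<partial>lborel)"
      using assms top AE_lborel_singleton[of "0::real"]
      by (intro nn_integral_mono_AE) (auto elim!: eventually_mono simp: indicator_def ennreal_mult)
    finally show ?thesis .
  qed
  moreover have "\<exists>m::nat. K \<le> real m powr q" for K :: real
  proof -
    obtain m :: nat where m: "max 1 K powr (1 / q) \<le> real m" using real_arch_simple by blast
    have "K \<le> (max 1 K powr (1 / q)) powr q" using assms by (simp add: powr_powr)
    also have "\<dots> \<le> real m powr q" using m assms by (intro powr_mono2) auto
    finally show ?thesis by blast
  qed
  ultimately have "ennreal K \<le> (\<integral>\<^sup>+t. ennreal (q * t powr (q - 1)) * indicator {t. 0 < t \<and> ennreal t < x} t \<partial>lborel)" for K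
    by (meson ennreal_leI order_trans)
  then have "(\<integral>\<^sup>+t. ennreal (q * t powr (q - 1)) * indicator {t. 0 < t \<and> ennreal t < x} t \<partial>lborel) = top"
    by (rule eq_top_if_ge_all)
  then show ?thesis using top by simp
qed

lemma Young_ineq:
  fixes a b p p' :: real
  assumes "0 \<le> a" "0 \<le> b" "1 < p" "1 / p + 1 / p' = 1"
  shows "a * b \<le> a powr p / p + b powr p' / p'"
proof (cases "a = 0 \<or> b = 0")
  case True
  have "p' > 0" using assms by (smt (verit) divide_less_eq_1_pos zero_less_divide_1_iff)
  then show ?thesis using True assms by auto
next
  case False
  then have ab: "a > 0" "b > 0" using assms by auto
  have p': "1 / p' = 1 - 1 / p" using assms by simp
  have p0: "p' > 0" using assms by (smt (verit) divide_less_eq_1_pos zero_less_divide_1_iff)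
  have "1 / p' < 1" unfolding p' using assms(3) by simp
  then have p1: "1 \<le> p'" using p0 by (simp add: divide_less_eq)
  have "exp ((1 - 1 / p') * (p * ln a) + (1 / p') * (p' * ln b)) \<le> (1 - 1 / p') * exp (p * ln a) + (1 / p') * exp (p' * ln b)"
    by (rule convex_onD[OF exp_convex, simplified]) (use assms p0 p1 in auto)
  moreover have e: "(1 - 1 / p') = 1 / p" using p' by simp
  moreover have "exp ((1 / p) * (p * ln a) + (1 / p') * (p' * ln b)) = a * b"
    using ab assms p0 by (simp add: exp_add)
  ultimately show ?thesis using ab unfolding e by (simp add: powr_def)
qed

text \<open>
  Young's inequality for products, applied to the functions divided by their norms. If one norm
  vanishes, the left-hand side vanishes as well, and if one is infinite, the claim is trivial.
\<close>

lemma nn_integral_Holder: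
  fixes F G :: "'a \<Rightarrow> real"
  assumes [measurable]: "F \<in> borel_measurable M" "G \<in> borel_measurable M"
    and nn: "\<And>x. 0 \<le> F x" "\<And>x. 0 \<le> G x" and p: "1 < p" "1 / p + 1 / p' = 1"
  shows "(\<integral>\<^sup>+x. ennreal (F x * G x) \<partial>M)
     \<le> ennpowr (\<integral>\<^sup>+x. ennreal (F x powr p) \<partial>M) (1 / p) * ennpowr (\<integral>\<^sup>+x. ennreal (G x powr p') \<partial>M) (1 / p')"
    (is "?L \<le> ennpowr ?A _ * ennpowr ?B _")
proof -
  have p': "p' > 0" using p by (smt (verit) divide_less_eq_1_pos zero_less_divide_1_iff)
  consider "?A = 0 \<or> ?B = 0" | "?A \<noteq> 0" "?B \<noteq> 0" "?A = top \<or> ?B = top" | a b where "?A = ennreal a" "?B = ennreal b" "a > 0" "b > 0"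
    by (cases ?A; cases ?B) (auto simp: order_less_le)
  then show ?thesis
  proof cases
    case 1
    then have "(AE x in M. F x = 0) \<or> (AE x in M. G x = 0)"
      by (auto simp: nn_integral_0_iff_AE)
    then have "AE x in M. ennreal (F x * G x) = 0" by (auto elim!: eventually_mono)
    then have "?L = 0" by (subst nn_integral_0_iff_AE) auto
    then show ?thesis by simp
  next
    case 2
    have "ennpowr x c = 0 \<longleftrightarrow> x = 0" for x c
      by (cases x) (auto simp: ennpowr_ennreal ennreal_eq_0_iff)
    with 2 show ?thesis by (auto simp: ennreal_mult_eq_top_iff ennreal_mult_top ennreal_top_mult)
  next
    case 3
    define s where "s = a powr (1 / p)"
    define t where "t = b powr (1 / p')"
    have st: "s > 0" "t > 0" using 3 by (auto simp: s_def t_def)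
    have "?L \<le> (\<integral>\<^sup>+x. ennreal (s * t / p / a) * ennreal (F x powr p) + ennreal (s * t / p' / b) * ennreal (G x powr p') \<partial>M)"
    proof (rule nn_integral_mono)
      fix x
      have "F x * G x = s * t * ((F x / s) * (G x / t))" using st by simp
      also have "\<dots> \<le> s * t * ((F x / s) powr p / p + (G x / t) powr p' / p')"
        using st nn p by (intro mult_left_mono Young_ineq) auto
      also have "\<dots> = s * t / p / a * F x powr p + s * t / p' / b * G x powr p'"
        using 3 nn p p' st by (simp add: powr_divide s_def t_def powr_powr field_simps)
      finally show "ennreal (F x * G x) \<le> ennreal (s * t / p / a) * ennreal (F x powr p) + ennreal (s * t / p' / b) * ennreal (G x powr p')"
        using st p p' 3 by (simp flip: ennreal_mult ennreal_plus add: ennreal_leI)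
    qed
    also have "\<dots> = ennreal (s * t / p / a) * ?A + ennreal (s * t / p' / b) * ?B"
      by (simp add: nn_integral_add nn_integral_cmult)
    also have "\<dots> = ennreal (s * t / p / a * a + s * t / p' / b * b)"
      using 3 st p p' by (simp flip: ennreal_mult ennreal_plus)
    also have "s * t / p / a * a + s * t / p' / b * b = s * t * (1 / p + 1 / p')"
      using 3 by (simp add: field_simps)
    also have "\<dots> = s * t" using p by simp
    also have "ennreal (s * t) = ennpowr ?A (1 / p) * ennpowr ?B (1 / p')"
      using 3 by (simp add: s_def t_def ennpowr_ennreal ennreal_mult)
    finally show ?thesis .
  qed
qed

section \<open>Polar integration of homogeneous functions\<close>

lemma nn_integral_lborel_affine:
  fixes f :: "'a::euclidean_space \<Rightarrow> ennreal"
  assumes [measurable]: "f \<in> borel_measurable borel" and "c \<noteq> 0"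
  shows "(\<integral>\<^sup>+x. f x \<partial>lborel) = ennreal (\<bar>c\<bar> ^ DIM('a)) * (\<integral>\<^sup>+x. f (t + c *\<^sub>R x) \<partial>lborel)"
  by (subst lborel_affine[OF \<open>c \<noteq> 0\<close>, of t])
     (simp add: nn_integral_density nn_integral_distr nn_integral_cmult)

lemma nn_integral_lborel_reflect:
  fixes f :: "'a::euclidean_space \<Rightarrow> ennreal"
  assumes "f \<in> borel_measurable borel"
  shows "(\<integral>\<^sup>+w. f (x - w) \<partial>lborel) = (\<integral>\<^sup>+v. f v \<partial>lborel)"
  using nn_integral_lborel_affine[OF assms, of "-1" x] by simp

text \<open>
  Homogeneity of degree 0 away from the origin; the value at the origin is arbitrary, being irrelevant for integration.
\<close>

definition homogeneous0 :: "('a::real_vector \<Rightarrow> 'b) \<Rightarrow> bool" where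
  "homogeneous0 \<Phi> \<longleftrightarrow> (\<forall>c>0. \<forall>v. \<Phi> (c *\<^sub>R v) = \<Phi> v)"

lemma homogeneous0D: "homogeneous0 \<Phi> \<Longrightarrow> 0 < c \<Longrightarrow> \<Phi> (c *\<^sub>R v) = \<Phi> v"
  by (auto simp: homogeneous0_def)

lemma nn_integral_homogeneous_cball:
  fixes \<Phi> :: "'a::euclidean_space \<Rightarrow> ennreal"
  assumes [measurable]: "\<Phi> \<in> borel_measurable borel" and hom: "homogeneous0 \<Phi>" and "0 < R"
  shows "(\<integral>\<^sup>+v. \<Phi> v * indicator {v. norm v \<le> R} v \<partial>lborel)
     = ennreal (R ^ DIM('a)) * (\<integral>\<^sup>+v. \<Phi> v * indicator {v. norm v \<le> 1} v \<partial>lborel)"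
proof -
  have "(\<integral>\<^sup>+v. \<Phi> v * indicator {v. norm v \<le> R} v \<partial>lborel)
      = ennreal (R ^ DIM('a)) * (\<integral>\<^sup>+v. \<Phi> (0 + R *\<^sub>R v) * indicator {v. norm v \<le> R} (0 + R *\<^sub>R v) \<partial>lborel)"
    using \<open>0 < R\<close> by (subst nn_integral_lborel_affine[of _ R 0]) auto
  also have "(\<lambda>v::'a. \<Phi> (0 + R *\<^sub>R v) * indicator {v. norm v \<le> R} (0 + R *\<^sub>R v)) = (\<lambda>v. \<Phi> v * indicator {v. norm v \<le> 1} v)"
    using \<open>0 < R\<close> homogeneous0D[OF hom, of R] by (auto simp: fun_eq_iff indicator_def)
  finally show ?thesis .
qed

text \<open>
  The radial distribution of a homogeneous density is determined by one number, the mass of the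
  unit ball: by scaling, the ball of radius \<open>b\<close> has mass \<open>b^n\<close> times that of the unit ball, and measures on the line
  are determined by the half-lines. As an identity of measures it also applies to signed radial integrands.
\<close>

theorem distr_norm_homogeneous:
  fixes \<Phi> :: "'a::euclidean_space \<Rightarrow> ennreal"
  assumes [measurable]: "\<Phi> \<in> borel_measurable borel" and hom: "homogeneous0 \<Phi>"
    and fin: "(\<integral>\<^sup>+v. \<Phi> v * indicator {v. norm v \<le> 1} v \<partial>lborel) < top"
  shows "distr (density lborel \<Phi>) borel norm =
    density lborel (\<lambda>t::real. (\<integral>\<^sup>+v. \<Phi> v * indicator {v. norm v \<le> 1} v \<partial>lborel)
      * ennreal (real DIM('a) * t powr (real DIM('a) - 1)) * indicator {0<..} t)" (is "?M = ?N")
proof -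
  define \<Lambda> where "\<Lambda> = (\<integral>\<^sup>+v. \<Phi> v * indicator {v. norm v \<le> 1} v \<partial>lborel)"
  have DIM: "real DIM('a) > 0" "DIM('a) > 0" by auto
  have eM: "emeasure ?M {..b} = (\<integral>\<^sup>+v. \<Phi> v * indicator {v. norm v \<le> b} v \<partial>lborel)" for b
  proof -
    have "norm -` {..b} = {v::'a. norm v \<le> b}" by auto
    then show ?thesis by (subst emeasure_distr) (simp_all add: emeasure_density)
  qed
  have eN: "emeasure ?N {..b} = ennreal (b ^ DIM('a)) * \<Lambda>" if "b \<ge> 0" for b
  proof -
    have "emeasure ?N {..b} = (\<integral>\<^sup>+t. \<Lambda> * (ennreal (real DIM('a)) * (ennreal (t powr (real DIM('a) - 1)) * indicator {0..b} t)) \<partial>lborel)"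
      unfolding \<Lambda>_def[symmetric]
      using AE_lborel_singleton[of "0::real"]
      by (subst emeasure_density) (auto intro!: nn_integral_cong_AE elim!: eventually_mono simp: indicator_def ennreal_mult mult.assoc)
    also have "\<dots> = \<Lambda> * (ennreal (real DIM('a)) * ennreal (b powr (real DIM('a)) / real DIM('a)))"
      using nn_integral_powr_from_0[of "real DIM('a) - 1" b] that DIM by (simp add: nn_integral_cmult)
    also have "\<dots> = \<Lambda> * ennreal (b powr (real DIM('a)))"
      using DIM by (simp flip: ennreal_mult)
    also have "b powr (real DIM('a)) = b ^ DIM('a)"
      using that DIM by (cases "b = 0") (auto simp: powr_realpow)
    finally show ?thesis by (simp add: mult.commute)
  qed
  have eN0: "emeasure ?N {..b} = 0" if "b < 0" for b
    using that by (subst emeasure_density) (auto simp: nn_integral_0_iff_AE indicator_def)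
  have eq: "emeasure ?M {..b} = emeasure ?N {..b}" for b
  proof -
    consider "b < 0" | "b = 0" | "b > 0" by linarith
    then show ?thesis
    proof cases
      case 1
      then have "norm v \<le> b \<longleftrightarrow> False" for v :: 'a by (smt (verit) norm_ge_zero)
      then show ?thesis using 1 by (simp add: eM eN0)
    next
      case 2
      have "(\<integral>\<^sup>+v. \<Phi> v * indicator {v. norm v \<le> b} v \<partial>lborel) = 0"
        using 2 AE_lborel_singleton[of "0::'a"] by (subst nn_integral_0_iff_AE) (auto elim!: eventually_mono)
      then show ?thesis using 2 DIM by (simp add: eM eN)
    next
      case 3
      then show ?thesis unfolding eM using nn_integral_homogeneous_cball[OF assms(1,2) 3] eN[of b] by (simp add: \<Lambda>_def)
    qed
  qed
  show ?thesis
  proof (rule measure_eqI_generator_eq[where E="range (\<lambda>b::real. {..b})" and A="\<lambda>i::nat. {..real i}" and \<Omega>=UNIV])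
    show "Int_stable (range (\<lambda>b::real. {..b}))"
      by (auto simp: Int_stable_def)
    show "sets ?M = sigma_sets UNIV (range (\<lambda>b::real. {..b}))" "sets ?N = sigma_sets UNIV (range (\<lambda>b::real. {..b}))"
      by (simp_all add: borel_eq_atMost)
    show "emeasure ?M X = emeasure ?N X" if "X \<in> range (\<lambda>b. {..b})" for X using that eq by auto
    show "(\<Union>i::nat. {..real i}) = UNIV" by (auto intro: real_arch_simple)
    show "emeasure ?M {..real i} \<noteq> \<infinity>" for i
      unfolding eq eN[OF of_nat_0_le_iff] using fin by (auto simp: \<Lambda>_def ennreal_mult_eq_top_iff)
  qed auto
qed

text \<open>Polar integration.\<close>

text \<open>
  Finite mass is needed to compare measures on half-lines, so \<open>\<Phi>\<close> is first truncated at \<open>N\<close>, which preserves homogeneity.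
\<close>

theorem nn_integral_polar:
  fixes \<Phi> :: "'a::euclidean_space \<Rightarrow> ennreal"
  assumes [measurable]: "\<Phi> \<in> borel_measurable borel" "h \<in> borel_measurable borel" and hom: "homogeneous0 \<Phi>"
  shows "(\<integral>\<^sup>+v. \<Phi> v * h (norm v) \<partial>lborel) = (\<integral>\<^sup>+v. \<Phi> v * indicator {v. norm v \<le> 1} v \<partial>lborel)
      * (\<integral>\<^sup>+t. ennreal (real DIM('a) * t powr (real DIM('a) - 1)) * indicator {0<..} t * h t \<partial>lborel)"
proof -
  define \<Psi> where "\<Psi> N v = min (\<Phi> v) (of_nat N)" for N v
  have [measurable]: "\<Psi> N \<in> borel_measurable borel" for N unfolding \<Psi>_def by measurable
  have hom': "homogeneous0 (\<Psi> N)" for N using hom by (auto simp: homogeneous0_def \<Psi>_def)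
  have lim: "(\<integral>\<^sup>+v. \<Phi> v * g v \<partial>lborel) = (SUP N. \<integral>\<^sup>+v. \<Psi> N v * g v \<partial>lborel)"
    if [measurable]: "g \<in> borel_measurable borel" for g
  proof -
    have "\<Phi> v = (SUP N. \<Psi> N v)" for v
    proof (rule antisym)
      show "\<Phi> v \<le> (SUP N. \<Psi> N v)"
      proof (cases "\<Phi> v = top")
        case True
        then have "\<Psi> N v = of_nat N" for N by (simp add: \<Psi>_def)
        then have "(SUP N. \<Psi> N v) = top" by (simp only: ennreal_SUP_of_nat_eq_top)
        then show ?thesis by (simp only: top_greatest)
      next
        case False
        then obtain r where r: "\<Phi> v = ennreal r" by (cases "\<Phi> v") auto
        obtain N :: nat where "r \<le> real N" using real_arch_simple by blast
        then have "\<Phi> v \<le> of_nat N" by (simp add: r ennreal_leI flip: ennreal_of_nat_eq_real_of_nat)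
        then have "\<Phi> v \<le> \<Psi> N v" by (simp add: \<Psi>_def)
        then show ?thesis by (meson SUP_upper2 UNIV_I)
      qed
    qed (auto simp: \<Psi>_def intro!: SUP_least)
    then have "(\<integral>\<^sup>+v. \<Phi> v * g v \<partial>lborel) = (\<integral>\<^sup>+v. (SUP N. \<Psi> N v * g v) \<partial>lborel)"
      by (simp add: SUP_mult_right_ennreal)
    also have "\<dots> = (SUP N. \<integral>\<^sup>+v. \<Psi> N v * g v \<partial>lborel)"
      by (intro nn_integral_monotone_convergence_SUP)
         (auto simp: incseq_def le_fun_def \<Psi>_def intro!: mult_right_mono min.mono)
    finally show ?thesis .
  qed
  have "(\<integral>\<^sup>+v. \<Psi> N v * h (norm v) \<partial>lborel) = (\<integral>\<^sup>+v. \<Psi> N v * indicator {v. norm v \<le> 1} v \<partial>lborel)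
      * (\<integral>\<^sup>+t. ennreal (real DIM('a) * t powr (real DIM('a) - 1)) * indicator {0<..} t * h t \<partial>lborel)" for N
  proof -
    have "(\<integral>\<^sup>+v. \<Psi> N v * indicator {v. norm v \<le> 1} v \<partial>lborel) \<le> (\<integral>\<^sup>+v. of_nat N * indicator (cball (0::'a) 1) v \<partial>lborel)"
      by (intro nn_integral_mono) (auto simp: \<Psi>_def indicator_def)
    also have "\<dots> < top"
      using emeasure_lborel_cball_finite[of "0::'a" 1] by (subst nn_integral_cmult_indicator) (auto simp: ennreal_mult_less_top simp: ennreal_of_nat_eq_real_of_nat)
    finally have fin: "(\<integral>\<^sup>+v. \<Psi> N v * indicator {v. norm v \<le> 1} v \<partial>lborel) < top" .
    have "(\<integral>\<^sup>+v. \<Psi> N v * h (norm v) \<partial>lborel) = (\<integral>\<^sup>+t. h t \<partial>(distr (density lborel (\<Psi> N)) borel norm))"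
      by (subst nn_integral_distr) (auto simp: nn_integral_density)
    also have "\<dots> = (\<integral>\<^sup>+v. \<Psi> N v * indicator {v. norm v \<le> 1} v \<partial>lborel)
      * (\<integral>\<^sup>+t. ennreal (real DIM('a) * t powr (real DIM('a) - 1)) * indicator {0<..} t * h t \<partial>lborel)"
      unfolding distr_norm_homogeneous[OF _ hom' fin, simplified]
      by (subst nn_integral_density) (auto simp: nn_integral_cmult mult.assoc)
    finally show ?thesis .
  qed
  then show ?thesis
    by (subst lim, simp)+ (simp add: SUP_mult_right_ennreal)
qed

lemma nn_integral_homogeneous_powr_le:
  fixes \<Phi> :: "'a::euclidean_space \<Rightarrow> ennreal"
  assumes [measurable]: "\<Phi> \<in> borel_measurable borel" and hom: "homogeneous0 \<Phi>"
    and c: "- real DIM('a) < c" and "0 \<le> R"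
  shows "(\<integral>\<^sup>+v. \<Phi> v * (ennreal (norm v powr c) * indicator {..R} (norm v)) \<partial>lborel)
     = (\<integral>\<^sup>+v. \<Phi> v * indicator {v. norm v \<le> 1} v \<partial>lborel)
       * ennreal (real DIM('a) / (c + real DIM('a)) * R powr (c + real DIM('a)))"
proof -
  have "(\<integral>\<^sup>+t. ennreal (real DIM('a) * t powr (real DIM('a) - 1)) * indicator {0<..} t * (ennreal (t powr c) * indicator {..R} t) \<partial>lborel)
     = (\<integral>\<^sup>+t. ennreal (real DIM('a)) * (ennreal (t powr (c + real DIM('a) - 1)) * indicator {0..R} t) \<partial>lborel)"
    using AE_lborel_singleton[of "0::real"]
    by (intro nn_integral_cong_AE, elim eventually_mono)
       (auto simp: indicator_def ennreal_mult[symmetric] mult.assoc powr_add[symmetric] algebra_simps)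
  also have "\<dots> = ennreal (real DIM('a)) * ennreal (R powr (c + real DIM('a)) / (c + real DIM('a)))"
    using nn_integral_powr_from_0[of "c + real DIM('a) - 1" R] assms by (simp add: nn_integral_cmult)
  also have "\<dots> = ennreal (real DIM('a) / (c + real DIM('a)) * R powr (c + real DIM('a)))"
    using c by (simp flip: ennreal_mult)
  finally show ?thesis
    using nn_integral_polar[OF assms(1) _ hom, of "\<lambda>t. ennreal (t powr c) * indicator {..R} t"] by simp
qed

lemma nn_integral_homogeneous_powr_ge:
  fixes \<Phi> :: "'a::euclidean_space \<Rightarrow> ennreal"
  assumes [measurable]: "\<Phi> \<in> borel_measurable borel" and hom: "homogeneous0 \<Phi>"
    and c: "c < - real DIM('a)" and "0 < R"
  shows "(\<integral>\<^sup>+v. \<Phi> v * (ennreal (norm v powr c) * indicator {R..} (norm v)) \<partial>lborel)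
     = (\<integral>\<^sup>+v. \<Phi> v * indicator {v. norm v \<le> 1} v \<partial>lborel)
       * ennreal (real DIM('a) / - (c + real DIM('a)) * R powr (c + real DIM('a)))"
proof -
  have "(\<integral>\<^sup>+t. ennreal (real DIM('a) * t powr (real DIM('a) - 1)) * indicator {0<..} t * (ennreal (t powr c) * indicator {R..} t) \<partial>lborel)
     = (\<integral>\<^sup>+t. ennreal (real DIM('a)) * (ennreal (t powr (c + real DIM('a) - 1)) * indicator {R..} t) \<partial>lborel)"
    using \<open>0 < R\<close>
    by (intro nn_integral_cong)
       (auto simp: indicator_def ennreal_mult[symmetric] mult.assoc powr_add[symmetric] algebra_simps)
  also have "\<dots> = ennreal (real DIM('a)) * ennreal (R powr (c + real DIM('a)) / - (c + real DIM('a)))"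
    using nn_integral_powr_to_inf[of "c + real DIM('a) - 1" R] assms by (simp add: nn_integral_cmult)
  also have "\<dots> = ennreal (real DIM('a) / - (c + real DIM('a)) * R powr (c + real DIM('a)))"
    using c by (subst ennreal_mult[symmetric]) (auto simp: field_simps)
  finally show ?thesis
    using nn_integral_polar[OF assms(1) _ hom, of "\<lambda>t. ennreal (t powr c) * indicator {R..} t"] by simp
qed

section \<open>Integral operators between Lebesgue spaces\<close>

text \<open>
  A one-sided Schur test. Hoelder's inequality puts \<open>k1\<close> next to \<open>g\<close> and \<open>k2\<close> into \<open>A\<close>; of the resulting
  power \<open>q / p\<close> of \<open>\<integral> g^p k1^p\<close> all but one factor is bounded by the norm of \<open>g\<close> (this uses \<open>p \<le> q\<close> and \<open>k1 \<le> 1\<close>), and the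
  remaining factor is integrated in \<open>x\<close> by Tonelli.
\<close>

lemma nn_integral_Schur:
  fixes k1 k2 :: "'a::euclidean_space \<Rightarrow> 'a \<Rightarrow> real" and g :: "'a \<Rightarrow> real"
  assumes [measurable]: "case_prod k1 \<in> borel_measurable (borel \<Otimes>\<^sub>M borel)"
      "case_prod k2 \<in> borel_measurable (borel \<Otimes>\<^sub>M borel)" "g \<in> borel_measurable borel"
      "A \<in> borel_measurable borel"
    and p: "1 < p" "1 / p + 1 / p' = 1" "p \<le> q"
    and g: "\<And>w. 0 \<le> g w" and k1: "\<And>x w. 0 \<le> k1 x w" "\<And>x w. k1 x w \<le> 1" and k2: "\<And>x w. 0 \<le> k2 x w"
    and A: "\<And>x. (\<integral>\<^sup>+w. ennreal (k2 x w powr p') \<partial>lborel) \<le> ennreal (A x)" "\<And>x. 0 \<le> A x"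
    and D: "\<And>w. (\<integral>\<^sup>+x. ennreal (A x powr (q / p') * k1 x w powr p) \<partial>lborel) \<le> ennreal D"
  shows "(\<integral>\<^sup>+x. ennpowr (\<integral>\<^sup>+w. ennreal (g w * (k1 x w * k2 x w)) \<partial>lborel) q \<partial>lborel)
     \<le> ennreal D * ennpowr (\<integral>\<^sup>+w. ennreal (g w powr p) \<partial>lborel) (q / p)"
proof -
  define P where "P = (\<integral>\<^sup>+w. ennreal (g w powr p) \<partial>lborel)"
  have p': "p' > 0" using p by (smt (verit) divide_less_eq_1_pos zero_less_divide_1_iff)
  have q: "q > 0" using p by auto
  let ?Q = "\<lambda>x. \<integral>\<^sup>+w. ennreal (g w powr p) * ennreal (k1 x w powr p) \<partial>lborel"
  have pt: "ennpowr (\<integral>\<^sup>+w. ennreal (g w * (k1 x w * k2 x w)) \<partial>lborel) q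
     \<le> ennpowr P (q / p - 1) * (?Q x * ennreal (A x powr (q / p')))" for x
  proof -
    have "(\<integral>\<^sup>+w. ennreal (g w * (k1 x w * k2 x w)) \<partial>lborel) = (\<integral>\<^sup>+w. ennreal ((g w * k1 x w) * k2 x w) \<partial>lborel)"
      by (simp add: mult.assoc)
    also have "\<dots> \<le> ennpowr (\<integral>\<^sup>+w. ennreal ((g w * k1 x w) powr p) \<partial>lborel) (1 / p)
        * ennpowr (\<integral>\<^sup>+w. ennreal (k2 x w powr p') \<partial>lborel) (1 / p')"
      using p g k1 k2 by (intro nn_integral_Holder) auto
    also have "\<dots> = ennpowr (?Q x) (1 / p) * ennpowr (\<integral>\<^sup>+w. ennreal (k2 x w powr p') \<partial>lborel) (1 / p')"
      using g k1 by (simp add: powr_mult ennreal_mult)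
    also have "\<dots> \<le> ennpowr (?Q x) (1 / p) * ennpowr (ennreal (A x)) (1 / p')"
      using p' A by (intro mult_left_mono ennpowr_mono) auto
    finally have "ennpowr (\<integral>\<^sup>+w. ennreal (g w * (k1 x w * k2 x w)) \<partial>lborel) q \<le> ennpowr \<dots> q"
      using q by (intro ennpowr_mono) auto
    also have "\<dots> = ennpowr (?Q x) (q / p) * ennreal (A x powr (q / p'))"
      using A by (simp add: ennpowr_mult ennpowr_ennpowr ennpowr_ennreal powr_powr)
    also have "ennpowr (?Q x) (q / p) = ennpowr (?Q x) (q / p - 1) * ?Q x"
      using ennpowr_plus[of "?Q x" "q / p - 1" 1] by simp
    also have "ennpowr (?Q x) (q / p - 1) \<le> ennpowr P (q / p - 1)"
    proof (rule ennpowr_mono)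
      have "ennreal (g w powr p) * ennreal (k1 x w powr p) \<le> ennreal (g w powr p) * 1" for w
        using k1[where x=x and w=w] p by (intro mult_left_mono) (auto simp: powr_le1)
      then show "?Q x \<le> P" unfolding P_def by (intro nn_integral_mono) simp
    qed (use p in \<open>auto simp: field_simps\<close>)
    finally show ?thesis by (simp add: mult_right_mono mult.assoc)
  qed
  have "(\<integral>\<^sup>+x. ennpowr (\<integral>\<^sup>+w. ennreal (g w * (k1 x w * k2 x w)) \<partial>lborel) q \<partial>lborel)
     \<le> (\<integral>\<^sup>+x. ennpowr P (q / p - 1) * (\<integral>\<^sup>+w. ennreal (g w powr p) * ennreal (A x powr (q / p') * k1 x w powr p) \<partial>lborel) \<partial>lborel)"
  proof (intro nn_integral_mono)
    fix x
    have "?Q x * ennreal (A x powr (q / p')) = (\<integral>\<^sup>+w. (ennreal (g w powr p) * ennreal (k1 x w powr p)) * ennreal (A x powr (q / p')) \<partial>lborel)"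
      by (simp add: nn_integral_multc)
    then have eq: "?Q x * ennreal (A x powr (q / p')) = (\<integral>\<^sup>+w. ennreal (g w powr p) * ennreal (A x powr (q / p') * k1 x w powr p) \<partial>lborel)"
      by (simp add: ennreal_mult mult_ac)
    show "ennpowr (\<integral>\<^sup>+w. ennreal (g w * (k1 x w * k2 x w)) \<partial>lborel) q
      \<le> ennpowr P (q / p - 1) * (\<integral>\<^sup>+w. ennreal (g w powr p) * ennreal (A x powr (q / p') * k1 x w powr p) \<partial>lborel)"
      using pt[of x] unfolding eq .
  qed
  also have "\<dots> = ennpowr P (q / p - 1) * (\<integral>\<^sup>+x. \<integral>\<^sup>+w. ennreal (g w powr p) * ennreal (A x powr (q / p') * k1 x w powr p) \<partial>lborel \<partial>lborel)"
    by (simp add: nn_integral_cmult)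
  also have "(\<integral>\<^sup>+x. \<integral>\<^sup>+w. ennreal (g w powr p) * ennreal (A x powr (q / p') * k1 x w powr p) \<partial>lborel \<partial>lborel)
    = (\<integral>\<^sup>+w. \<integral>\<^sup>+x. ennreal (g w powr p) * ennreal (A x powr (q / p') * k1 x w powr p) \<partial>lborel \<partial>lborel)"
    by (subst lborel_pair.Fubini') auto
  also have "\<dots> = (\<integral>\<^sup>+w. ennreal (g w powr p) * (\<integral>\<^sup>+x. ennreal (A x powr (q / p') * k1 x w powr p) \<partial>lborel) \<partial>lborel)"
    by (simp add: nn_integral_cmult)
  also have "\<dots> \<le> (\<integral>\<^sup>+w. ennreal (g w powr p) * ennreal D \<partial>lborel)"
    by (intro nn_integral_mono mult_left_mono D) auto
  also have "\<dots> = P * ennreal D" by (simp add: nn_integral_multc P_def)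
  also have "ennpowr P (q / p - 1) * (P * ennreal D) = ennreal D * (ennpowr P (q / p - 1) * ennpowr P 1)"
    by (simp add: mult_ac)
  also have "ennpowr P (q / p - 1) * ennpowr P 1 = ennpowr P (q / p)"
    by (simp only: ennpowr_plus[symmetric]) simp
  finally show ?thesis by (simp add: mult_left_mono P_def)
qed

text \<open>
  The Hardy--Littlewood--Sobolev inequality, by a direct estimate of level sets. To estimate the set where the convolution exceeds \<open>\<tau>\<close>, cut the kernel at a radius \<open>R\<close> and \<open>g\<close> at
  a height \<open>\<gamma>\<close>, both depending on \<open>\<tau>\<close>. The far part of the kernel and the small part of \<open>g\<close> contribute at most \<open>\<tau>/2\<close> and
  \<open>\<tau>/4\<close> pointwise, so only the large part of \<open>g\<close> against the near part of the kernel counts, and Markov's inequality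
  bounds its level set by \<open>\<gamma>^(-1) \<integral> g\<close> over \<open>g > \<gamma>\<close>. Integrating \<open>q \<tau>^(q-1)\<close> times this bound gives back \<open>\<integral> g^p\<close>, because
  scaling forces \<open>\<gamma>\<close> to be a multiple of \<open>\<tau>^(q/p)\<close>.
\<close>

lemma nn_integral_weak_Young:
  fixes H :: "'a::euclidean_space \<Rightarrow> real"
  defines "n \<equiv> real DIM('a)"
  assumes H[measurable]: "H \<in> borel_measurable borel" and Hnn: "\<And>v. 0 \<le> H v"
    and p: "1 < p" "1 / p + 1 / p' = 1" and \<alpha>: "0 < \<alpha>" and q: "1 / q = 1 / p - \<alpha> / n" "0 < q"
    and AB: "0 < A" "0 < B"
    and far: "\<And>R. 0 < R \<Longrightarrow> (\<integral>\<^sup>+v. ennreal (H v powr p') * indicator {R..} (norm v) \<partial>lborel) \<le> ennreal (A * R powr - (n * p' / q))"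
    and near: "\<And>R. 0 < R \<Longrightarrow> (\<integral>\<^sup>+v. ennreal (H v) * indicator {..<R} (norm v) \<partial>lborel) \<le> ennreal (B * R powr \<alpha>)"
    and g[measurable]: "g \<in> borel_measurable borel" and gnn: "\<And>x. 0 \<le> g x"
  shows "(\<integral>\<^sup>+x. ennpowr (\<integral>\<^sup>+w. ennreal (g w * H (x - w)) \<partial>lborel) q \<partial>lborel)
     \<le> ennreal (p' * (4 * B) powr p * (2 * A powr (1 / p')) powr (q - p))
        * ennpowr (\<integral>\<^sup>+w. ennreal (g w powr p) \<partial>lborel) (q / p)"
proof -
  define P where "P = (\<integral>\<^sup>+w. ennreal (g w powr p) \<partial>lborel)"
  define C where "C = p' * (4 * B) powr p * (2 * A powr (1 / p')) powr (q - p)"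
  define u where "u x = (\<integral>\<^sup>+w. ennreal (g w * H (x - w)) \<partial>lborel)" for x
  have [measurable]: "u \<in> borel_measurable borel" unfolding u_def by measurable
  have p': "p' > 0" using p by (smt (verit) divide_less_eq_1_pos zero_less_divide_1_iff)
  have n: "n > 0" by (simp add: n_def)
  have C: "C > 0" using p' AB by (simp add: C_def)
  consider "P = top" | "P = 0" | P0 where "P = ennreal P0" "P0 > 0"
    by (cases P) (auto simp: order_less_le)
  then have "(\<integral>\<^sup>+x. ennpowr (u x) q \<partial>lborel) \<le> ennreal C * ennpowr P (q / p)"
  proof cases
    case 1
    then show ?thesis using C by (simp add: ennreal_mult_top)
  next
    case 2
    then have "AE w in lborel. g w = 0"
      unfolding P_def by (subst (asm) nn_integral_0_iff_AE) auto
    then have "u x = 0" for x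
      unfolding u_def by (subst nn_integral_0_iff_AE) auto
    then show ?thesis by simp
  next
    case 3
    note P0 = 3
    define M where "M = 2 * P0 powr (1 / p) * A powr (1 / p')"
    \<comment> \<open>\<open>R\<close> makes the bound for the far part equal to \<open>\<tau>/2\<close>, and \<open>\<gamma>\<close> makes \<open>\<gamma> B R^\<alpha>\<close> equal to \<open>\<tau>/4\<close>; the exponent \<open>q / p\<close> of \<open>\<gamma>\<close> is the relation \<open>1/q = 1/p - \<alpha>/n\<close>.\<close>
    define R where "R \<tau> = (M / \<tau>) powr (q / n)" for \<tau>
    define \<kappa> where "\<kappa> = M powr (1 - q / p) / (4 * B)"
    define \<gamma> where "\<gamma> \<tau> = \<kappa> * \<tau> powr (q / p)" for \<tau>
    have [measurable]: "\<gamma> \<in> borel_measurable borel" unfolding \<gamma>_def by measurable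
    have M: "M > 0" using P0 AB by (simp add: M_def)
    have \<kappa>: "\<kappa> > 0" using M AB by (simp add: \<kappa>_def)
    have \<gamma>: "\<gamma> \<tau> > 0" if "\<tau> > 0" for \<tau> using \<kappa> that by (simp add: \<gamma>_def)
    have R: "R \<tau> > 0" if "\<tau> > 0" for \<tau> using M that by (simp add: R_def)
    have \<alpha>q: "q * \<alpha> / n = q / p - 1" 
    proof -
      have "q * (1 / q) = q * (1 / p - \<alpha> / n)" using q by simp
      then show ?thesis using q(2) by (simp add: algebra_simps)
    qed
    have \<gamma>R: "\<gamma> \<tau> * (B * R \<tau> powr \<alpha>) = \<tau> / 4" if "\<tau> > 0" for \<tau>
    proof -
      have "R \<tau> powr \<alpha> = (M / \<tau>) powr (q / p - 1)"
        unfolding R_def powr_powr using \<alpha>q by (simp add: mult.commute)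
      also have "\<dots> = M powr (q / p - 1) * \<tau> powr (1 - q / p)"
        using M that by (simp add: powr_divide powr_diff)
      finally have e: "R \<tau> powr \<alpha> = M powr (q / p - 1) * \<tau> powr (1 - q / p)" .
      have "M powr (1 - q / p) * M powr (q / p - 1) = 1"
        using M by (simp flip: powr_add)
      moreover have "\<tau> powr (q / p) * \<tau> powr (1 - q / p) = \<tau>"
        using that by (simp flip: powr_add)
      moreover have "\<gamma> \<tau> * (B * R \<tau> powr \<alpha>) = (M powr (1 - q / p) * M powr (q / p - 1)) * (\<tau> powr (q / p) * \<tau> powr (1 - q / p)) / 4"
        using AB unfolding \<gamma>_def \<kappa>_def e by (simp add: field_simps)
      ultimately show ?thesis by simp
    qed
    have level: "emeasure lborel {x. ennreal \<tau> < u x}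
       \<le> (\<integral>\<^sup>+w. ennreal (g w / \<gamma> \<tau>) * indicator {w. \<gamma> \<tau> < g w} w \<partial>lborel)" if \<tau>: "\<tau> > 0" for \<tau>
    proof -
      let ?G = "\<lambda>w. ennreal (g w) * indicator {w. \<gamma> \<tau> < g w} w"
      let ?K = "\<lambda>v. ennreal (H v) * indicator {..<R \<tau>} (norm v)"
      let ?u3 = "\<lambda>x. \<integral>\<^sup>+w. ?G w * ?K (x - w) \<partial>lborel"
      have sub: "ennreal (\<tau> / 4) \<le> ?u3 x" if x: "ennreal \<tau> < u x" for x
      proof -
        let ?u1 = "\<integral>\<^sup>+w. ennreal (g w * (H (x - w) * indicator {R \<tau>..} (norm (x - w)))) \<partial>lborel"
        let ?u2 = "\<integral>\<^sup>+w. ennreal (\<gamma> \<tau>) * ?K (x - w) \<partial>lborel"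
        have "u x \<le> (\<integral>\<^sup>+w. ennreal (g w * (H (x - w) * indicator {R \<tau>..} (norm (x - w))))
            + (ennreal (\<gamma> \<tau>) * ?K (x - w)
            + ?G w * ?K (x - w)) \<partial>lborel)"
          unfolding u_def
        proof (intro nn_integral_mono)
          fix w
          show "ennreal (g w * H (x - w)) \<le> ennreal (g w * (H (x - w) * indicator {R \<tau>..} (norm (x - w))))
            + (ennreal (\<gamma> \<tau>) * ?K (x - w)
            + ?G w * ?K (x - w))"
            using gnn[of w] Hnn[of "x - w"] \<gamma>[OF \<tau>]
            by (auto simp: indicator_def ennreal_mult intro!: mult_right_mono ennreal_leI)
        qed
        also have "\<dots> = ?u1 + (?u2 + ?u3 x)"
          by (simp add: nn_integral_add)
        also have "?u1 \<le> ennreal (\<tau> / 2)"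
        proof -
          have "?u1 \<le> ennpowr (\<integral>\<^sup>+w. ennreal (g w powr p) \<partial>lborel) (1 / p) * 
             ennpowr (\<integral>\<^sup>+w. ennreal ((H (x - w) * indicator {R \<tau>..} (norm (x - w))) powr p') \<partial>lborel) (1 / p')"
            using p gnn Hnn by (intro nn_integral_Holder) auto
          also have "(\<integral>\<^sup>+w. ennreal ((H (x - w) * indicator {R \<tau>..} (norm (x - w))) powr p') \<partial>lborel)
              = (\<integral>\<^sup>+v. ennreal ((H v * indicator {R \<tau>..} (norm v)) powr p') \<partial>lborel)"
            by (rule nn_integral_lborel_reflect) measurable
          also have "\<dots> = (\<integral>\<^sup>+v. ennreal (H v powr p') * indicator {R \<tau>..} (norm v) \<partial>lborel)"
            by (intro nn_integral_cong) (auto simp: indicator_def)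
          also have "ennpowr \<dots> (1 / p') \<le> ennpowr (ennreal (A * R \<tau> powr - (n * p' / q))) (1 / p')"
            using p' far[OF R[OF \<tau>]] by (intro ennpowr_mono) auto
          also have "ennpowr (\<integral>\<^sup>+w. ennreal (g w powr p) \<partial>lborel) (1 / p) = ennreal (P0 powr (1 / p))"
            using P0 by (simp add: P_def[symmetric] ennpowr_ennreal)
          also have "ennpowr (ennreal (A * R \<tau> powr - (n * p' / q))) (1 / p') = ennreal (A powr (1 / p') * (\<tau> / M))"
          proof -
            have "(R \<tau> powr - (n * p' / q)) powr (1 / p') = (M / \<tau>) powr (-1)"
              unfolding R_def powr_powr using n p' q by (simp add: field_simps)
            also have "\<dots> = \<tau> / M" using M \<tau> by (simp add: powr_minus_divide)
            finally show ?thesis using AB by (simp add: ennpowr_ennreal powr_mult)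
          qed
          also have "ennreal (P0 powr (1 / p)) * ennreal (A powr (1 / p') * (\<tau> / M)) = ennreal (\<tau> / 2)"
            using M \<tau> P0 AB by (subst ennreal_mult[symmetric]) (auto simp: M_def)
          finally show ?thesis by (simp add: mult_left_mono)
        qed
        also have "?u2 \<le> ennreal (\<tau> / 4)"
        proof -
          have "?u2 = ennreal (\<gamma> \<tau>) * (\<integral>\<^sup>+w. ?K (x - w) \<partial>lborel)"
            by (rule nn_integral_cmult) measurable
          also have "(\<integral>\<^sup>+w. ?K (x - w) \<partial>lborel) =
             (\<integral>\<^sup>+v. ?K v \<partial>lborel)"
            by (rule nn_integral_lborel_reflect) measurable
          also have "\<dots> \<le> ennreal (B * R \<tau> powr \<alpha>)" by (rule near[OF R[OF \<tau>]])
          also have "ennreal (\<gamma> \<tau>) * ennreal (B * R \<tau> powr \<alpha>) = ennreal (\<tau> / 4)"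
            using \<gamma>[OF \<tau>] AB by (subst ennreal_mult[symmetric]) (auto simp: \<gamma>R[OF \<tau>])
          finally show ?thesis by (simp add: mult_left_mono)
        qed
        finally have le: "u x \<le> ennreal (\<tau> / 2) + (ennreal (\<tau> / 4) + ?u3 x)" by (simp add: add_mono)
        show ?thesis
        proof (cases "?u3 x")
          case (real r)
          then have "ennreal (\<tau> / 2) + (ennreal (\<tau> / 4) + ?u3 x) = ennreal (\<tau> / 2 + (\<tau> / 4 + r))"
            unfolding real(2) using \<tau> real(1) by (simp flip: ennreal_plus)
          with le x have "ennreal \<tau> < ennreal (\<tau> / 2 + (\<tau> / 4 + r))" by (auto intro: order_less_le_trans)
          then have "\<tau> / 4 \<le> r" using \<tau> by (simp add: ennreal_less_iff)
          then show ?thesis unfolding real by (rule ennreal_leI)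
        qed simp
      qed
      have [measurable]: "?u3 \<in> borel_measurable lborel" by measurable
      have "{x. ennreal \<tau> < u x} \<subseteq> {x\<in>space lborel. 1 \<le> ennreal (4 / \<tau>) * ?u3 x}"
      proof safe
        fix x assume "ennreal \<tau> < u x"
        then have "ennreal (4 / \<tau>) * ennreal (\<tau> / 4) \<le> ennreal (4 / \<tau>) * ?u3 x" 
          by (intro mult_left_mono sub) auto
        then show "1 \<le> ennreal (4 / \<tau>) * ?u3 x" using \<tau> by (simp flip: ennreal_mult)
      qed auto
      then have "emeasure lborel {x. ennreal \<tau> < u x} \<le> emeasure lborel {x\<in>space lborel. 1 \<le> ennreal (4 / \<tau>) * ?u3 x}"
        by (intro emeasure_mono) measurable
      also have "\<dots> \<le> ennreal (4 / \<tau>) * (\<integral>\<^sup>+x. ?u3 x \<partial>lborel)"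
        using nn_integral_Markov_inequality[of ?u3 UNIV lborel "ennreal (4 / \<tau>)"] by simp
      also have "(\<integral>\<^sup>+x. ?u3 x \<partial>lborel) = (\<integral>\<^sup>+w. \<integral>\<^sup>+x. ?G w * ?K (x - w) \<partial>lborel \<partial>lborel)"
        by (subst lborel_pair.Fubini') auto
      also have "\<dots> \<le> (\<integral>\<^sup>+w. ?G w * ennreal (B * R \<tau> powr \<alpha>) \<partial>lborel)"
      proof (intro nn_integral_mono)
        fix w
        have "(\<integral>\<^sup>+x. ?K (x - w) \<partial>lborel) 
           = (\<integral>\<^sup>+v. ?K v \<partial>lborel)"
          using nn_integral_lborel_affine[of "\<lambda>v. ?K v" 1 "-w"] by simp
        also have "\<dots> \<le> ennreal (B * R \<tau> powr \<alpha>)" by (rule near[OF R[OF \<tau>]])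
        finally show "(\<integral>\<^sup>+x. ?G w * ?K (x - w) \<partial>lborel) \<le> ?G w * ennreal (B * R \<tau> powr \<alpha>)"
          by (simp add: nn_integral_cmult mult_left_mono)
      qed
      also have "ennreal (4 / \<tau>) * \<dots> = (\<integral>\<^sup>+w. ennreal (4 / \<tau>) * (?G w * ennreal (B * R \<tau> powr \<alpha>)) \<partial>lborel)"
        by (simp add: nn_integral_cmult)
      also have "\<dots> = (\<integral>\<^sup>+w. ennreal (g w / \<gamma> \<tau>) * indicator {w. \<gamma> \<tau> < g w} w \<partial>lborel)"
      proof (intro nn_integral_cong)
        fix w
        have "4 / \<tau> * (g w * (B * R \<tau> powr \<alpha>)) = g w / \<gamma> \<tau>"
          using \<gamma>R[OF \<tau>] \<gamma>[OF \<tau>] \<tau> by (simp add: field_simps)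
        then show "ennreal (4 / \<tau>) * (?G w * ennreal (B * R \<tau> powr \<alpha>)) = ennreal (g w / \<gamma> \<tau>) * indicator {w. \<gamma> \<tau> < g w} w"
          using gnn[of w] AB \<tau> by (auto simp: indicator_def simp flip: ennreal_mult)
      qed
      finally show ?thesis by (simp add: mult_left_mono)
    qed
    let ?Q = "\<lambda>t. ennreal (q * t powr (q - 1)) * indicator {0<..} t"
    let ?L = "\<lambda>t w. ennreal (g w / \<gamma> t) * indicator {w. \<gamma> t < g w} w"
    let ?X = "\<lambda>t x. ennreal (q * t powr (q - 1)) * indicator {t. 0 < t \<and> ennreal t < u x} t"
    have "(\<integral>\<^sup>+x. ennpowr (u x) q \<partial>lborel) = (\<integral>\<^sup>+x. \<integral>\<^sup>+t. ?X t x \<partial>lborel \<partial>lborel)"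
      using q(2) by (simp add: ennpowr_layer_cake)
    also have "\<dots> = (\<integral>\<^sup>+t. \<integral>\<^sup>+x. ?X t x \<partial>lborel \<partial>lborel)"
      by (subst lborel_pair.Fubini') auto
    also have "\<dots> = (\<integral>\<^sup>+t. ?Q t * emeasure lborel {x. ennreal t < u x} \<partial>lborel)"
    proof (intro nn_integral_cong)
      fix t :: real
      have "(\<integral>\<^sup>+x. ?X t x \<partial>lborel) = 
        (\<integral>\<^sup>+x. ?Q t * indicator {x. ennreal t < u x} x \<partial>lborel)"
        by (intro nn_integral_cong) (auto simp: indicator_def)
      then show "(\<integral>\<^sup>+x. ?X t x \<partial>lborel) = ?Q t * emeasure lborel {x. ennreal t < u x}"
        by (simp add: nn_integral_cmult)
    qed
    also have "\<dots> \<le> (\<integral>\<^sup>+t. \<integral>\<^sup>+w. ?Q t * ?L t w \<partial>lborel \<partial>lborel)"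
    proof (intro nn_integral_mono)
      fix t :: real
      show "?Q t * emeasure lborel {x. ennreal t < u x}
        \<le> (\<integral>\<^sup>+w. ?Q t * ?L t w \<partial>lborel)"
        using level[of t] by (cases "t > 0") (auto simp: nn_integral_cmult intro!: mult_left_mono)
    qed
    also have "\<dots> = (\<integral>\<^sup>+w. \<integral>\<^sup>+t. ?Q t * ?L t w \<partial>lborel \<partial>lborel)"
      by (subst lborel_pair.Fubini') auto
    also have "\<dots> \<le> (\<integral>\<^sup>+w. ennreal (p' * \<kappa> powr - p) * ennreal (g w powr p) \<partial>lborel)"
    proof (intro nn_integral_mono)
      fix w
      \<comment> \<open>\<open>T\<close> is the value of \<open>t\<close> with \<open>\<gamma> t = g w\<close>.\<close>
      define T where "T = (g w / \<kappa>) powr (p / q)"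
      have e1: "q - q / p = q / p'"
      proof -
        have "q * (1 / p + 1 / p') = q" using p by simp
        then show ?thesis by (simp add: algebra_simps)
      qed
      have e2: "p / p' = p - 1" 
      proof -
        have "p * (1 / p + 1 / p') = p" using p by simp
        then show ?thesis using p(1) by (simp add: algebra_simps)
      qed
      have "(\<integral>\<^sup>+t. ?Q t * ?L t w \<partial>lborel)
        \<le> (\<integral>\<^sup>+t. ennreal (q * g w / \<kappa>) * (ennreal (t powr (q - q / p - 1)) * indicator {0..T} t) \<partial>lborel)"
      proof (intro nn_integral_mono)
        fix t :: real
        show "?Q t * ?L t w
           \<le> ennreal (q * g w / \<kappa>) * (ennreal (t powr (q - q / p - 1)) * indicator {0..T} t)"
        proof (cases "t > 0 \<and> \<gamma> t < g w")
          case True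
          then have "t powr (q / p) \<le> g w / \<kappa>" using \<kappa> by (simp add: \<gamma>_def field_simps)
          then have "(t powr (q / p)) powr (p / q) \<le> T"
            unfolding T_def using p q by (intro powr_mono2) auto
          then have tT: "t \<le> T" using True p q by (simp add: powr_powr)
          have "q * t powr (q - 1) * (g w / \<gamma> t) = q * g w / \<kappa> * (t powr (q - 1) / t powr (q / p))"
            by (simp add: \<gamma>_def)
          also have "t powr (q - 1) / t powr (q / p) = t powr (q - q / p - 1)"
            by (simp add: powr_diff[symmetric] algebra_simps)
          finally show ?thesis using True tT q gnn[of w] \<kappa> \<gamma>[of t]
            by (simp add: ennreal_mult[symmetric])
        qed auto
      qed
      also have "\<dots> = ennreal (q * g w / \<kappa>) * ennreal (T powr (q - q / p) / (q - q / p))"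
        using nn_integral_powr_from_0[of "q - q / p - 1" T] e1 p' q
        by (simp add: nn_integral_cmult T_def)
      also have "\<dots> = ennreal (q * g w / \<kappa> * (T powr (q - q / p) / (q - q / p)))"
        using q gnn[of w] \<kappa> e1 p' by (intro ennreal_mult[symmetric]) auto
      also have "q * g w / \<kappa> * (T powr (q - q / p) / (q - q / p)) = p' * \<kappa> powr - p * g w powr p"
      proof (cases "g w = 0")
        case False
        then have gw: "g w > 0" using gnn[of w] by simp
        have "T powr (q - q / p) = (g w / \<kappa>) powr (p - 1)"
          unfolding T_def powr_powr e1 e2[symmetric] using q(2) by simp
        also have "g w / \<kappa> * \<dots> = (g w / \<kappa>) powr p"
          using gw \<kappa> by (simp add: powr_diff)
        finally have "g w / \<kappa> * T powr (q - q / p) = (g w / \<kappa>) powr p" .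
        moreover have "q / (q - q / p) = p'" unfolding e1 using q by simp
        moreover have "q * g w / \<kappa> * (T powr (q - q / p) / (q - q / p)) = (q / (q - q / p)) * (g w / \<kappa> * T powr (q - q / p))"
          by (simp add: mult_ac)
        ultimately show ?thesis using gw \<kappa> by (simp add: powr_divide powr_minus_divide)
      qed (use p in simp)
      finally show "(\<integral>\<^sup>+t. ?Q t * ?L t w \<partial>lborel)
         \<le> ennreal (p' * \<kappa> powr - p) * ennreal (g w powr p)"
        using p' by (simp add: ennreal_mult)
    qed
    also have "\<dots> = ennreal (p' * \<kappa> powr - p) * ennreal P0"
      using P0 by (simp add: nn_integral_cmult P_def)
    also have "\<dots> = ennreal (p' * \<kappa> powr - p * P0)"
      using P0 p' by (simp flip: ennreal_mult)
    also have "p' * \<kappa> powr - p * P0 = C * P0 powr (q / p)"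
    proof -
      have "\<kappa> powr - p = (M powr (1 - q / p)) powr - p / (4 * B) powr - p"
        unfolding \<kappa>_def using M AB by (intro powr_divide)
      also have "(M powr (1 - q / p)) powr - p = M powr (q - p)"
        using p(1) by (simp add: powr_powr algebra_simps)
      also have "\<dots> / (4 * B) powr - p = (4 * B) powr p * M powr (q - p)"
        by (simp add: powr_minus field_simps)
      finally have "\<kappa> powr - p = (4 * B) powr p * M powr (q - p)" .
      moreover have "M powr (q - p) = (2 * A powr (1 / p')) powr (q - p) * P0 powr (q / p - 1)"
        using P0 AB p unfolding M_def by (simp add: powr_mult powr_powr diff_divide_distrib)
      moreover have "P0 powr (q / p - 1) * P0 = P0 powr (q / p)"
        using P0 by (simp add: powr_diff)
      ultimately show ?thesis by (simp add: C_def mult_ac)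
    qed
    finally show ?thesis using C P0 by (simp add: ennpowr_ennreal ennreal_mult)
  qed
  then show ?thesis by (simp add: u_def P_def C_def)
qed

section \<open>Homogeneous kernels and power weights\<close>

lemma powr_comparable:
  fixes a b \<beta> :: real
  assumes "0 < a" "0 < b" "a \<le> 2 * b" "b \<le> 2 * a"
  shows "a powr \<beta> \<le> 2 powr \<bar>\<beta>\<bar> * b powr \<beta>"
proof (cases "0 \<le> \<beta>")
  case True
  then have "a powr \<beta> \<le> (2 * b) powr \<beta>" using assms by (intro powr_mono2) auto
  then show ?thesis using True assms by (simp add: powr_mult)
next
  case False
  then have "a powr \<beta> \<le> (b / 2) powr \<beta>" using assms by (intro powr_mono2') auto
  also have "(b / 2) powr \<beta> = 2 powr - \<beta> * b powr \<beta>"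
    using assms by (simp add: powr_divide powr_minus_divide)
  finally show ?thesis using False by simp
qed

lemma divide_le_self: "0 \<le> y \<Longrightarrow> 1 < c \<Longrightarrow> y / c \<le> (y::real)"
  using mult_left_mono[of 1 c y] by (simp add: divide_le_eq)

lemma norm_le_eq_cball: "{v::'a::euclidean_space. norm v \<le> R} = cball 0 R"
  by auto

lemma nn_integral_norm_powr_le:
  assumes "- real DIM('a) < c" "0 \<le> R"
  shows "(\<integral>\<^sup>+v. ennreal (norm (v::'a::euclidean_space) powr c) * indicator {..R} (norm v) \<partial>lborel)
    = emeasure lborel (cball (0::'a) 1) * ennreal (real DIM('a) / (c + real DIM('a)) * R powr (c + real DIM('a)))"
  using nn_integral_homogeneous_powr_le[of "\<lambda>_::'a. 1" c R] assms
  by (simp add: homogeneous0_def norm_le_eq_cball)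

lemma nn_integral_norm_powr_ge:
  assumes "c < - real DIM('a)" "0 < R"
  shows "(\<integral>\<^sup>+v. ennreal (norm (v::'a::euclidean_space) powr c) * indicator {R..} (norm v) \<partial>lborel)
    = emeasure lborel (cball (0::'a) 1) * ennreal (real DIM('a) / - (c + real DIM('a)) * R powr (c + real DIM('a)))"
  using nn_integral_homogeneous_powr_ge[of "\<lambda>_::'a. 1" c R] assms
  by (simp add: homogeneous0_def norm_le_eq_cball)

lemma emeasure_cball_real: 
  obtains V where "emeasure lborel (cball (0::'a::euclidean_space) 1) = ennreal V" "0 \<le> V"
  using emeasure_lborel_cball_finite[of "0::'a" 1] by (cases "emeasure lborel (cball (0::'a) 1)") auto

text \<open>
  A kernel of degree \<open>\<alpha> - n\<close> whose angular part is in \<open>L^S\<close> for some \<open>S > p'\<close>, with exponents \<open>p\<close>, \<open>q\<close> in the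
  relation that scaling imposes. Integrability on the sphere is expressed on the unit ball, through
  the 0-homogeneous function \<open>|v|^(n-\<alpha>) H(v)\<close>.
\<close>

locale homogeneous_kernel =
  fixes H :: "'a::euclidean_space \<Rightarrow> real" and n \<alpha> p p' q S :: real
  assumes n_def: "n = real DIM('a)"
    and H[measurable]: "H \<in> borel_measurable borel" and Hnn: "\<And>v. 0 \<le> H v"
    and Hhom: "\<And>c v. 0 < c \<Longrightarrow> H (c *\<^sub>R v) = c powr (\<alpha> - n) * H v"
    and p: "1 < p" "1 / p + 1 / p' = 1" and \<alpha>: "0 < \<alpha>" and q: "1 / q = 1 / p - \<alpha> / n" "0 < q"
    and S: "p' < S"
    and fin: "(\<integral>\<^sup>+v. ennreal ((norm v powr (n - \<alpha>) * H v) powr S) * indicator {v. norm v \<le> 1} v \<partial>lborel) < top"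
begin

definition \<phi> where "\<phi> v = norm v powr (n - \<alpha>) * H v"

lemma phi_meas [measurable]: "\<phi> \<in> borel_measurable borel"
  unfolding \<phi>_def by measurable

lemma phi_nn: "0 \<le> \<phi> v"
  by (simp add: \<phi>_def Hnn)

lemma H_phi: "v \<noteq> 0 \<Longrightarrow> H v = norm v powr (\<alpha> - n) * \<phi> v"
  by (simp add: \<phi>_def powr_add[symmetric] mult.assoc[symmetric])

lemma phi_hom: "homogeneous0 (\<lambda>v. ennreal (\<phi> v powr a))"
proof -
  have "\<phi> (c *\<^sub>R v) = \<phi> v" if "c > 0" for c v
    using that Hhom[OF that] by (simp add: \<phi>_def powr_mult) (simp add: mult.left_commute mult.assoc[symmetric] powr_add[symmetric])
  then show ?thesis by (simp add: homogeneous0_def)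
qed

lemma pp': "0 < p'" "1 < p'" "n > 0" "0 < S"
proof -
  show "0 < p'" using p by (smt (verit) divide_less_eq_1_pos zero_less_divide_1_iff)
  have "1 / p' = 1 - 1 / p" using p(2) by simp
  then have "1 / p' < 1" using p(1) by simp
  then show "1 < p'" using \<open>0 < p'\<close> by simp
  show "n > 0" by (simp add: n_def)
  show "0 < S" using S \<open>0 < p'\<close> by simp
qed

lemma exponent_relations: "p \<le> q" "(\<alpha> - n) * p' + n = - (n * p' / q)" "\<alpha> < n"
proof -
  have "0 < 1 / p - \<alpha> / n" using q by (metis zero_less_divide_1_iff)
  then have an: "\<alpha> / n < 1 / p" by simp
  have "1 / q \<le> 1 / p" using q \<alpha> pp' by simp
  then have "inverse q \<le> inverse p" by (simp add: divide_inverse)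
  then show "p \<le> q" using p(1) q(2) by simp
  have p1: "1 / p' = 1 - 1 / p" using p(2) by simp
  have "(\<alpha> - n) * p' + n = n * p' * (\<alpha> / n - 1 + 1 / p')" using pp' by (simp add: field_simps)
  also have "\<alpha> / n - 1 + 1 / p' = - (1 / q)" unfolding p1 q(1) by simp
  finally show "(\<alpha> - n) * p' + n = - (n * p' / q)" by simp
  have "1 / p < 1" using p by simp
  then have "\<alpha> / n < 1" using an by linarith
  then show "\<alpha> < n" using pp' by simp
qed

lemma exp_far: "(\<alpha> - n) * p' < - n"
proof -
  have "0 < n * p' / q" using pp' q by simp
  then show ?thesis using exponent_relations(2) by linarith
qed

text \<open>The ball has finite measure, so \<open>L^S\<close> integrability passes to smaller exponents.\<close>

lemma phi_power_integrable:
  assumes "0 < a" "a \<le> S"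
  obtains L where "(\<integral>\<^sup>+v. ennreal (\<phi> v powr a) * indicator {v. norm v \<le> 1} v \<partial>lborel) = ennreal L" "0 \<le> L"
proof -
  have "(\<integral>\<^sup>+v. ennreal (\<phi> v powr a) * indicator {v. norm v \<le> 1} v \<partial>lborel)
    \<le> (\<integral>\<^sup>+v. indicator (cball 0 1) v + ennreal (\<phi> v powr S) * indicator {v. norm v \<le> 1} v \<partial>lborel)"
  proof (rule nn_integral_mono)
    fix v
    have "\<phi> v powr a \<le> 1 + \<phi> v powr S"
    proof (cases "\<phi> v \<le> 1")
      case True
      then have "\<phi> v powr a \<le> 1" using assms phi_nn by (simp add: powr_le1)
      then show ?thesis by (simp add: add_increasing2)
    next
      case False
      then have "\<phi> v powr a \<le> \<phi> v powr S" using assms by (intro powr_mono) auto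
      then show ?thesis by simp
    qed
    then have "ennreal (\<phi> v powr a) \<le> 1 + ennreal (\<phi> v powr S)"
      using ennreal_leI[of "\<phi> v powr a" "1 + \<phi> v powr S"] by simp
    then show "ennreal (\<phi> v powr a) * indicator {v. norm v \<le> 1} v \<le> indicator (cball 0 1) v + ennreal (\<phi> v powr S) * indicator {v. norm v \<le> 1} v"
      by (auto simp: indicator_def)
  qed
  also have "\<dots> = emeasure lborel (cball (0::'a) 1) + (\<integral>\<^sup>+v. ennreal (\<phi> v powr S) * indicator {v. norm v \<le> 1} v \<partial>lborel)"
    by (subst nn_integral_add) (auto intro!: borel_measurable_indicator)
  also have "\<dots> < top" using fin emeasure_lborel_cball_finite[of "0::'a" 1] by (simp add: \<phi>_def)
  finally show ?thesis using that
    by (cases "\<integral>\<^sup>+v. ennreal (\<phi> v powr a) * indicator {v. norm v \<le> 1} v \<partial>lborel") auto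
qed

text \<open>
  The hypotheses of the Hardy--Littlewood--Sobolev inequality in polar coordinates: \<open>H^p'\<close> is integrable at infinity and \<open>H\<close> at the origin.
\<close>

lemma local_bound:
  "\<exists>C\<ge>0. \<forall>g\<in>borel_measurable borel. (\<forall>x. 0 \<le> g x) \<longrightarrow>
     (\<integral>\<^sup>+x. ennpowr (\<integral>\<^sup>+w. ennreal (g w * H (x - w)) \<partial>lborel) q \<partial>lborel)
       \<le> ennreal C * ennpowr (\<integral>\<^sup>+w. ennreal (g w powr p) \<partial>lborel) (q / p)"
proof -
  obtain L1 where L1: "(\<integral>\<^sup>+v. ennreal (\<phi> v powr 1) * indicator {v. norm v \<le> 1} v \<partial>lborel) = ennreal L1" "0 \<le> L1"
    using phi_power_integrable[of 1] pp' S by auto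
  obtain L2 where L2: "(\<integral>\<^sup>+v. ennreal (\<phi> v powr p') * indicator {v. norm v \<le> 1} v \<partial>lborel) = ennreal L2" "0 \<le> L2"
    using phi_power_integrable[of p'] pp' S by auto
  define A where "A = L2 * (n / (n * p' / q)) + 1"
  define B where "B = L1 * (n / \<alpha>) + 1"
  have A0: "0 \<le> L2 * (n / (n * p' / q))" and B0: "0 \<le> L1 * (n / \<alpha>)"
    using L1 L2 pp' q \<alpha> by auto
  then have AB: "0 < A" "0 < B" by (auto simp: A_def B_def)
  have far: "(\<integral>\<^sup>+v. ennreal (H v powr p') * indicator {R..} (norm v) \<partial>lborel) \<le> ennreal (A * R powr - (n * p' / q))"
    if R: "0 < R" for R
  proof -
    have "(\<integral>\<^sup>+v. ennreal (H v powr p') * indicator {R..} (norm v) \<partial>lborel)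
       = (\<integral>\<^sup>+v. ennreal (\<phi> v powr p') * (ennreal (norm v powr ((\<alpha> - n) * p')) * indicator {R..} (norm v)) \<partial>lborel)"
    proof (intro nn_integral_cong)
      fix v :: 'a
      show "ennreal (H v powr p') * indicator {R..} (norm v) = ennreal (\<phi> v powr p') * (ennreal (norm v powr ((\<alpha> - n) * p')) * indicator {R..} (norm v))"
      proof (cases "R \<le> norm v")
        case True
        then have "v \<noteq> 0" using R by auto
        then show ?thesis using True by (simp add: H_phi powr_mult powr_powr mult.commute flip: ennreal_mult)
      qed auto
    qed
    also have "\<dots> = ennreal L2 * ennreal (n / (n * p' / q) * R powr - (n * p' / q))"
      using R pp' q exponent_relations(2) exp_far
      by (subst nn_integral_homogeneous_powr_ge[OF _ phi_hom]) (auto simp: L2 n_def[symmetric])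
    also have "\<dots> = ennreal (L2 * (n / (n * p' / q)) * R powr - (n * p' / q))"
      using L2 pp' q by (subst ennreal_mult[symmetric]) (auto simp: mult.assoc)
    also have "\<dots> \<le> ennreal (A * R powr - (n * p' / q))"
      unfolding A_def by (intro ennreal_leI mult_right_mono) auto
    finally show ?thesis .
  qed
  have near: "(\<integral>\<^sup>+v. ennreal (H v) * indicator {..<R} (norm v) \<partial>lborel) \<le> ennreal (B * R powr \<alpha>)"
    if R: "0 < R" for R
  proof -
    have "(\<integral>\<^sup>+v. ennreal (H v) * indicator {..<R} (norm v) \<partial>lborel)
       \<le> (\<integral>\<^sup>+v. ennreal (\<phi> v powr 1) * (ennreal (norm v powr (\<alpha> - n)) * indicator {..R} (norm v)) \<partial>lborel)"
      using R AE_lborel_singleton[of "0::'a"] by (intro nn_integral_mono_AE, elim eventually_mono)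
        (auto simp: indicator_def H_phi phi_nn mult.commute simp flip: ennreal_mult)
    also have "\<dots> = ennreal L1 * ennreal (n / \<alpha> * R powr \<alpha>)"
      using R \<alpha> by (subst nn_integral_homogeneous_powr_le[OF _ phi_hom]) (auto simp: L1[simplified] n_def[symmetric])
    also have "\<dots> = ennreal (L1 * (n / \<alpha>) * R powr \<alpha>)"
      using L1 pp' \<alpha> by (subst ennreal_mult[symmetric]) (auto simp: mult.assoc)
    also have "\<dots> \<le> ennreal (B * R powr \<alpha>)"
      unfolding B_def by (intro ennreal_leI mult_right_mono) auto
    finally show ?thesis .
  qed
  show ?thesis
    using nn_integral_weak_Young[OF H Hnn p \<alpha> q(1)[unfolded n_def] q(2) AB, folded n_def, OF far near] pp'
    by (intro exI[of _ "p' * (4 * B) powr p * (2 * A powr (1 / p')) powr (q - p)"]) auto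
qed

text \<open>
  The weighted inequality for the part of the operator where \<open>R x w\<close> holds, with \<open>|\<cdot>|^l\<close> moved from the function into the kernel.
\<close>

definition region_bounded :: "real \<Rightarrow> ('a \<Rightarrow> 'a \<Rightarrow> bool) \<Rightarrow> bool" where
  "region_bounded l R \<longleftrightarrow> (\<exists>C\<ge>0. \<forall>g\<in>borel_measurable borel. (\<forall>x. 0 \<le> g x) \<longrightarrow>
     (\<integral>\<^sup>+x. ennpowr (\<integral>\<^sup>+w. ennreal (if R x w then g w * (norm x powr l * norm w powr - l * H (x - w)) else 0) \<partial>lborel) q \<partial>lborel)
       \<le> ennreal C * ennpowr (\<integral>\<^sup>+w. ennreal (g w powr p) \<partial>lborel) (q / p))"

text \<open>The Schur test with the power of \<open>|x|\<close> that homogeneity dictates for the kernel.\<close>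

lemma region_boundedI:
  fixes k1 k2 :: "'a \<Rightarrow> 'a \<Rightarrow> real"
  assumes [measurable]: "case_prod k1 \<in> borel_measurable (borel \<Otimes>\<^sub>M borel)" "case_prod k2 \<in> borel_measurable (borel \<Otimes>\<^sub>M borel)"
    and k1: "\<And>x w. 0 \<le> k1 x w" "\<And>x w. k1 x w \<le> 1" and k2: "\<And>x w. 0 \<le> k2 x w"
    and C1: "0 \<le> C1" and D: "0 \<le> D"
    and k2A: "\<And>x. (\<integral>\<^sup>+w. ennreal (k2 x w powr p') \<partial>lborel) \<le> ennreal (C1 * norm x powr - (n * p' / q))"
    and k1D: "\<And>w. (\<integral>\<^sup>+x. ennreal (norm x powr - n * k1 x w powr p) \<partial>lborel) \<le> ennreal D"
    and split: "\<And>x w. R x w \<Longrightarrow> norm x powr l * norm w powr - l * H (x - w) = k1 x w * k2 x w" "\<And>x w. \<not> R x w \<Longrightarrow> k1 x w = 0"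
  shows "region_bounded l R"
  unfolding region_bounded_def
proof (intro exI[of _ "C1 powr (q / p') * D"] conjI ballI impI)
  show "0 \<le> C1 powr (q / p') * D" using D by simp
  fix g :: "'a \<Rightarrow> real" assume [measurable]: "g \<in> borel_measurable borel" and g: "\<forall>x. 0 \<le> g x"
  let ?A = "\<lambda>x::'a. C1 * norm x powr - (n * p' / q)"
  have "(if R x w then g w * (norm x powr l * norm w powr - l * H (x - w)) else 0) = g w * (k1 x w * k2 x w)" for x w
    using split by simp
  then have "(\<integral>\<^sup>+x. ennpowr (\<integral>\<^sup>+w. ennreal (if R x w then g w * (norm x powr l * norm w powr - l * H (x - w)) else 0) \<partial>lborel) q \<partial>lborel)
     = (\<integral>\<^sup>+x. ennpowr (\<integral>\<^sup>+w. ennreal (g w * (k1 x w * k2 x w)) \<partial>lborel) q \<partial>lborel)" by simp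
  also have "\<dots> \<le> ennreal (C1 powr (q / p') * D) * ennpowr (\<integral>\<^sup>+w. ennreal (g w powr p) \<partial>lborel) (q / p)"
  proof (rule nn_integral_Schur[where A="?A"])
    show "(\<integral>\<^sup>+x. ennreal (?A x powr (q / p') * k1 x w powr p) \<partial>lborel) \<le> ennreal (C1 powr (q / p') * D)" for w
    proof -
      have "ennreal (?A x powr (q / p') * k1 x w powr p) = ennreal (C1 powr (q / p')) * ennreal (norm x powr - n * k1 x w powr p)" for x
        using C1 pp' q by (simp add: powr_mult powr_powr mult.assoc flip: ennreal_mult)
      then show ?thesis using k1D[of w] D by (simp add: nn_integral_cmult ennreal_mult mult_left_mono)
    qed
  qed (use p exponent_relations g k1 k2 k2A C1 in auto)
  finally show "(\<integral>\<^sup>+x. ennpowr (\<integral>\<^sup>+w. ennreal (if R x w then g w * (norm x powr l * norm w powr - l * H (x - w)) else 0) \<partial>lborel) q \<partial>lborel)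
     \<le> ennreal (C1 powr (q / p') * D) * ennpowr (\<integral>\<^sup>+w. ennreal (g w powr p) \<partial>lborel) (q / p)" .
qed

text \<open>
  For \<open>|w| < |x|/2\<close> one has \<open>|x - w| \<sim> |x|\<close>, so \<open>H\<close> may be large only because of its angular part. The
  weight \<open>|w|^(-l)\<close> and \<open>H^p'\<close> are separated by Young's inequality for products; \<open>H\<close> uses up the exponent \<open>S\<close>, and the
  upper bound on \<open>l\<close> says exactly that the power of \<open>|w|\<close> left over is integrable at the origin.
\<close>

lemma origin_bound:
  assumes lam: "l < n * (1 / p' - 1 / S)"
  shows "region_bounded l (\<lambda>x w. 2 * norm w < norm x)"
proof -
  define X where "X = n * (1 / p' - 1 / S)"
  \<comment> \<open>\<open>\<epsilon>\<close> is the power of \<open>|w|/|x|\<close> moved to the side of \<open>g\<close>; \<open>m\<close> is the exponent dual to \<open>S/p'\<close>, so that \<open>e < n\<close> expresses integrability at the origin.\<close>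
  define \<epsilon> where "\<epsilon> = (X - l) / 2"
  have \<epsilon>: "0 < \<epsilon>" "l + \<epsilon> < n * (1 / p' - 1 / S)" using lam unfolding \<epsilon>_def X_def[symmetric] by (auto simp: field_simps)
  define k1 where "k1 x w = (if 2 * norm w < norm x then (norm w / norm x) powr \<epsilon> else 0)" for x w :: 'a
  define k2 where "k2 x w = (if 2 * norm w < norm x then (norm w / norm x) powr (- l - \<epsilon>) * H (x - w) else 0)" for x w :: 'a
  define M where "M = S / p'"
  define m where "m = M / (M - 1)"
  define e where "e = (l + \<epsilon>) * p' * m"
  have M: "M > 1" using S pp' by (simp add: M_def)
  have m: "m > 1" "1 / m + 1 / M = 1" using M by (auto simp: m_def field_simps)
  have e: "e < n"
  proof -
    have "e < n * (1 / p' - 1 / S) * p' * m"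
      unfolding e_def using \<epsilon> pp' m by (intro mult_strict_right_mono) auto
    also have "\<dots> = n * (1 - 1 / M) * m" using pp' by (simp add: M_def field_simps)
    also have "1 - 1 / M = 1 / m" using m by simp
    finally show ?thesis using m by simp
  qed
  obtain V where V: "emeasure lborel (cball (0::'a) 1) = ennreal V" "0 \<le> V" by (rule emeasure_cball_real)
  obtain L where L: "(\<integral>\<^sup>+v. ennreal (\<phi> v powr S) * indicator {v. norm v \<le> 1} v \<partial>lborel) = ennreal L" "0 \<le> L"
    using phi_power_integrable[of S] pp' by auto
  define c0 where "c0 = 2 powr ((n - \<alpha>) * p')"
  define C1 where "C1 = c0 * (V * (n / (n - e)) + L * 2 powr n)"
  have C1: "0 \<le> C1" using V L e pp' by (auto simp: C1_def c0_def)
  define D where "D = V * (n / (\<epsilon> * p))"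
  have D0: "0 \<le> D" using C1 V pp' \<epsilon> p by (auto simp: D_def)
  have k2A: "(\<integral>\<^sup>+w. ennreal (k2 x w powr p') \<partial>lborel) \<le> ennreal (C1 * norm x powr - (n * p' / q))" for x
  proof (cases "x = 0")
    case True
    then have "k2 x w = 0" for w by (simp add: k2_def)
    then show ?thesis using pp' by simp
  next
    case False
    define N where "N = norm x"
    have N: "N > 0" using False by (simp add: N_def)
    have "(\<integral>\<^sup>+w. ennreal (k2 x w powr p') \<partial>lborel)
       \<le> (\<integral>\<^sup>+w. ennreal (c0 * N powr ((\<alpha> - n) * p')) * (ennreal (N powr e) * (ennreal (norm w powr - e) * indicator {..N} (norm w))
             + ennreal (\<phi> (x - w) powr S) * indicator {v. norm v \<le> 2 * N} (x - w)) \<partial>lborel)"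
    proof (intro nn_integral_mono_AE, rule eventually_mono[OF AE_lborel_singleton[of "0::'a"]])
      fix w :: 'a assume w: "w \<noteq> 0"
      show "ennreal (k2 x w powr p') \<le> ennreal (c0 * N powr ((\<alpha> - n) * p')) * (ennreal (N powr e) * (ennreal (norm w powr - e) * indicator {..N} (norm w))
             + ennreal (\<phi> (x - w) powr S) * indicator {v. norm v \<le> 2 * N} (x - w))"
      proof (cases "2 * norm w < norm x")
        case True
        have xw: "x - w \<noteq> 0" "norm (x - w) \<le> 2 * N" "N / 2 \<le> norm (x - w)"
          using True w norm_triangle_ineq2[of x w] norm_triangle_ineq4[of x w] by (auto simp: N_def)
        have "H (x - w) \<le> (N / 2) powr (\<alpha> - n) * \<phi> (x - w)"
          unfolding H_phi[OF xw(1)] using xw N exponent_relations(3) phi_nn by (intro mult_right_mono powr_mono2') auto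
        then have "H (x - w) powr p' \<le> ((N / 2) powr (\<alpha> - n) * \<phi> (x - w)) powr p'"
          using pp' Hnn by (intro powr_mono2) auto
        also have "\<dots> = c0 * N powr ((\<alpha> - n) * p') * \<phi> (x - w) powr p'"
          using N phi_nn by (simp add: powr_mult powr_divide powr_powr c0_def powr_minus_divide algebra_simps powr_diff)
        finally have 1: "H (x - w) powr p' \<le> c0 * N powr ((\<alpha> - n) * p') * \<phi> (x - w) powr p'" .
        define a where "a = (norm w / N) powr ((- l - \<epsilon>) * p')"
        have ee: "(- l - \<epsilon>) * p' * m = - e" by (simp add: e_def algebra_simps)
        have "a * \<phi> (x - w) powr p' \<le> a powr m / m + (\<phi> (x - w) powr p') powr M / M"
          using m by (intro Young_ineq) (auto simp: a_def)
        also have "\<dots> \<le> a powr m + (\<phi> (x - w) powr p') powr M"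
          using m M by (intro add_mono divide_le_self) auto
        also have "a powr m = (norm w / N) powr - e"
          by (simp only: a_def powr_powr ee)
        also have "(norm w / N) powr - e = N powr e * norm w powr - e"
          using N w by (simp add: powr_divide powr_minus_divide)
        also have "(\<phi> (x - w) powr p') powr M = \<phi> (x - w) powr S"
          using pp' by (simp add: powr_powr M_def)
        finally have 2: "a * \<phi> (x - w) powr p' \<le> N powr e * norm w powr - e + \<phi> (x - w) powr S" .
        have "k2 x w powr p' = a * H (x - w) powr p'"
          using True Hnn by (simp add: k2_def powr_mult powr_powr a_def N_def)
        also have "\<dots> \<le> a * (c0 * N powr ((\<alpha> - n) * p') * \<phi> (x - w) powr p')"
          using 1 by (intro mult_left_mono) (auto simp: a_def)
        also have "\<dots> = c0 * N powr ((\<alpha> - n) * p') * (a * \<phi> (x - w) powr p')" by simp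
        also have "\<dots> \<le> c0 * N powr ((\<alpha> - n) * p') * (N powr e * norm w powr - e + \<phi> (x - w) powr S)"
          using 2 by (intro mult_left_mono) (auto simp: c0_def)
        finally have "k2 x w powr p' \<le> c0 * N powr ((\<alpha> - n) * p') * (N powr e * norm w powr - e + \<phi> (x - w) powr S)" .
        then have "ennreal (k2 x w powr p') \<le> ennreal (c0 * N powr ((\<alpha> - n) * p') * (N powr e * norm w powr - e + \<phi> (x - w) powr S))"
          by (rule ennreal_leI)
        also have "\<dots> = ennreal (c0 * N powr ((\<alpha> - n) * p')) * (ennreal (N powr e) * ennreal (norm w powr - e) + ennreal (\<phi> (x - w) powr S))"
          by (simp add: ennreal_mult c0_def)
        also have "\<dots> = ennreal (c0 * N powr ((\<alpha> - n) * p')) * (ennreal (N powr e) * (ennreal (norm w powr - e) * indicator {..N} (norm w))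
             + ennreal (\<phi> (x - w) powr S) * indicator {v. norm v \<le> 2 * N} (x - w))"
          using xw True by (simp add: N_def[symmetric])
        finally show ?thesis .
      next
        case False
        then have "k2 x w = 0" by (simp add: k2_def)
        then show ?thesis using pp' by simp
      qed
    qed
    also have "\<dots> = ennreal (c0 * N powr ((\<alpha> - n) * p')) * (ennreal (N powr e) * (\<integral>\<^sup>+w. ennreal (norm (w::'a) powr - e) * indicator {..N} (norm w) \<partial>lborel)
             + (\<integral>\<^sup>+w. ennreal (\<phi> (x - w) powr S) * indicator {v. norm v \<le> 2 * N} (x - w) \<partial>lborel))"
      by (simp add: nn_integral_cmult nn_integral_add)
    also have "(\<integral>\<^sup>+w. ennreal (\<phi> (x - w) powr S) * indicator {v. norm v \<le> 2 * N} (x - w) \<partial>lborel) = ennreal (L * (2 * N) powr n)"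
    proof -
      have "(\<integral>\<^sup>+w. ennreal (\<phi> (x - w) powr S) * indicator {v. norm v \<le> 2 * N} (x - w) \<partial>lborel) = (\<integral>\<^sup>+v. ennreal (\<phi> v powr S) * indicator {v. norm v \<le> 2 * N} v \<partial>lborel)"
        by (rule nn_integral_lborel_reflect) measurable
      also have "\<dots> = ennreal ((2 * N) ^ DIM('a)) * ennreal L"
        using N by (subst nn_integral_homogeneous_cball[OF _ phi_hom]) (auto simp: L)
      also have "(2 * N) ^ DIM('a) = (2 * N) powr n"
        using N by (simp add: n_def powr_realpow)
      finally show ?thesis using L by (simp add: ennreal_mult mult.commute)
    qed
    also have "(\<integral>\<^sup>+w. ennreal (norm (w::'a) powr - e) * indicator {..N} (norm w) \<partial>lborel) = ennreal (V * (n / (n - e) * N powr (n - e)))"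
      using e N V pp' by (subst nn_integral_norm_powr_le) (auto simp: n_def[symmetric] ennreal_mult[symmetric])
    also have "ennreal (c0 * N powr ((\<alpha> - n) * p')) * (ennreal (N powr e) * ennreal (V * (n / (n - e) * N powr (n - e))) + ennreal (L * (2 * N) powr n))
       = ennreal (c0 * N powr ((\<alpha> - n) * p') * (N powr e * (V * (n / (n - e) * N powr (n - e))) + L * (2 * N) powr n))"
      using e V L pp' by (simp add: c0_def flip: ennreal_mult ennreal_plus)
    also have "c0 * N powr ((\<alpha> - n) * p') * (N powr e * (V * (n / (n - e) * N powr (n - e))) + L * (2 * N) powr n)
       = C1 * (N powr ((\<alpha> - n) * p') * N powr n)"
    proof -
      have "N powr e * (V * (n / (n - e) * N powr (n - e))) = V * (n / (n - e)) * (N powr e * N powr (n - e))" by simp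
      also have "N powr e * N powr (n - e) = N powr n" by (simp flip: powr_add)
      finally have eq: "N powr e * (V * (n / (n - e) * N powr (n - e))) = V * (n / (n - e)) * N powr n" .
      show ?thesis unfolding eq C1_def using N by (simp add: powr_mult algebra_simps)
    qed
    also have "N powr ((\<alpha> - n) * p') * N powr n = N powr - (n * p' / q)"
      by (simp only: powr_add[symmetric] exponent_relations)
    finally show ?thesis by (simp add: N_def)
  qed
  have AD: "(\<integral>\<^sup>+x. ennreal (norm x powr - n * k1 x w powr p) \<partial>lborel) \<le> ennreal D" for w
  proof (cases "w = 0")
    case True
    then have "k1 x w = 0" for x using \<epsilon> by (simp add: k1_def)
    then show ?thesis using p by simp
  next
    case False
    define N where "N = norm w"
    have N: "N > 0" using False by (simp add: N_def)
    have "(\<integral>\<^sup>+x. ennreal (norm x powr - n * k1 x w powr p) \<partial>lborel)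
      \<le> (\<integral>\<^sup>+x. ennreal (N powr (\<epsilon> * p)) * (ennreal (norm (x::'a) powr (- n - \<epsilon> * p)) * indicator {N..} (norm x)) \<partial>lborel)"
    proof (intro nn_integral_mono)
      fix x :: 'a
      show "ennreal (norm x powr - n * k1 x w powr p) \<le> ennreal (N powr (\<epsilon> * p)) * (ennreal (norm (x::'a) powr (- n - \<epsilon> * p)) * indicator {N..} (norm x))"
      proof (cases "2 * norm w < norm x")
        case True
        then have x1: "N \<le> norm x" using norm_ge_zero[of w] unfolding N_def by linarith
        have x: "norm x > 0" "N \<le> norm x" using x1 N by auto
        have "k1 x w powr p = N powr (\<epsilon> * p) * norm x powr (- \<epsilon> * p)"
          using True x N by (simp add: k1_def powr_powr powr_divide N_def powr_minus_divide)
        then have "norm x powr - n * k1 x w powr p = N powr (\<epsilon> * p) * (norm x powr - n * norm x powr (- \<epsilon> * p))"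
          by simp
        also have "norm x powr - n * norm x powr (- \<epsilon> * p) = norm x powr (- n - \<epsilon> * p)"
          by (simp flip: powr_add)
        finally show ?thesis using x by (simp add: ennreal_mult)
      next
        case False
        then have "k1 x w = 0" by (simp add: k1_def)
        then show ?thesis using p by simp
      qed
    qed
    also have "\<dots> = ennreal (N powr (\<epsilon> * p)) * ennreal (V * (n / (\<epsilon> * p) * N powr (- \<epsilon> * p)))"
      using N \<epsilon> p V pp' by (subst nn_integral_cmult, simp, subst nn_integral_norm_powr_ge) (auto simp: n_def[symmetric] ennreal_mult[symmetric])
    also have "\<dots> = ennreal ((V * (n / (\<epsilon> * p))) * (N powr (\<epsilon> * p) * N powr (- \<epsilon> * p)))"
      using V \<epsilon> p pp' by (subst ennreal_mult[symmetric]) (auto simp: mult_ac)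
    also have "N powr (\<epsilon> * p) * N powr (- \<epsilon> * p) = 1" using N by (simp flip: powr_add)
    finally show ?thesis by (simp add: D_def)
  qed
  show ?thesis
  proof (rule region_boundedI[where ?k1.0=k1 and ?k2.0=k2, OF _ _ _ _ _ C1 D0 k2A AD])
    show "case_prod k1 \<in> borel_measurable (borel \<Otimes>\<^sub>M borel)" "case_prod k2 \<in> borel_measurable (borel \<Otimes>\<^sub>M borel)"
      unfolding k1_def k2_def by measurable
    show "k1 x w \<le> 1" for x w
    proof (cases "2 * norm w < norm x")
      case True
      then have "norm w \<le> norm x" using norm_ge_zero[of w] by linarith
      then have "norm w / norm x \<le> 1" by (simp add: divide_le_eq)
      then show ?thesis using \<epsilon> by (auto simp: k1_def intro!: powr_le1)
    qed (simp add: k1_def)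
    show "norm x powr l * norm w powr - l * H (x - w) = k1 x w * k2 x w" if R: "2 * norm w < norm x" for x w
    proof (cases "w = 0")
      case False
      have x: "norm x > 0" "norm w > 0" using False R norm_ge_zero[of w] by (auto simp del: norm_ge_zero)
      have "k1 x w * k2 x w = ((norm w / norm x) powr \<epsilon> * (norm w / norm x) powr (- l - \<epsilon>)) * H (x - w)"
        using R by (simp add: k1_def k2_def)
      also have "(norm w / norm x) powr \<epsilon> * (norm w / norm x) powr (- l - \<epsilon>) = (norm w / norm x) powr - l"
        by (simp flip: powr_add)
      also have "\<dots> = norm x powr l * norm w powr - l"
        using x by (simp add: powr_divide powr_minus_divide)
      finally show ?thesis by simp
    qed (simp add: k1_def)
  qed (auto simp: k1_def k2_def Hnn)
qed

text \<open>
  For \<open>|w| > 2|x|\<close> one has \<open>|x - w| \<sim> |w|\<close>, so the weight is a power of \<open>|x - w|\<close> and the bound is a single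
  polar integral over \<open>|v| \<ge> |x|\<close>. It converges at infinity exactly because of the lower bound on \<open>l\<close>.
\<close>

lemma infinity_bound:
  assumes lam: "\<alpha> - n / p < l"
  shows "region_bounded l (\<lambda>x w. 2 * norm x < norm w)"
proof -
  define \<epsilon> where "\<epsilon> = (l - (\<alpha> - n / p)) / 2"
  have \<epsilon>: "0 < \<epsilon>" "\<epsilon> < l - (\<alpha> - n / p)" using lam unfolding \<epsilon>_def by auto
  define k1 where "k1 x w = (if 2 * norm x < norm w then (norm x / norm w) powr \<epsilon> else 0)" for x w :: 'a
  define k2 where "k2 x w = (if 2 * norm x < norm w then (norm x / norm w) powr (l - \<epsilon>) * H (x - w) else 0)" for x w :: 'a
  define \<beta> where "\<beta> = (\<epsilon> - l) * p'"
  define c where "c = \<beta> + (\<alpha> - n) * p'"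
  \<comment> \<open>Convergence at infinity of the polar integral in \<open>k2A\<close>.\<close>
  have c: "c < - n"
  proof -
    have "\<beta> < (n / p - \<alpha>) * p'" unfolding \<beta>_def using \<epsilon> pp' by (intro mult_strict_right_mono) auto
    then have "c < (n / p - n) * p'" by (simp add: c_def algebra_simps)
    also have "\<dots> = - n * (1 - 1 / p) * p'" by (simp add: algebra_simps)
    also have "1 - 1 / p = 1 / p'" using p(2) by simp
    finally show ?thesis using pp' by simp
  qed
  have cn: "c + n = \<beta> - n * p' / q" using exponent_relations(2) by (simp add: c_def)
  obtain V where V: "emeasure lborel (cball (0::'a) 1) = ennreal V" "0 \<le> V" by (rule emeasure_cball_real)
  obtain L where L: "(\<integral>\<^sup>+v. ennreal (\<phi> v powr p') * indicator {v. norm v \<le> 1} v \<partial>lborel) = ennreal L" "0 \<le> L"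
    using phi_power_integrable[of p'] pp' S by auto
  define C1 where "C1 = 2 powr \<bar>\<beta>\<bar> * (L * (n / - (c + n)))"
  have C1: "0 \<le> C1" using V L c pp' by (auto simp: C1_def intro!: mult_nonneg_nonneg divide_nonneg_nonneg)
  define D where "D = V * (n / (\<epsilon> * p))"
  have D0: "0 \<le> D" using C1 V pp' \<epsilon> p by (auto simp: D_def)
  have k2A: "(\<integral>\<^sup>+w. ennreal (k2 x w powr p') \<partial>lborel) \<le> ennreal (C1 * norm x powr - (n * p' / q))" for x
  proof (cases "x = 0")
    case True
    then have "k2 x w = 0" for w by (simp add: k2_def)
    then show ?thesis using pp' by simp
  next
    case False
    define N where "N = norm x"
    have N: "N > 0" using False by (simp add: N_def)
    let ?F = "\<lambda>v. ennreal (\<phi> v powr p') * (ennreal (norm v powr c) * indicator {N..} (norm v))"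
    have "(\<integral>\<^sup>+w. ennreal (k2 x w powr p') \<partial>lborel) \<le> (\<integral>\<^sup>+w. ennreal (2 powr \<bar>\<beta>\<bar> * N powr - \<beta>) * ?F (x - w) \<partial>lborel)"
    proof (intro nn_integral_mono)
      fix w :: 'a
      show "ennreal (k2 x w powr p') \<le> ennreal (2 powr \<bar>\<beta>\<bar> * N powr - \<beta>) * ?F (x - w)"
      proof (cases "2 * norm x < norm w")
        case True
        have xw: "x - w \<noteq> 0" "N \<le> norm (x - w)" "norm w \<le> 2 * norm (x - w)" "norm (x - w) \<le> 2 * norm w" "norm w > 0"
          using True N norm_triangle_ineq2[of w x] norm_triangle_ineq4[of x w] norm_minus_commute[of x w] by (auto simp: N_def)
        have "k2 x w powr p' = (N / norm w) powr - \<beta> * H (x - w) powr p'"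
          using True Hnn by (simp add: k2_def powr_mult powr_powr N_def \<beta>_def algebra_simps)
        also have "(N / norm w) powr - \<beta> = N powr - \<beta> * norm w powr \<beta>"
          using xw N by (simp add: powr_divide powr_minus_divide)
        also have "H (x - w) powr p' = norm (x - w) powr ((\<alpha> - n) * p') * \<phi> (x - w) powr p'"
          unfolding H_phi[OF xw(1)] by (simp add: powr_mult powr_powr)
        also have "N powr - \<beta> * norm w powr \<beta> * (norm (x - w) powr ((\<alpha> - n) * p') * \<phi> (x - w) powr p')
          \<le> N powr - \<beta> * (2 powr \<bar>\<beta>\<bar> * norm (x - w) powr \<beta>) * (norm (x - w) powr ((\<alpha> - n) * p') * \<phi> (x - w) powr p')"
          using xw by (intro mult_right_mono mult_left_mono powr_comparable) auto
        also have "\<dots> = (2 powr \<bar>\<beta>\<bar> * N powr - \<beta>) * (\<phi> (x - w) powr p' * (norm (x - w) powr \<beta> * norm (x - w) powr ((\<alpha> - n) * p')))"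
          by simp
        also have "norm (x - w) powr \<beta> * norm (x - w) powr ((\<alpha> - n) * p') = norm (x - w) powr c"
          by (simp add: c_def powr_add)
        finally show ?thesis using xw(2) by (simp add: ennreal_leI flip: ennreal_mult)
      next
        case False
        then have "k2 x w = 0" by (simp add: k2_def)
        then show ?thesis using pp' by simp
      qed
    qed
    also have "\<dots> = ennreal (2 powr \<bar>\<beta>\<bar> * N powr - \<beta>) * (\<integral>\<^sup>+w. ?F (x - w) \<partial>lborel)"
      by (simp add: nn_integral_cmult)
    also have "(\<integral>\<^sup>+w. ?F (x - w) \<partial>lborel) = (\<integral>\<^sup>+v. ?F v \<partial>lborel)"
      by (rule nn_integral_lborel_reflect) measurable
    also have "\<dots> = ennreal L * ennreal (n / - (c + n) * N powr (c + n))"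
      using N c by (subst nn_integral_homogeneous_powr_ge[OF _ phi_hom]) (auto simp: L n_def[symmetric])
    also have "ennreal (2 powr \<bar>\<beta>\<bar> * N powr - \<beta>) * (ennreal L * ennreal (n / - (c + n) * N powr (c + n)))
       = ennreal (2 powr \<bar>\<beta>\<bar> * N powr - \<beta> * (L * (n / - (c + n) * N powr (c + n))))"
    proof -
      have "0 \<le> n / - (c + n)" using c pp' by (intro divide_nonneg_nonneg) auto
      then show ?thesis using L by (simp only: ennreal_mult mult_nonneg_nonneg powr_ge_zero)
    qed
    also have "2 powr \<bar>\<beta>\<bar> * N powr - \<beta> * (L * (n / - (c + n) * N powr (c + n))) = C1 * (N powr - \<beta> * N powr (c + n))"
      by (simp add: C1_def)
    also have "N powr - \<beta> * N powr (c + n) = N powr - (n * p' / q)"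
      by (simp add: powr_add[symmetric] cn)
    finally show ?thesis by (simp add: N_def)
  qed
  have AD: "(\<integral>\<^sup>+x. ennreal (norm x powr - n * k1 x w powr p) \<partial>lborel) \<le> ennreal D" for w
  proof (cases "w = 0")
    case True
    then have "k1 x w = 0" for x using \<epsilon> by (simp add: k1_def)
    then show ?thesis using p by simp
  next
    case False
    define N where "N = norm w"
    have N: "N > 0" using False by (simp add: N_def)
    have "(\<integral>\<^sup>+x. ennreal (norm x powr - n * k1 x w powr p) \<partial>lborel)
      \<le> (\<integral>\<^sup>+x. ennreal (N powr (- \<epsilon> * p)) * (ennreal (norm (x::'a) powr (- n + \<epsilon> * p)) * indicator {..N} (norm x)) \<partial>lborel)"
    proof (intro nn_integral_mono)
      fix x :: 'a
      show "ennreal (norm x powr - n * k1 x w powr p) \<le> ennreal (N powr (- \<epsilon> * p)) * (ennreal (norm (x::'a) powr (- n + \<epsilon> * p)) * indicator {..N} (norm x))"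
      proof (cases "2 * norm x < norm w")
        case True
        then have x: "norm x \<le> N" using N by (auto simp: N_def intro: order_trans[of _ "2 * norm x"])
        have "k1 x w powr p = N powr (- \<epsilon> * p) * norm x powr (\<epsilon> * p)"
          using True x N by (simp add: k1_def powr_powr powr_divide N_def powr_minus_divide)
        then have "norm x powr - n * k1 x w powr p = N powr (- \<epsilon> * p) * (norm x powr - n * norm x powr (\<epsilon> * p))"
          by simp
        also have "norm x powr - n * norm x powr (\<epsilon> * p) = norm x powr (- n + \<epsilon> * p)"
          by (simp flip: powr_add)
        finally show ?thesis using x by (simp add: ennreal_mult)
      next
        case False
        then have "k1 x w = 0" by (simp add: k1_def)
        then show ?thesis using p by simp
      qed
    qed
    also have "\<dots> = ennreal (N powr (- \<epsilon> * p)) * ennreal (V * (n / (\<epsilon> * p) * N powr (\<epsilon> * p)))"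
      using N \<epsilon> p V pp' by (subst nn_integral_cmult, simp, subst nn_integral_norm_powr_le) (auto simp: n_def[symmetric] ennreal_mult[symmetric])
    also have "\<dots> = ennreal ((V * (n / (\<epsilon> * p))) * (N powr (- \<epsilon> * p) * N powr (\<epsilon> * p)))"
      using V \<epsilon> p pp' by (subst ennreal_mult[symmetric]) (auto simp: mult_ac)
    also have "N powr (- \<epsilon> * p) * N powr (\<epsilon> * p) = 1" using N by (simp flip: powr_add)
    finally show ?thesis by (simp add: D_def)
  qed
  show ?thesis
  proof (rule region_boundedI[where ?k1.0=k1 and ?k2.0=k2, OF _ _ _ _ _ C1 D0 k2A AD])
    show "case_prod k1 \<in> borel_measurable (borel \<Otimes>\<^sub>M borel)" "case_prod k2 \<in> borel_measurable (borel \<Otimes>\<^sub>M borel)"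
      unfolding k1_def k2_def by measurable
    show "k1 x w \<le> 1" for x w
    proof (cases "2 * norm x < norm w")
      case True
      then have "norm x \<le> norm w" using norm_ge_zero[of x] by linarith
      then have "norm x / norm w \<le> 1" by (simp add: divide_le_eq)
      then show ?thesis using \<epsilon> by (auto simp: k1_def intro!: powr_le1)
    qed (simp add: k1_def)
    show "norm x powr l * norm w powr - l * H (x - w) = k1 x w * k2 x w" if R: "2 * norm x < norm w" for x w
    proof (cases "x = 0")
      case False
      have x: "norm x > 0" "norm w > 0" using False R norm_ge_zero[of x] by (auto simp del: norm_ge_zero)
      have "k1 x w * k2 x w = ((norm x / norm w) powr \<epsilon> * (norm x / norm w) powr (l - \<epsilon>)) * H (x - w)"
        using R by (simp add: k1_def k2_def)
      also have "(norm x / norm w) powr \<epsilon> * (norm x / norm w) powr (l - \<epsilon>) = (norm x / norm w) powr l"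
        by (simp flip: powr_add)
      also have "\<dots> = norm x powr l * norm w powr - l"
        using x by (simp add: powr_divide powr_minus_divide)
      finally show ?thesis by simp
    qed (simp add: k1_def)
  qed (auto simp: k1_def k2_def Hnn)
qed

text \<open>
  In the remaining region \<open>|x|\<close> and \<open>|w|\<close> differ by a factor of at most 2, so that the quotient of the weights is at most \<open>2^|l|\<close>.
\<close>

theorem weighted_bound:
  assumes lam: "\<alpha> - n / p < l" "l < n * (1 / p' - 1 / S)"
  shows "\<exists>C\<ge>0. \<forall>g\<in>borel_measurable borel. (\<forall>x. 0 \<le> g x) \<longrightarrow>
     (\<integral>\<^sup>+x. ennpowr (\<integral>\<^sup>+w. ennreal (g w * (norm x powr l * norm w powr - l * H (x - w))) \<partial>lborel) q \<partial>lborel)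
       \<le> ennreal C * ennpowr (\<integral>\<^sup>+w. ennreal (g w powr p) \<partial>lborel) (q / p)"
proof -
  obtain C1 where C1: "C1 \<ge> 0" "\<And>g. g\<in>borel_measurable borel \<Longrightarrow> (\<forall>x. 0 \<le> g x) \<Longrightarrow>
     (\<integral>\<^sup>+x. ennpowr (\<integral>\<^sup>+w. ennreal (if 2 * norm w < norm x then g w * (norm x powr l * norm w powr - l * H (x - w)) else 0) \<partial>lborel) q \<partial>lborel)
       \<le> ennreal C1 * ennpowr (\<integral>\<^sup>+w. ennreal (g w powr p) \<partial>lborel) (q / p)"
    using origin_bound[OF lam(2)] unfolding region_bounded_def by blast
  obtain C2 where C2: "C2 \<ge> 0" "\<And>g. g\<in>borel_measurable borel \<Longrightarrow> (\<forall>x. 0 \<le> g x) \<Longrightarrow>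
     (\<integral>\<^sup>+x. ennpowr (\<integral>\<^sup>+w. ennreal (g w * H (x - w)) \<partial>lborel) q \<partial>lborel)
       \<le> ennreal C2 * ennpowr (\<integral>\<^sup>+w. ennreal (g w powr p) \<partial>lborel) (q / p)"
    using local_bound by blast
  obtain C3 where C3: "C3 \<ge> 0" "\<And>g. g\<in>borel_measurable borel \<Longrightarrow> (\<forall>x. 0 \<le> g x) \<Longrightarrow>
     (\<integral>\<^sup>+x. ennpowr (\<integral>\<^sup>+w. ennreal (if 2 * norm x < norm w then g w * (norm x powr l * norm w powr - l * H (x - w)) else 0) \<partial>lborel) q \<partial>lborel)
       \<le> ennreal C3 * ennpowr (\<integral>\<^sup>+w. ennreal (g w powr p) \<partial>lborel) (q / p)"
    using infinity_bound[OF lam(1)] unfolding region_bounded_def by blast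
  define b where "b = (2::real) powr \<bar>l\<bar>"
  define C where "C = 2 powr q * (C1 + 2 powr q * (b powr q * C2 + C3))"
  have C: "0 \<le> C" using C1 C2 C3 by (simp add: C_def)
  show ?thesis
  proof (intro exI[of _ C] conjI C ballI impI)
    fix g :: "'a \<Rightarrow> real" assume g[measurable]: "g \<in> borel_measurable borel" and gnn: "\<forall>x. 0 \<le> g x"
    let ?K = "\<lambda>x w. g w * (norm x powr l * norm w powr - l * H (x - w))"
    let ?P = "ennpowr (\<integral>\<^sup>+w. ennreal (g w powr p) \<partial>lborel) (q / p)"
    let ?f1 = "\<lambda>x w. if 2 * norm w < norm x then ?K x w else 0"
    let ?f3 = "\<lambda>x w. if 2 * norm x < norm w then ?K x w else 0"
    let ?u1 = "\<lambda>x. \<integral>\<^sup>+w. ennreal (?f1 x w) \<partial>lborel"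
    let ?u2 = "\<lambda>x. \<integral>\<^sup>+w. ennreal (g w * H (x - w)) \<partial>lborel"
    let ?u3 = "\<lambda>x. \<integral>\<^sup>+w. ennreal (?f3 x w) \<partial>lborel"
    have pt: "ennpowr (\<integral>\<^sup>+w. ennreal (?K x w) \<partial>lborel) q
      \<le> ennreal (2 powr q) * (ennpowr (?u1 x) q + ennreal (2 powr q) * (ennreal (b powr q) * ennpowr (?u2 x) q + ennpowr (?u3 x) q))" for x
    proof -
      have "(\<integral>\<^sup>+w. ennreal (?K x w) \<partial>lborel)
        \<le> (\<integral>\<^sup>+w. ennreal (?f1 x w) + (ennreal b * ennreal (g w * H (x - w)) + ennreal (?f3 x w)) \<partial>lborel)"
      proof (intro nn_integral_mono)
        fix w
        have nn: "0 \<le> ?K x w" "0 \<le> g w * H (x - w)"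
          using gnn Hnn by auto
        have "?K x w \<le> b * (g w * H (x - w))"
          if "\<not> 2 * norm w < norm x" "\<not> 2 * norm x < norm w"
        proof (cases "x = 0 \<or> w = 0")
          case True
          then show ?thesis using nn(2) by (auto simp: b_def)
        next
          case False
          then have "norm x powr l \<le> b * norm w powr l"
            unfolding b_def using that by (intro powr_comparable) auto
          then have "norm x powr l * norm w powr - l \<le> b"
            using False by (simp add: powr_minus divide_simps mult.commute)
          then have "norm x powr l * norm w powr - l * (g w * H (x - w)) \<le> b * (g w * H (x - w))"
            using nn(2) by (rule mult_right_mono)
          then show ?thesis by (simp add: mult_ac)
        qed
        then have "?K x w \<le> ?f1 x w + (b * (g w * H (x - w)) + ?f3 x w)"
          using nn by (auto simp: b_def)
        then have "ennreal (?K x w) \<le> ennreal (?f1 x w + (b * (g w * H (x - w)) + ?f3 x w))"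
          by (rule ennreal_leI)
        also have "\<dots> = ennreal (?f1 x w) + (ennreal b * ennreal (g w * H (x - w)) + ennreal (?f3 x w))"
          using nn by (subst ennreal_plus ennreal_mult; simp add: b_def)+
        finally show "ennreal (?K x w) \<le> ennreal (?f1 x w) + (ennreal b * ennreal (g w * H (x - w)) + ennreal (?f3 x w))" .
      qed
      also have "\<dots> = ?u1 x + (ennreal b * ?u2 x + ?u3 x)"
        by (subst nn_integral_add, measurable, subst nn_integral_add, measurable, subst nn_integral_cmult, measurable)
      finally have "ennpowr (\<integral>\<^sup>+w. ennreal (?K x w) \<partial>lborel) q
         \<le> ennpowr (?u1 x + (ennreal b * ?u2 x + ?u3 x)) q"
        using q by (intro ennpowr_mono) auto
      also have "\<dots> \<le> ennreal (2 powr q) * (ennpowr (?u1 x) q + ennpowr (ennreal b * ?u2 x + ?u3 x) q)"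
        using q by (intro ennpowr_add_le) auto
      also have "\<dots> \<le> ennreal (2 powr q) * (ennpowr (?u1 x) q + ennreal (2 powr q) * (ennpowr (ennreal b * ?u2 x) q + ennpowr (?u3 x) q))"
        using q by (intro mult_left_mono add_left_mono ennpowr_add_le) auto
      also have "ennpowr (ennreal b * ?u2 x) q = ennreal (b powr q) * ennpowr (?u2 x) q"
        by (simp add: ennpowr_mult ennpowr_ennreal b_def)
      finally show ?thesis .
    qed
    have "(\<integral>\<^sup>+x. ennpowr (\<integral>\<^sup>+w. ennreal (?K x w) \<partial>lborel) q \<partial>lborel)
       \<le> (\<integral>\<^sup>+x. ennreal (2 powr q) * (ennpowr (?u1 x) q + ennreal (2 powr q) * (ennreal (b powr q) * ennpowr (?u2 x) q + ennpowr (?u3 x) q)) \<partial>lborel)"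
      by (intro nn_integral_mono pt)
    also have "\<dots> = ennreal (2 powr q) * ((\<integral>\<^sup>+x. ennpowr (?u1 x) q \<partial>lborel) + ennreal (2 powr q) * (ennreal (b powr q) * (\<integral>\<^sup>+x. ennpowr (?u2 x) q \<partial>lborel) + (\<integral>\<^sup>+x. ennpowr (?u3 x) q \<partial>lborel)))"
      by (simp add: nn_integral_cmult nn_integral_add)
    also have "\<dots> \<le> ennreal (2 powr q) * (ennreal C1 * ?P + ennreal (2 powr q) * (ennreal (b powr q) * (ennreal C2 * ?P) + ennreal C3 * ?P))"
      by (intro mult_left_mono add_mono C1(2)[OF g gnn] C2(2)[OF g gnn] C3(2)[OF g gnn]) auto
    also have "\<dots> = ennreal C * ?P"
      using C1(1) C2(1) C3(1) by (simp add: C_def b_def ennreal_mult distrib_left distrib_right mult.assoc)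
    finally show "(\<integral>\<^sup>+x. ennpowr (\<integral>\<^sup>+w. ennreal (?K x w) \<partial>lborel) q \<partial>lborel) \<le> ennreal C * ?P" .
  qed
qed

end

section \<open>Uniformly distributed measures\<close>

text \<open>The erosion of \<open>U\<close> by \<open>d\<close>.\<close>

definition inner_pts :: "real \<Rightarrow> 'a::metric_space set \<Rightarrow> 'a set" where
  "inner_pts d U = {x. ball x d \<subseteq> U}"

lemma closed_inner_pts: 
  fixes U :: "'a::metric_space set"
  shows "closed (inner_pts d U)"
proof -
  have "inner_pts d U = (\<Inter>y\<in>-U. {x. d \<le> dist x y})"
    by (force simp: inner_pts_def subset_eq not_less)
  moreover have "closed {x. d \<le> dist x y}" for y
    by (intro closed_Collect_le continuous_intros)
  ultimately show ?thesis by auto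
qed

text \<open>
  Both sides bound the product measure of the pairs in \<open>X \<times> U\<close> at distance less than \<open>d\<close>, computed in the two orders of integration.
\<close>

lemma uniform_measures_compare:
  fixes \<mu> \<nu> :: "'a::{metric_space, second_countable_topology} measure" and X :: "'a set"
  assumes [measurable_cong]: "sets \<mu> = sets borel" "sets \<nu> = sets borel" and sf: "sigma_finite_measure \<mu>" "sigma_finite_measure \<nu>"
    and X: "AE x in \<mu>. x \<in> X" "AE x in \<nu>. x \<in> X"
    and \<mu>: "\<And>x. x \<in> X \<Longrightarrow> emeasure \<mu> (ball x d) = a" and \<nu>: "\<And>x. x \<in> X \<Longrightarrow> emeasure \<nu> (ball x d) = b"
    and [measurable]: "U \<in> sets borel" and "0 < d"
  shows "emeasure \<mu> (inner_pts d U) * b \<le> a * emeasure \<nu> U"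
proof -
  interpret M: sigma_finite_measure \<mu> by fact
  interpret N: sigma_finite_measure \<nu> by fact
  interpret P: pair_sigma_finite \<mu> \<nu> ..
  have [measurable]: "inner_pts d U \<in> sets borel" using closed_inner_pts by (rule borel_closed)
  have "emeasure \<mu> (inner_pts d U) * b = (\<integral>\<^sup>+x. b * indicator (inner_pts d U) x \<partial>\<mu>)"
    by (subst nn_integral_cmult_indicator) (auto simp: mult.commute)
  also have "\<dots> \<le> (\<integral>\<^sup>+x. \<integral>\<^sup>+y. indicator U y * indicator {z. dist (fst z) (snd z) < d} (x, y) \<partial>\<nu> \<partial>\<mu>)"
  proof (intro nn_integral_mono_AE, use X(1) in eventually_elim)
    fix x assume x: "x \<in> X"
    show "b * indicator (inner_pts d U) x \<le> (\<integral>\<^sup>+y. indicator U y * indicator {z. dist (fst z) (snd z) < d} (x, y) \<partial>\<nu>)"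
    proof (cases "x \<in> inner_pts d U")
      case True
      then have sub: "ball x d \<subseteq> U" by (simp add: inner_pts_def)
      have "b = (\<integral>\<^sup>+y. indicator (ball x d) y \<partial>\<nu>)" using \<nu>[OF x] by simp
      also have "\<dots> \<le> (\<integral>\<^sup>+y. indicator U y * indicator {z. dist (fst z) (snd z) < d} (x, y) \<partial>\<nu>)"
        using sub by (intro nn_integral_mono) (auto simp: indicator_def)
      finally show ?thesis using True by simp
    qed simp
  qed
  also have "\<dots> = (\<integral>\<^sup>+y. \<integral>\<^sup>+x. indicator U y * indicator {z. dist (fst z) (snd z) < d} (x, y) \<partial>\<mu> \<partial>\<nu>)"
    by (rule P.Fubini'[symmetric]) measurable
  also have "\<dots> \<le> (\<integral>\<^sup>+y. a * indicator U y \<partial>\<nu>)"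
  proof (intro nn_integral_mono_AE, use X(2) in eventually_elim)
    fix y assume y: "y \<in> X"
    have "(\<integral>\<^sup>+x. indicator U y * indicator {z. dist (fst z) (snd z) < d} (x, y) \<partial>\<mu>) = (\<integral>\<^sup>+x. indicator U y * indicator (ball y d) x \<partial>\<mu>)"
      by (intro nn_integral_cong) (auto simp: indicator_def dist_commute)
    also have "\<dots> = indicator U y * a" using \<mu>[OF y] by (subst nn_integral_cmult_indicator) auto
    finally show "(\<integral>\<^sup>+x. indicator U y * indicator {z. dist (fst z) (snd z) < d} (x, y) \<partial>\<mu>) \<le> a * indicator U y"
      by (simp add: mult.commute)
  qed
  also have "\<dots> = a * emeasure \<nu> U" by (subst nn_integral_cmult_indicator) auto
  finally show ?thesis .
qed

lemma SUP_emeasure_inner_pts: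
  fixes \<mu> :: "'a::metric_space measure"
  assumes [measurable_cong]: "sets \<mu> = sets borel" and "open U"
  shows "(SUP i. emeasure \<mu> (inner_pts (1 / real (Suc i)) U)) = emeasure \<mu> U"
proof -
  have "(\<Union>i. inner_pts (1 / real (Suc i)) U) = U"
  proof safe
    fix x i assume "x \<in> inner_pts (1 / real (Suc i)) U"
    then show "x \<in> U" by (auto simp: inner_pts_def)
  next
    fix x assume "x \<in> U"
    then obtain e where e: "e > 0" "ball x e \<subseteq> U" using \<open>open U\<close> by (auto simp: open_contains_ball)
    then obtain i where "1 / real (Suc i) < e" using reals_Archimedean[of e] by (auto simp: inverse_eq_divide)
    then have "ball x (1 / real (Suc i)) \<subseteq> U" using e by (auto simp: subset_eq)
    then show "x \<in> (\<Union>i. inner_pts (1 / real (Suc i)) U)" by (auto simp: inner_pts_def)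
  qed
  moreover have "(SUP i. emeasure \<mu> (inner_pts (1 / real (Suc i)) U)) = emeasure \<mu> (\<Union>i. inner_pts (1 / real (Suc i)) U)"
  proof (rule SUP_emeasure_incseq)
    show "range (\<lambda>i. inner_pts (1 / real (Suc i)) U) \<subseteq> sets \<mu>"
      using closed_inner_pts assms(1) by (auto intro: borel_closed)
    have "1 / real (Suc j) \<le> 1 / real (Suc i)" if "i \<le> j" for i j
      using that by (intro divide_left_mono) auto
    then show "incseq (\<lambda>i. inner_pts (1 / real (Suc i)) U)"
      unfolding incseq_def inner_pts_def by (fastforce simp: subset_eq)
  qed
  ultimately show ?thesis by simp
qed

text \<open>
  Multiplying \<open>uniform_measures_compare\<close> for \<open>U\<close> and, with the measures exchanged, for \<open>V\<close> makes the unknown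
  masses \<open>a d\<close>, \<open>b d\<close> of balls cancel; then \<open>d \<rightarrow> 0\<close>.
\<close>

lemma uniform_measures_cross:
  fixes \<mu> \<nu> :: "'a::{metric_space, second_countable_topology} measure" and X :: "'a set"
  assumes sets: "sets \<mu> = sets borel" "sets \<nu> = sets borel" and sf: "sigma_finite_measure \<mu>" "sigma_finite_measure \<nu>"
    and X: "AE x in \<mu>. x \<in> X" "AE x in \<nu>. x \<in> X"
    and \<mu>: "\<And>x d. x \<in> X \<Longrightarrow> 0 < d \<Longrightarrow> emeasure \<mu> (ball x d) = a d" and \<nu>: "\<And>x d. x \<in> X \<Longrightarrow> 0 < d \<Longrightarrow> emeasure \<nu> (ball x d) = b d"
    and pos: "\<And>d. 0 < d \<Longrightarrow> 0 < a d \<and> a d < top \<and> 0 < b d \<and> b d < top"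
    and "open U" "open V"
  shows "emeasure \<mu> U * emeasure \<nu> V \<le> emeasure \<nu> U * emeasure \<mu> V"
proof -
  have [measurable]: "U \<in> sets borel" "V \<in> sets borel" using \<open>open U\<close> \<open>open V\<close> by auto
  have le: "emeasure \<mu> (inner_pts d U) * emeasure \<nu> (inner_pts d V) \<le> emeasure \<nu> U * emeasure \<mu> V" if d: "0 < d" for d
  proof -
    have 1: "emeasure \<mu> (inner_pts d U) * b d \<le> a d * emeasure \<nu> U"
      using d by (intro uniform_measures_compare[OF sets sf X \<mu> \<nu>]) auto
    have 2: "emeasure \<nu> (inner_pts d V) * a d \<le> b d * emeasure \<mu> V"
      using d by (intro uniform_measures_compare[OF sets(2,1) sf(2,1) X(2,1) \<nu> \<mu>]) auto
    have "(emeasure \<mu> (inner_pts d U) * b d) * (emeasure \<nu> (inner_pts d V) * a d) \<le> (a d * emeasure \<nu> U) * (b d * emeasure \<mu> V)"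
      by (rule mult_mono[OF 1 2]) auto
    then have "(a d * b d) * (emeasure \<mu> (inner_pts d U) * emeasure \<nu> (inner_pts d V)) \<le> (a d * b d) * (emeasure \<nu> U * emeasure \<mu> V)"
      by (simp add: mult_ac)
    moreover have "0 < a d * b d" "a d * b d < top" using pos[OF d] by (auto simp: ennreal_zero_less_mult_iff ennreal_mult_less_top)
    ultimately show ?thesis by (metis ennreal_mult_le_mult_iff less_irrefl)
  qed
  have "emeasure \<mu> (inner_pts (1 / real (Suc i)) U) * emeasure \<nu> (inner_pts (1 / real (Suc j)) V) \<le> emeasure \<nu> U * emeasure \<mu> V" for i j
  proof -
    have meas: "inner_pts e W \<in> sets \<mu>" "inner_pts e W \<in> sets \<nu>" for e W
      unfolding sets by (rule borel_closed[OF closed_inner_pts])+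
    have mono: "inner_pts (1 / real (Suc i)) W \<subseteq> inner_pts (1 / real (Suc (max i j))) W" 
      "inner_pts (1 / real (Suc j)) W \<subseteq> inner_pts (1 / real (Suc (max i j))) W" for W :: "'a set"
    proof -
      have "1 / real (Suc (max i j)) \<le> 1 / real (Suc i)" "1 / real (Suc (max i j)) \<le> 1 / real (Suc j)"
        by (intro divide_left_mono; simp)+
      then show "inner_pts (1 / real (Suc i)) W \<subseteq> inner_pts (1 / real (Suc (max i j))) W" 
        "inner_pts (1 / real (Suc j)) W \<subseteq> inner_pts (1 / real (Suc (max i j))) W"
        unfolding inner_pts_def by (blast dest: subset_ball)+
    qed
    have "emeasure \<mu> (inner_pts (1 / real (Suc i)) U) * emeasure \<nu> (inner_pts (1 / real (Suc j)) V)
      \<le> emeasure \<mu> (inner_pts (1 / real (Suc (max i j))) U) * emeasure \<nu> (inner_pts (1 / real (Suc (max i j))) V)"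
    proof (rule mult_mono)
      show "emeasure \<mu> (inner_pts (1 / real (Suc i)) U) \<le> emeasure \<mu> (inner_pts (1 / real (Suc (max i j))) U)"
        by (rule emeasure_mono[OF mono(1)[of U] meas(1)])
      show "emeasure \<nu> (inner_pts (1 / real (Suc j)) V) \<le> emeasure \<nu> (inner_pts (1 / real (Suc (max i j))) V)"
        by (rule emeasure_mono[OF mono(2)[of V] meas(2)])
    qed auto
    also have "\<dots> \<le> emeasure \<nu> U * emeasure \<mu> V" by (rule le) simp
    finally show ?thesis .
  qed
  then have "(SUP i. emeasure \<mu> (inner_pts (1 / real (Suc i)) U) * (SUP j. emeasure \<nu> (inner_pts (1 / real (Suc j)) V))) \<le> emeasure \<nu> U * emeasure \<mu> V"
    by (auto simp: SUP_mult_left_ennreal intro!: SUP_least)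
  then have "(SUP i. emeasure \<mu> (inner_pts (1 / real (Suc i)) U)) * emeasure \<nu> V \<le> emeasure \<nu> U * emeasure \<mu> V"
    by (simp only: SUP_mult_right_ennreal SUP_emeasure_inner_pts[OF sets(2) \<open>open V\<close>])
  then show ?thesis
    by (simp only: SUP_emeasure_inner_pts[OF sets(1) \<open>open U\<close>])
qed

text \<open>
  Christensen's theorem: two measures for which all balls of equal radius have equal mass are proportional.
\<close>

theorem uniform_measures_proportional:
  fixes \<mu> \<nu> :: "'a::{metric_space, second_countable_topology} measure" and X :: "'a set"
  assumes sets: "sets \<mu> = sets borel" "sets \<nu> = sets borel" and sf: "sigma_finite_measure \<mu>" "sigma_finite_measure \<nu>"
    and X: "AE x in \<mu>. x \<in> X" "AE x in \<nu>. x \<in> X"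
    and \<mu>: "\<And>x d. x \<in> X \<Longrightarrow> 0 < d \<Longrightarrow> emeasure \<mu> (ball x d) = a d" and \<nu>: "\<And>x d. x \<in> X \<Longrightarrow> 0 < d \<Longrightarrow> emeasure \<nu> (ball x d) = b d"
    and pos: "\<And>d. 0 < d \<Longrightarrow> 0 < a d \<and> a d < top \<and> 0 < b d \<and> b d < top"
    and "open U" "open V"
  shows "emeasure \<mu> U * emeasure \<nu> V = emeasure \<nu> U * emeasure \<mu> V"
proof (rule antisym)
  show "emeasure \<mu> U * emeasure \<nu> V \<le> emeasure \<nu> U * emeasure \<mu> V"
    using uniform_measures_cross[of \<mu> \<nu> X a b U V] assms by blast
  show "emeasure \<nu> U * emeasure \<mu> V \<le> emeasure \<mu> U * emeasure \<nu> V"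
    using uniform_measures_cross[of \<nu> \<mu> X b a U V] assms by blast
qed

lemma sigma_sets_open: "sets borel = sigma_sets UNIV {S :: 'a::topological_space set. open S}"
  unfolding borel_def by (rule sets_measure_of) simp

section \<open>Reflections\<close>

text \<open>The orthogonal reflection in the hyperplane perpendicular to \<open>d\<close>.\<close>

definition reflection :: "'a::real_inner \<Rightarrow> 'a \<Rightarrow> 'a" where
  "reflection d u = u - (2 * (u \<bullet> d) / (d \<bullet> d)) *\<^sub>R d"

lemma linear_reflection: "linear (reflection d)"
  by (rule linearI) (auto simp: reflection_def inner_add_left algebra_simps add_divide_distrib)

lemma reflection_reflection [simp]: "reflection d (reflection d u) = u"
proof (cases "d = 0")
  case False
  then have "(reflection d u) \<bullet> d = - (u \<bullet> d)"
    by (simp add: reflection_def inner_diff_left)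
  then show ?thesis by (simp add: reflection_def[of d "reflection d u"]) (simp add: reflection_def)
qed (simp add: reflection_def)

lemma norm_reflection [simp]: "norm (reflection d u) = norm u"
proof (cases "d = 0")
  case False
  have "reflection d u \<bullet> reflection d u = u \<bullet> u"
    using False by (simp add: reflection_def inner_diff_left inner_diff_right inner_commute field_simps)
  then show ?thesis by (simp add: norm_eq_sqrt_inner)
qed (simp add: reflection_def)

lemma dist_reflection [simp]: "dist (reflection d u) (reflection d v) = dist u v"
proof -
  have "dist (reflection d u) (reflection d v) = norm (reflection d (u - v))"
    by (simp only: dist_norm linear_diff[OF linear_reflection])
  then show ?thesis by (simp add: dist_norm)
qed

text \<open>Reflections act transitively on spheres; this replaces the full orthogonal group below.\<close>

lemma reflection_swap:
  assumes "norm x = norm y"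
  shows "reflection (x - y) x = y"
proof (cases "x = y")
  case False
  have xy: "x \<bullet> x = y \<bullet> y" using assms by (simp add: norm_eq_sqrt_inner)
  have eq: "2 * (x \<bullet> (x - y)) = (x - y) \<bullet> (x - y)"
    using xy by (simp add: inner_diff_left inner_diff_right inner_commute)
  have "(x - y) \<bullet> (x - y) \<noteq> 0" using False by simp
  then have r: "2 * (x \<bullet> (x - y)) / ((x - y) \<bullet> (x - y)) = 1" unfolding eq by (rule divide_self)
  show ?thesis unfolding reflection_def r by simp
qed (simp add: reflection_def)

lemma continuous_reflection: "continuous_on UNIV (reflection (d::'a::euclidean_space))"
  by (intro linear_continuous_on linear_reflection[THEN linear_conv_bounded_linear[THEN iffD1]])

lemma measurable_reflection [measurable]: "reflection (d::'a::euclidean_space) \<in> borel_measurable borel"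
  by (rule borel_measurable_continuous_onI[OF continuous_reflection])

lemma reflection_image_eq_vimage: "reflection d ` A = reflection d -` A"
proof safe
  fix u assume "reflection d u \<in> A"
  then have "reflection d (reflection d u) \<in> reflection d ` A" by (rule imageI)
  then show "u \<in> reflection d ` A" by simp
qed simp

lemma reflection_vimage_ball: "reflection d -` ball x e = ball (reflection d x) e"
proof -
  have "dist x (reflection d u) = dist (reflection d x) u" for u
    using dist_reflection[of d x "reflection d u"] by simp
  then show ?thesis by auto
qed

lemma norm_less_Suc: "\<exists>i::nat. norm x < 1 + real i"
proof -
  obtain i :: nat where "norm x \<le> real i" using real_arch_simple by blast
  then have "norm x < 1 + real i" by simp
  then show ?thesis ..
qed

text \<open>
  Balls have the same Lebesgue measure whatever their centre, and reflections permute balls of equal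
  radius. So Lebesgue measure and its image are uniformly distributed with the same masses of balls.
\<close>

lemma distr_lborel_reflection: "distr lborel borel (reflection (d::'a::euclidean_space)) = lborel"
proof -
  let ?N = "distr lborel borel (reflection d)"
  define a where "a e = emeasure lborel (ball (0::'a) e)" for e
  have b1: "emeasure lborel (ball x e) = a e" if "0 < e" for x :: 'a and e
    using that by (simp add: a_def emeasure_ball)
  have b2: "emeasure ?N (ball x e) = a e" if "0 < e" for x e
    using that by (simp add: emeasure_distr reflection_vimage_ball b1)
  have pos: "0 < a e \<and> a e < top" if "0 < e" for e
    using that by (simp add: a_def emeasure_ball)
  have sf: "sigma_finite_measure ?N"
  proof
    show "\<exists>A. countable A \<and> A \<subseteq> sets ?N \<and> \<Union>A = space ?N \<and> (\<forall>a\<in>A. emeasure ?N a \<noteq> \<infinity>)"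
    proof (intro exI[of _ "range (\<lambda>i::nat. ball 0 (real (Suc i)))"] conjI)
      show "\<Union>(range (\<lambda>i::nat. ball 0 (real (Suc i)))) = space ?N"
      proof -
        have "\<exists>i::nat. norm x < 1 + real i" for x :: 'a
          by (rule norm_less_Suc)
        then show ?thesis by auto
      qed
      show "\<forall>A\<in>range (\<lambda>i::nat. ball 0 (real (Suc i))). emeasure ?N A \<noteq> \<infinity>"
        using b2 pos by (auto simp: less_top simp del: of_nat_Suc)
    qed auto
  qed
  have eq: "emeasure ?N U = emeasure lborel U" if "open U" for U
  proof -
    have "emeasure ?N U * emeasure lborel (ball (0::'a) 1) = emeasure lborel U * emeasure ?N (ball 0 1)"
      using that pos by (intro uniform_measures_proportional[where X=UNIV and a=a and b=a] b1 b2 sf sigma_finite_lborel) auto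
    then have "a 1 * emeasure ?N U = a 1 * emeasure lborel U" using b1[of 1] b2[of 1] by (simp add: mult.commute)
    then show ?thesis using pos[of 1] by (metis ennreal_mult_cancel_left less_irrefl zero_less_one)
  qed
  show ?thesis
  proof (rule measure_eqI_generator_eq[where E="{S. open S}" and A="\<lambda>i::nat. ball 0 (real (Suc i))" and \<Omega>=UNIV])
    show "Int_stable {S::'a set. open S}" by (auto simp: Int_stable_def)
    show "(\<Union>i::nat. ball 0 (real (Suc i))) = (UNIV::'a set)"
    proof -
      have "\<exists>i::nat. norm x < 1 + real i" for x :: 'a
        by (rule norm_less_Suc)
      then show ?thesis by auto
    qed
    show "emeasure ?N (ball 0 (real (Suc i))) \<noteq> \<infinity>" for i :: nat
      using b2[of "real (Suc i)" 0] pos[of "real (Suc i)"] by (auto simp: less_top simp del: of_nat_Suc)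
  qed (auto simp: eq sigma_sets_open)
qed

section \<open>Surface measure and cone measure\<close>

text \<open>
  The Lebesgue measure of the part in the unit ball of the cone over a set; it charges the origin's direction \<open>0\<close> only with a null set.
\<close>

definition cone_measure :: "'a::euclidean_space measure" where
  "cone_measure = distr (density lborel (indicator (cball 0 1))) borel (\<lambda>y. y /\<^sub>R norm y)"

text \<open>Surface measure as a Borel measure on the whole space, carried by the sphere.\<close>

definition sphere_measure :: "'a::euclidean_space measure" where
  "sphere_measure = distr surface_measure borel (\<lambda>x. x)"

lemma measurable_direction [measurable]: "(\<lambda>y::'a::euclidean_space. y /\<^sub>R norm y) \<in> borel_measurable borel"
  by measurable

lemma sets_cone_measure [measurable_cong, simp]: "sets cone_measure = sets borel"
  and space_cone_measure [simp]: "space cone_measure = UNIV"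
  by (auto simp: cone_measure_def)

lemma sets_sphere_measure [measurable_cong, simp]: "sets sphere_measure = sets borel"
  and space_sphere_measure [simp]: "space sphere_measure = UNIV"
  by (auto simp: sphere_measure_def)

lemma measurable_indicator_cball [measurable]:
  "(indicator (cball (a::'a::euclidean_space) r) :: 'a \<Rightarrow> ennreal) \<in> borel_measurable borel"
  by (intro borel_measurable_indicator) simp

lemma cone_in_borel:
  assumes "A \<in> sets (borel :: 'a::euclidean_space measure)"
  shows "{y. norm y \<le> 1 \<and> y /\<^sub>R norm y \<in> A} \<in> sets borel"
proof -
  have eq: "cball 0 1 \<inter> (\<lambda>y. y /\<^sub>R norm y) -` A = {y. norm y \<le> 1 \<and> y /\<^sub>R norm y \<in> A}" by auto
  have "(\<lambda>y. y /\<^sub>R norm y) -` A \<in> sets (borel :: 'a measure)"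
    using measurable_sets[OF measurable_direction assms] by simp
  then show ?thesis unfolding eq[symmetric] by auto
qed

lemma emeasure_cone_measure:
  assumes [measurable]: "A \<in> sets (borel :: 'a::euclidean_space measure)"
  shows "emeasure cone_measure A = emeasure lborel {y. norm y \<le> 1 \<and> y /\<^sub>R norm y \<in> A}"
proof -
  have eq: "cball 0 1 \<inter> (\<lambda>y. y /\<^sub>R norm y) -` A = {y. norm y \<le> 1 \<and> y /\<^sub>R norm y \<in> A}" by auto
  have [measurable]: "(\<lambda>y. y /\<^sub>R norm y) -` A \<in> sets (borel :: 'a measure)"
    using measurable_sets[OF measurable_direction, of A] by simp
  have "emeasure cone_measure A = (\<integral>\<^sup>+y. indicator (cball 0 1) y * indicator ((\<lambda>y. y /\<^sub>R norm y) -` A) y \<partial>lborel)"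
    unfolding cone_measure_def by (subst emeasure_distr, measurable, subst emeasure_density) auto
  also have "\<dots> = (\<integral>\<^sup>+y. indicator (cball 0 1 \<inter> (\<lambda>y. y /\<^sub>R norm y) -` A) y \<partial>lborel)"
    by (intro nn_integral_cong) (auto simp: indicator_def)
  also have "\<dots> = emeasure lborel (cball 0 1 \<inter> (\<lambda>y. y /\<^sub>R norm y) -` A)"
    by (subst nn_integral_indicator) auto
  finally show ?thesis unfolding eq .
qed

lemma nn_integral_cone_measure:
  assumes [measurable]: "f \<in> borel_measurable borel"
  shows "(\<integral>\<^sup>+x. f x \<partial>cone_measure) = (\<integral>\<^sup>+y. f (y /\<^sub>R norm y) * indicator {y. norm y \<le> 1} y \<partial>lborel)"
proof -
  have "(\<integral>\<^sup>+x. f x \<partial>cone_measure) = (\<integral>\<^sup>+y. f (y /\<^sub>R norm y) \<partial>density lborel (indicator (cball 0 1)))"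
    unfolding cone_measure_def by (rule nn_integral_distr) measurable
  also have "\<dots> = (\<integral>\<^sup>+y. indicator (cball 0 1) y * f (y /\<^sub>R norm y) \<partial>lborel)"
    by (rule nn_integral_density) measurable
  also have "\<dots> = (\<integral>\<^sup>+y. f (y /\<^sub>R norm y) * indicator {y. norm y \<le> 1} y \<partial>lborel)"
    by (rule nn_integral_cong) (simp add: indicator_def)
  finally show ?thesis .
qed

lemma borel_in_sets_hausdorff: "A \<in> sets borel \<Longrightarrow> A \<in> sets (hausdorff_measure k :: 'a::metric_space measure)"
  by (rule subsetD[OF borel_subset_sets_hausdorff_measure])

lemma measurable_id_surface: "(\<lambda>x. x) \<in> surface_measure \<rightarrow>\<^sub>M (borel :: 'a::euclidean_space measure)"
proof (rule measurableI)
  fix A :: "'a set" assume "A \<in> sets borel"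
  then show "(\<lambda>x. x) -` A \<inter> space surface_measure \<in> sets surface_measure"
    by (auto simp: surface_measure_def space_restrict_space sets_restrict_space Int_commute intro!: imageI borel_in_sets_hausdorff)
qed simp

lemma space_surface_measure: "space (surface_measure :: 'a::euclidean_space measure) = sphere 0 1"
  by (simp add: surface_measure_def space_restrict_space)

lemma emeasure_sphere_measure:
  assumes "A \<in> sets (borel :: 'a::euclidean_space measure)"
  shows "emeasure sphere_measure A = hausdorff_outer (DIM('a) - 1) (A \<inter> sphere 0 1)"
proof -
  have "emeasure sphere_measure A = emeasure surface_measure (A \<inter> sphere 0 1)"
    unfolding sphere_measure_def using assms
    by (subst emeasure_distr[OF measurable_id_surface]) (auto simp: space_surface_measure)
  also have "\<dots> = hausdorff_outer (DIM('a) - 1) (A \<inter> sphere 0 1)"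
    using assms by (intro emeasure_surface_measure) auto
  finally show ?thesis .
qed

section \<open>Reflection invariance\<close>

text \<open>Reflecting every set of a covering preserves its diameters.\<close>

lemma hausdorff_outer_reflection_le:
  fixes A :: "'a::euclidean_space set"
  shows "hausdorff_outer k (reflection d ` A) \<le> hausdorff_outer k A"
  unfolding hausdorff_outer_def
proof (rule SUP_mono, rule bexI)
  fix \<delta> :: real assume "\<delta> \<in> {0<..}"
  then show "\<delta> \<in> {0<..}" .
  then have "\<delta> > 0" by simp
  have diam: "diameter (reflection d ` U) \<le> diameter U" if "bounded U" for U :: "'a set"
  proof (rule diameter_le)
    fix x y assume "x \<in> reflection d ` U" "y \<in> reflection d ` U"
    then obtain u v where "u \<in> U" "v \<in> U" "x = reflection d u" "y = reflection d v" by auto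
    then show "norm (x - y) \<le> diameter U"
      using diameter_bounded_bound[OF that, of u v] by (simp flip: dist_norm)
  qed (use that in \<open>auto simp: diameter_ge_0\<close>)
  have bd: "bounded (reflection d ` U)" if "bounded U" for U :: "'a set"
    using that by (auto simp: bounded_iff)
  have g: "hausdorff_gauge k (reflection d ` U) \<le> hausdorff_gauge k U" if "bounded U" for U :: "'a set"
    using diam[OF that] diameter_ge_0[OF bd[OF that]]
    by (auto simp: hausdorff_gauge_def intro!: ennreal_leI mult_left_mono power_mono divide_right_mono)
  show "hausdorff_pre k \<delta> (reflection d ` A) \<le> hausdorff_pre k \<delta> A"
    unfolding hausdorff_pre_def[of k \<delta> A]
  proof (rule INF_greatest)
    fix U :: "nat \<Rightarrow> 'a set" assume "U \<in> {U. A \<subseteq> \<Union> (range U) \<and> (\<forall>i. bounded (U i) \<and> diameter (U i) \<le> \<delta>)}"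
    then have U: "A \<subseteq> \<Union> (range U)" "\<And>i. bounded (U i)" "\<And>i. diameter (U i) \<le> \<delta>" by auto
    have "hausdorff_pre k \<delta> (reflection d ` A) \<le> (\<Sum>i. hausdorff_gauge k (reflection d ` U i))"
    proof (rule hausdorff_pre_le)
      show "reflection d ` A \<subseteq> (\<Union>i. reflection d ` U i)" using U(1) by blast
    qed (intro bd U(2) order_trans[OF diam U(3)])+
    also have "\<dots> \<le> (\<Sum>i. hausdorff_gauge k (U i))"
      by (intro suminf_le g U) auto
    finally show "hausdorff_pre k \<delta> (reflection d ` A) \<le> (\<Sum>i. hausdorff_gauge k (U i))" .
  qed
qed

lemma hausdorff_outer_reflection:
  fixes A :: "'a::euclidean_space set"
  shows "hausdorff_outer k (reflection d ` A) = hausdorff_outer k A"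
proof (rule antisym[OF hausdorff_outer_reflection_le])
  have "reflection d ` reflection d ` A = A" by (auto simp: image_image)
  then show "hausdorff_outer k A \<le> hausdorff_outer k (reflection d ` A)"
    using hausdorff_outer_reflection_le[of k d "reflection d ` A"] by simp
qed

lemma sphere_measure_ball_eq:
  fixes x y :: "'a::euclidean_space"
  assumes "norm x = 1" "norm y = 1"
  shows "emeasure sphere_measure (ball x e) = emeasure sphere_measure (ball y e)"
proof -
  let ?R = "reflection (x - y)"
  have xy: "?R x = y" using assms by (intro reflection_swap) simp
  have yx: "?R y = x" using xy reflection_reflection[of "x - y" x] by simp
  have "?R ` (ball x e \<inter> sphere 0 1) = ball y e \<inter> sphere 0 1"
    unfolding reflection_image_eq_vimage vimage_Int reflection_vimage_ball xy
    by (auto simp: dist_norm)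
  then show ?thesis
    using hausdorff_outer_reflection[of "DIM('a) - 1" "x - y" "ball x e \<inter> sphere 0 1"]
    by (simp add: emeasure_sphere_measure)
qed

lemma cone_measure_ball_eq:
  fixes x y :: "'a::euclidean_space"
  assumes "norm x = 1" "norm y = 1"
  shows "emeasure cone_measure (ball x e) = emeasure cone_measure (ball y e)"
proof -
  let ?R = "reflection (x - y)"
  let ?C = "\<lambda>x. {u. norm u \<le> 1 \<and> u /\<^sub>R norm u \<in> ball x e}"
  have xy: "?R x = y" using assms by (intro reflection_swap) simp
  have "?R -` ?C x = ?C y"
  proof -
    have "?R u /\<^sub>R norm u = ?R (u /\<^sub>R norm u)" for u :: 'a
      by (simp add: linear_scale[OF linear_reflection])
    moreover have "?R v \<in> ball x e \<longleftrightarrow> v \<in> ball y e" for v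
      using reflection_vimage_ball[of "x - y" x e] xy by (auto simp: set_eq_iff)
    ultimately show ?thesis by auto
  qed
  moreover have "?C x \<in> sets borel" by (rule cone_in_borel) simp
  ultimately show ?thesis
    using emeasure_distr[of ?R lborel borel "?C x"]
    by (simp add: emeasure_cone_measure distr_lborel_reflection)
qed

section \<open>Size of spherical caps\<close>

lemma cone_measure_finite: "emeasure cone_measure A < top"
proof -
  have "emeasure cone_measure A \<le> emeasure cone_measure (UNIV::'a set)" 
    by (rule emeasure_mono) auto
  also have "\<dots> \<le> emeasure lborel (cball (0::'a) 1)"
    by (subst emeasure_cone_measure) (auto intro!: emeasure_mono)
  also have "\<dots> < top" using emeasure_lborel_cball_finite[of "0::'a" 1] by simp
  finally show ?thesis .
qed

text \<open>
  The cone contains a small ball around \<open>x/2\<close>, since \<open>y \<mapsto> y/|y|\<close> is Lipschitz there.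
\<close>

lemma cone_measure_ball_pos:
  fixes x :: "'a::euclidean_space"
  assumes "norm x = 1" "0 < e"
  shows "0 < emeasure cone_measure (ball x e)"
proof -
  define c where "c = min (1/2) (e / 4)"
  have c: "0 < c" "c \<le> 1 / 2" "4 * c \<le> e" using assms by (auto simp: c_def)
  have "ball (x /\<^sub>R 2) (c / 2) \<subseteq> {y. norm y \<le> 1 \<and> y /\<^sub>R norm y \<in> ball x e}"
  proof
    fix y assume "y \<in> ball (x /\<^sub>R 2) (c / 2)"
    then have y: "norm (x /\<^sub>R 2 - y) < c / 2" by (simp add: dist_norm)
    have nx: "norm (x /\<^sub>R 2) = 1 / 2" using assms by simp
    have "\<bar>norm y - 1 / 2\<bar> < c / 2"
      using y norm_triangle_ineq3[of "x /\<^sub>R 2" y] nx by linarith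
    then have ny: "\<bar>norm y - 1 / 2\<bar> < c / 2" "norm y \<ge> 1 / 4" "norm y \<le> 1" using c by (auto simp: abs_if split: if_splits)
    have e1: "(norm y - 1 / 2) *\<^sub>R x + (x /\<^sub>R 2 - y) = norm y *\<^sub>R x - y"
      by (simp add: scaleR_diff_left inverse_eq_divide)
    have e2: "x - y /\<^sub>R norm y = (1 / norm y) *\<^sub>R (norm y *\<^sub>R x - y)"
      using ny by (auto simp: scaleR_diff_right inverse_eq_divide)
    have "norm (x - y /\<^sub>R norm y) = (1 / norm y) * norm ((norm y - 1 / 2) *\<^sub>R x + (x /\<^sub>R 2 - y))"
      by (simp only: e1 e2 norm_scaleR abs_divide abs_one abs_norm_cancel)
    also have "\<dots> \<le> (1 / norm y) * (\<bar>norm y - 1 / 2\<bar> * norm x + norm (x /\<^sub>R 2 - y))"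
      by (intro mult_left_mono order_trans[OF norm_triangle_ineq]) auto
    also have "\<dots> < (1 / norm y) * c"
      using ny y assms by (intro mult_strict_left_mono) auto
    also have "\<dots> \<le> 4 * c" using ny c by (simp add: divide_simps)
    finally show "y \<in> {y. norm y \<le> 1 \<and> y /\<^sub>R norm y \<in> ball x e}" using c ny by (simp add: dist_norm)
  qed
  then have "emeasure lborel (ball (x /\<^sub>R 2) (c / 2)) \<le> emeasure cone_measure (ball x e)"
    by (subst emeasure_cone_measure, simp, intro emeasure_mono) auto
  moreover have "0 < emeasure lborel (ball (x /\<^sub>R 2) (c / 2))"
    using c by (simp add: emeasure_ball)
  ultimately show ?thesis by (rule order_less_le_trans[rotated])
qed

text \<open>
  The cone over a cap of radius \<open>d\<close> lies within distance \<open>d\<close> of the segment from \<open>0\<close> to \<open>x\<close>, so about \<open>1/d\<close> balls of radius \<open>2 d\<close> cover it.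
\<close>

lemma cone_measure_cball_le:
  fixes x :: "'a::euclidean_space"
  assumes "norm x = 1" "0 < d" "d \<le> 1"
  shows "emeasure cone_measure (cball x d) \<le> ennreal (3 * 2 ^ DIM('a) * unit_ball_vol (DIM('a)) * d ^ (DIM('a) - 1))"
proof -
  define N where "N = nat \<lceil>1 / d\<rceil>"
  have N: "1 / d \<le> real N" "real N \<le> 1 / d + 1" "0 < N"
    using assms by (auto simp: N_def) (linarith+)?
  have sub: "{y. norm y \<le> 1 \<and> y /\<^sub>R norm y \<in> cball x d} \<subseteq> (\<Union>j\<in>{..N}. cball ((real j / real N) *\<^sub>R x) (2 * d))"
  proof safe
    fix y assume y: "norm y \<le> 1" "y /\<^sub>R norm y \<in> cball x d"
    \<comment> \<open>The grid point of the segment next to \<open>|y| x\<close>, to which \<open>y\<close> is close.\<close>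
    define j where "j = nat \<lfloor>norm y * real N\<rfloor>"
    have "norm y * real N \<le> real N" using y by (simp add: mult_left_le_one_le)
    then have j: "real j \<le> norm y * real N" "norm y * real N \<le> real j + 1" "j \<le> N"
      by (auto simp: j_def nat_le_iff floor_le_iff)
    have "\<bar>norm y - real j / real N\<bar> \<le> 1 / real N"
    proof -
      have "real j / real N \<le> norm y" using j N by (simp add: divide_le_eq mult.commute)
      moreover have "norm y \<le> (real j + 1) / real N" using j N by (simp add: le_divide_eq mult.commute)
      then have "norm y \<le> real j / real N + 1 / real N" by (simp add: add_divide_distrib)
      ultimately show ?thesis by linarith
    qed
    also have "\<dots> \<le> d" using N assms by (simp add: field_simps)
    finally have 1: "\<bar>norm y - real j / real N\<bar> \<le> d" .
    have 2: "norm (y - norm y *\<^sub>R x) \<le> d"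
    proof (cases "y = 0")
      case False
      have "y - norm y *\<^sub>R x = norm y *\<^sub>R (y /\<^sub>R norm y - x)" using False by (simp add: algebra_simps)
      then have "norm (y - norm y *\<^sub>R x) = norm y * norm (y /\<^sub>R norm y - x)" by simp
      also have "\<dots> \<le> 1 * d" using y by (intro mult_mono) (auto simp: dist_norm norm_minus_commute)
      finally show ?thesis by simp
    qed (use assms in simp)
    have "(real j / real N) *\<^sub>R x - y = - ((norm y - real j / real N) *\<^sub>R x) - (y - norm y *\<^sub>R x)"
      by (simp add: algebra_simps)
    then have "norm ((real j / real N) *\<^sub>R x - y) \<le> norm ((norm y - real j / real N) *\<^sub>R x) + norm (y - norm y *\<^sub>R x)"
      by (metis norm_minus_cancel norm_triangle_ineq4)
    also have "\<dots> \<le> d + d" using 1 2 assms by (intro add_mono) auto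
    finally show "y \<in> (\<Union>j\<in>{..N}. cball ((real j / real N) *\<^sub>R x) (2 * d))"
      using j by (auto simp: dist_norm intro!: bexI[of _ j])
  qed
  have "emeasure cone_measure (cball x d) \<le> emeasure lborel (\<Union>j\<in>{..N}. cball ((real j / real N) *\<^sub>R x) (2 * d))"
    using sub by (subst emeasure_cone_measure) (auto intro!: emeasure_mono)
  also have "\<dots> \<le> (\<Sum>j\<in>{..N}. emeasure lborel (cball ((real j / real N) *\<^sub>R x) (2 * d)))"
    by (rule emeasure_subadditive_finite) auto
  also have "\<dots> = ennreal (real (N + 1) * (unit_ball_vol (DIM('a)) * (2 * d) ^ DIM('a)))"
    using assms by (simp add: emeasure_cball ennreal_mult ennreal_of_nat_eq_real_of_nat)
  also have "\<dots> \<le> ennreal (3 / d * (unit_ball_vol (DIM('a)) * (2 * d) ^ DIM('a)))"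
  proof (intro ennreal_leI mult_right_mono)
    show "real (N + 1) \<le> 3 / d" using N assms by (simp add: field_simps)
  qed (use assms in auto)
  also have "3 / d * (unit_ball_vol (DIM('a)) * (2 * d) ^ DIM('a)) = 3 * 2 ^ DIM('a) * unit_ball_vol (DIM('a)) * d ^ (DIM('a) - 1)"
  proof -
    obtain m where m: "DIM('a) = Suc m" using DIM_positive[where 'a='a] gr0_implies_Suc by blast
    have "3 / d * (v * (2 * d) ^ Suc m) = 3 * 2 ^ Suc m * v * d ^ (Suc m - 1)" for v :: real
      using assms(2) by (simp add: power_mult_distrib)
    then show ?thesis unfolding m .
  qed
  finally show ?thesis .
qed

text \<open>
  Every covering set that meets the sphere lies in a cap whose radius is its diameter, and caps have cone
  measure at most a multiple of the \<open>(n-1)\<close>-st power of the radius. Together with \<open>cone_measure_ball_pos\<close> this shows that surface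
  measure does not vanish on caps.
\<close>

lemma cone_measure_le_hausdorff:
  assumes n: "2 \<le> DIM('a::euclidean_space)" and A: "A \<in> sets (borel :: 'a measure)" "A \<subseteq> sphere 0 1"
  shows "emeasure cone_measure A \<le> ennreal (3 * 2 ^ DIM('a) * unit_ball_vol (DIM('a)) / (unit_ball_vol (real (DIM('a) - 1)) / 2 ^ (DIM('a) - 1)))
     * hausdorff_outer (DIM('a) - 1) A"
proof -
  define k where "k = DIM('a) - 1"
  have k: "k \<ge> 1" using n by (simp add: k_def)
  define c where "c = 3 * 2 ^ DIM('a) * unit_ball_vol (DIM('a))"
  define b where "b = unit_ball_vol (real k) / 2 ^ k"
  have c: "c > 0" and b: "b > 0" by (auto simp: c_def b_def)
  have ball: "emeasure cone_measure (cball x d) \<le> ennreal (c * d ^ k)" if "norm x = 1" "0 \<le> d" "d \<le> 1" for x :: 'a and d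
  proof (cases "d = 0")
    case False
    then show ?thesis using cone_measure_cball_le[of x d] that by (simp add: c_def k_def)
  next
    case True
    have le: "emeasure cone_measure (cball x 0) \<le> ennreal e" if "e > 0" for e
    proof -
      \<comment> \<open>A point has cone measure \<open>0\<close>, by the estimate for small caps and \<open>k \<ge> 1\<close>.\<close>
      define e' where "e' = min 1 (e / c)"
      have e': "0 < e'" "e' \<le> 1" "c * e' \<le> e" using that c by (auto simp: e'_def min_def field_simps)
      have "emeasure cone_measure (cball x 0) \<le> emeasure cone_measure (cball x e')"
        using e' by (intro emeasure_mono) auto
      also have "\<dots> \<le> ennreal (c * e' ^ k)" using cone_measure_cball_le[of x e'] \<open>norm x = 1\<close> e' by (simp add: c_def k_def)
      also have "c * e' ^ k \<le> c * e' ^ 1" using c e' k by (intro mult_left_mono power_decreasing) auto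
      also have "\<dots> \<le> e" using e' by simp
      finally show ?thesis by (simp add: ennreal_leI)
    qed
    have "emeasure cone_measure (cball x 0) \<le> 0" by (rule ennreal_le_epsilon) (use le in simp)
    then show ?thesis using True by simp
  qed
  have "ennreal (b / c) * emeasure cone_measure A \<le> hausdorff_pre k 1 A"
    unfolding hausdorff_pre_def
  proof (rule INF_greatest)
    fix U :: "nat \<Rightarrow> 'a set" assume "U \<in> {U. A \<subseteq> \<Union> (range U) \<and> (\<forall>i. bounded (U i) \<and> diameter (U i) \<le> 1)}"
    then have U: "A \<subseteq> \<Union> (range U)" "\<And>i. bounded (U i)" "\<And>i. diameter (U i) \<le> 1" by auto
    define x where "x i = (SOME x. x \<in> U i \<inter> sphere 0 1)" for i
    have x: "x i \<in> U i \<inter> sphere 0 1" if "U i \<inter> sphere 0 1 \<noteq> {}" for i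
    proof -
      from that have "\<exists>x. x \<in> U i \<inter> sphere 0 1" by blast
      then show ?thesis unfolding x_def by (rule someI_ex)
    qed
    define V where "V i = (if U i \<inter> sphere 0 1 = {} then {} else cball (x i) (diameter (U i)))" for i
    have "A \<subseteq> (\<Union>i. V i)"
    proof
      fix y assume y: "y \<in> A"
      then obtain i where i: "y \<in> U i" using U(1) by auto
      then have ne: "U i \<inter> sphere 0 1 \<noteq> {}" using y A(2) by auto
      then have "y \<in> V i" using x[OF ne] diameter_bounded_bound[OF U(2), of "x i" i y] i by (simp add: V_def)
      then show "y \<in> (\<Union>i. V i)" by auto
    qed
    then have "emeasure cone_measure A \<le> emeasure cone_measure (\<Union>i. V i)"
      by (intro emeasure_mono) (auto simp: V_def)
    also have "\<dots> \<le> (\<Sum>i. emeasure cone_measure (V i))"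
      by (intro emeasure_subadditive_countably) (auto simp: V_def)
    finally have "ennreal (b / c) * emeasure cone_measure A \<le> (\<Sum>i. ennreal (b / c) * emeasure cone_measure (V i))"
      by (simp add: mult_left_mono)
    also have "\<dots> \<le> (\<Sum>i. hausdorff_gauge k (U i))"
    proof (intro suminf_le)
      fix i
      show "ennreal (b / c) * emeasure cone_measure (V i) \<le> hausdorff_gauge k (U i)"
      proof (cases "U i \<inter> sphere 0 1 = {}")
        case False
        then have "emeasure cone_measure (V i) \<le> ennreal (c * diameter (U i) ^ k)"
          using x[OF False] U diameter_ge_0[OF U(2)] by (auto simp: V_def intro!: ball)
        then have "ennreal (b / c) * emeasure cone_measure (V i) \<le> ennreal (b / c) * ennreal (c * diameter (U i) ^ k)"
          by (rule mult_left_mono) simp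
        also have "\<dots> = ennreal (b * diameter (U i) ^ k)"
          using b c diameter_ge_0[OF U(2), of i] by (simp flip: ennreal_mult)
        also have "\<dots> = hausdorff_gauge k (U i)"
          using False by (auto simp: hausdorff_gauge_def b_def power_divide)
        finally show ?thesis .
      qed (simp add: V_def)
    qed auto
    finally show "ennreal (b / c) * emeasure cone_measure A \<le> (\<Sum>i. hausdorff_gauge k (U i))" .
  qed
  also have "\<dots> \<le> hausdorff_outer k A"
    unfolding hausdorff_outer_def by (intro SUP_upper) auto
  finally have "ennreal (c / b) * (ennreal (b / c) * emeasure cone_measure A) \<le> ennreal (c / b) * hausdorff_outer k A"
    by (rule mult_left_mono) simp
  moreover have "ennreal (c / b) * (ennreal (b / c) * emeasure cone_measure A) = emeasure cone_measure A"
    using b c by (simp add: mult.assoc[symmetric] flip: ennreal_mult)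
  ultimately show ?thesis by (simp add: c_def b_def k_def)
qed

text \<open>
  A packing argument: the balls of radius \<open>\<delta>/2\<close> around the points are disjoint and lie in a shell of width \<open>\<delta>\<close>, whose volume is of order \<open>\<delta>\<close>.
\<close>

lemma sphere_separated_card:
  fixes P :: "'a::euclidean_space set"
  assumes P: "finite P" "P \<subseteq> sphere 0 1" "\<And>x y. x \<in> P \<Longrightarrow> y \<in> P \<Longrightarrow> x \<noteq> y \<Longrightarrow> \<delta> < dist x y"
    and \<delta>: "0 < \<delta>" "\<delta> \<le> 1"
  shows "real (card P) \<le> 2 * real DIM('a) * 4 ^ DIM('a) / \<delta> ^ (DIM('a) - 1)"
proof -
  define h where "h = \<delta> / 2"
  have h: "0 < h" "h \<le> 1 / 2" using \<delta> by (auto simp: h_def)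
  define v where "v = unit_ball_vol (real DIM('a))"
  have v: "v > 0" by (simp add: v_def)
  obtain m where m: "DIM('a) = Suc m" using DIM_positive[where 'a='a] gr0_implies_Suc by blast
  have "emeasure lborel (\<Union>x\<in>P. ball x h) \<le> emeasure lborel (cball 0 (1 + h) - ball (0::'a) (1 - h))"
  proof (rule emeasure_mono)
    show "(\<Union>x\<in>P. ball x h) \<subseteq> cball 0 (1 + h) - ball 0 (1 - h)"
    proof
      fix y assume "y \<in> (\<Union>x\<in>P. ball x h)"
      then obtain x where x: "x \<in> P" "dist x y < h" by auto
      then have "norm x = 1" using P(2) by auto
      then show "y \<in> cball 0 (1 + h) - ball 0 (1 - h)"
        using x(2) norm_triangle_ineq3[of x y] by (auto simp: dist_norm)
    qed
  qed auto
  also have "\<dots> = ennreal (v * (1 + h) ^ DIM('a)) - ennreal (v * (1 - h) ^ DIM('a))"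
    using h by (subst emeasure_Diff) (auto simp: emeasure_cball emeasure_ball v_def)
  also have "\<dots> = ennreal (v * ((1 + h) ^ DIM('a) - (1 - h) ^ DIM('a)))"
    using h v by (subst ennreal_minus) (auto simp: algebra_simps)
  also have "emeasure lborel (\<Union>x\<in>P. ball x h) = (\<Sum>x\<in>P. emeasure lborel (ball x h))"
  proof (rule sum_emeasure[symmetric])
    show "disjoint_family_on (\<lambda>x. ball x h) P"
      unfolding disjoint_family_on_def
    proof (intro ballI impI)
      fix x y assume xy: "x \<in> P" "y \<in> P" "x \<noteq> y"
      show "ball x h \<inter> ball y h = {}"
      proof (rule ccontr)
        assume "ball x h \<inter> ball y h \<noteq> {}"
        then obtain z where "dist x z < h" "dist y z < h" by auto
        then have "dist x y < 2 * h" using dist_triangle2[of x y z] by simp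
        then show False using P(3)[OF xy] by (simp add: h_def)
      qed
    qed
  qed (use P in auto)
  also have "(\<Sum>x\<in>P. emeasure lborel (ball x h)) = ennreal (real (card P) * (v * h ^ DIM('a)))"
    using h v by (simp add: emeasure_ball v_def ennreal_mult ennreal_of_nat_eq_real_of_nat)
  finally have "real (card P) * (v * h ^ DIM('a)) \<le> v * ((1 + h) ^ DIM('a) - (1 - h) ^ DIM('a))"
    using h v by (subst (asm) ennreal_le_iff) (auto intro!: mult_nonneg_nonneg power_mono)
  then have "v * (real (card P) * h ^ DIM('a)) \<le> v * ((1 + h) ^ DIM('a) - (1 - h) ^ DIM('a))"
    by (simp add: mult_ac)
  then have "real (card P) * h ^ DIM('a) \<le> (1 + h) ^ DIM('a) - (1 - h) ^ DIM('a)" using v by simp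
  also have "(1 + h) ^ DIM('a) - (1 - h) ^ DIM('a) \<le> 2 * h * real DIM('a) * 2 ^ m"
  proof -
    have "(1 + h) ^ Suc j - (1 - h) ^ Suc j \<le> 2 * h * real (Suc j) * 2 ^ j" for j
    proof (induction j)
      case (Suc j)
      have p2: "(1 + h) ^ Suc j \<le> 2 ^ Suc j" using h by (intro power_mono) auto
      have "(1 + h) ^ Suc (Suc j) - (1 - h) ^ Suc (Suc j) = (1 - h) * ((1 + h) ^ Suc j - (1 - h) ^ Suc j) + 2 * h * (1 + h) ^ Suc j"
        by (simp add: algebra_simps)
      also have "\<dots> \<le> 1 * (2 * h * real (Suc j) * 2 ^ j) + 2 * h * 2 ^ Suc j"
      proof (rule add_mono)
        have "(1 - h) ^ Suc j \<le> (1 + h) ^ Suc j" using h by (intro power_mono) auto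
        then show "(1 - h) * ((1 + h) ^ Suc j - (1 - h) ^ Suc j) \<le> 1 * (2 * h * real (Suc j) * 2 ^ j)"
          using h by (intro mult_mono Suc) auto
        show "2 * h * (1 + h) ^ Suc j \<le> 2 * h * 2 ^ Suc j" using h p2 by (intro mult_left_mono) auto
      qed
      also have "\<dots> \<le> 2 * h * real (Suc (Suc j)) * 2 ^ Suc j" using h by (simp add: algebra_simps)
      finally show ?case .
    qed simp
    then show ?thesis unfolding m .
  qed
  finally have "h * (real (card P) * h ^ m) \<le> h * (2 * real DIM('a) * 2 ^ m)" by (simp add: m mult_ac)
  then have "real (card P) * h ^ m \<le> 2 * real DIM('a) * 2 ^ m" using h by simp
  then have "real (card P) * \<delta> ^ m \<le> 2 * real DIM('a) * (2 ^ m * 2 ^ m)" by (simp add: h_def power_divide field_simps)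
  also have "(2::real) ^ m * 2 ^ m = 4 ^ m" by (simp flip: power_mult_distrib)
  also have "2 * real DIM('a) * (4 ^ m) \<le> 2 * real DIM('a) * 4 ^ DIM('a)" by (simp add: m)
  finally show ?thesis using \<delta> by (simp add: m field_simps)
qed

text \<open>
  A maximal \<open>\<delta>\<close>-separated set is a \<open>\<delta>\<close>-net, and \<open>sphere_separated_card\<close> bounds its size by a multiple of \<open>\<delta>^(1-n)\<close>.
\<close>

lemma hausdorff_outer_sphere_finite: "hausdorff_outer (DIM('a) - 1) (sphere (0::'a::euclidean_space) 1) < top"
proof -
  define k where "k = DIM('a) - 1"
  define B where "B = 2 * real DIM('a) * 4 ^ DIM('a)"
  have "hausdorff_pre k e (sphere (0::'a) 1) \<le> ennreal (unit_ball_vol (real k) * B)" if "e > 0" for e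
  proof -
    define \<delta> where "\<delta> = min 1 (e / 2)"
    have \<delta>: "0 < \<delta>" "\<delta> \<le> 1" "2 * \<delta> \<le> e" using that by (auto simp: \<delta>_def)
    define Q where "Q P \<longleftrightarrow> finite P \<and> P \<subseteq> sphere (0::'a) 1 \<and> (\<forall>x\<in>P. \<forall>y\<in>P. x \<noteq> y \<longrightarrow> \<delta> < dist x y)" for P
    have card: "real (card P) \<le> B / \<delta> ^ k" if "Q P" for P
      using sphere_separated_card[of P \<delta>] that \<delta> by (auto simp: Q_def B_def k_def)
    have "Q {}" by (simp add: Q_def)
    moreover have "\<forall>P. Q P \<longrightarrow> card P \<le> nat \<lceil>B / \<delta> ^ k\<rceil>"
    proof (intro allI impI)
      fix P assume "Q P"
      from order_trans[OF card[OF this] real_nat_ceiling_ge] show "card P \<le> nat \<lceil>B / \<delta> ^ k\<rceil>"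
        by (simp only: of_nat_le_iff)
    qed
    ultimately have "\<exists>P. Q P \<and> (\<forall>P'. Q P' \<longrightarrow> card P' \<le> card P)"
      using ex_has_greatest_nat[of Q "{}" card "Suc (nat \<lceil>B / \<delta> ^ k\<rceil>)"] by (auto simp: less_Suc_eq_le)
    then obtain P where P: "Q P" "\<And>P'. Q P' \<Longrightarrow> card P' \<le> card P" by blast
    have cov: "sphere 0 1 \<subseteq> (\<Union>x\<in>P. cball x \<delta>)"
    proof
      fix z :: 'a assume z: "z \<in> sphere 0 1"
      show "z \<in> (\<Union>x\<in>P. cball x \<delta>)"
      proof (rule ccontr)
        assume "z \<notin> (\<Union>x\<in>P. cball x \<delta>)"
        then have far: "\<delta> < dist x z" if "x \<in> P" for x using that by auto
        have "z \<notin> P" using far[of z] \<delta> by auto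
        moreover have "Q (insert z P)" using P(1) z far by (auto simp: Q_def dist_commute)
        ultimately show False using P(2)[of "insert z P"] P(1) by (simp add: Q_def)
      qed
    qed
    have "finite P" using P(1) by (simp add: Q_def)
    from finite_distinct_list[OF this] obtain xs where xs: "set xs = P" "distinct xs" by blast
    define U where "U i = (if i < length xs then cball (xs ! i) \<delta> else {})" for i
    have "hausdorff_pre k e (sphere (0::'a) 1) \<le> (\<Sum>i. hausdorff_gauge k (U i))"
    proof (rule hausdorff_pre_le)
      show "sphere 0 1 \<subseteq> \<Union> (range U)"
      proof
        fix z :: 'a assume "z \<in> sphere 0 1"
        then obtain x where "x \<in> set xs" "z \<in> cball x \<delta>" using cov xs by blast
        then obtain i where "i < length xs" "z \<in> cball (xs ! i) \<delta>" by (auto simp: in_set_conv_nth)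
        then have "z \<in> U i" by (simp add: U_def)
        then show "z \<in> \<Union> (range U)" by blast
      qed
    qed (use \<delta> in \<open>auto simp: U_def\<close>)
    also have "\<dots> = (\<Sum>i<length xs. hausdorff_gauge k (U i))"
      by (rule suminf_finite) (auto simp: U_def hausdorff_gauge_def)
    also have "\<dots> = (\<Sum>i<length xs. ennreal (unit_ball_vol (real k) * \<delta> ^ k))"
      using \<delta> by (intro sum.cong) (auto simp: U_def hausdorff_gauge_def)
    also have "\<dots> = ennreal (real (card P) * (unit_ball_vol (real k) * \<delta> ^ k))"
      using \<delta> xs distinct_card[of xs] by (simp add: ennreal_mult ennreal_of_nat_eq_real_of_nat)
    also have "\<dots> \<le> ennreal (B / \<delta> ^ k * (unit_ball_vol (real k) * \<delta> ^ k))"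
      using card[OF P(1)] \<delta> by (intro ennreal_leI mult_right_mono) auto
    finally show ?thesis using \<delta> by (simp add: mult.commute)
  qed
  then have "hausdorff_outer k (sphere (0::'a) 1) \<le> ennreal (unit_ball_vol (real k) * B)"
    unfolding hausdorff_outer_def by (intro SUP_least) auto
  then show ?thesis unfolding k_def using ennreal_less_top le_less_trans by blast
qed

section \<open>Proportionality of surface measure and cone measure\<close>

lemma sphere_measure_finite: "emeasure sphere_measure (A::'a::euclidean_space set) < top"
proof -
  have "emeasure sphere_measure A \<le> emeasure sphere_measure (UNIV::'a set)" 
    by (rule emeasure_mono) auto
  also have "\<dots> = hausdorff_outer (DIM('a) - 1) (sphere (0::'a) 1)"
    by (subst emeasure_sphere_measure) auto
  also have "\<dots> < top" by (rule hausdorff_outer_sphere_finite)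
  finally show ?thesis .
qed

lemma finite_sphere_measure: "finite_measure (sphere_measure :: 'a::euclidean_space measure)"
  by (rule finite_measureI) (use sphere_measure_finite in \<open>simp add: less_top\<close>)

lemma finite_cone_measure: "finite_measure (cone_measure :: 'a::euclidean_space measure)"
  by (rule finite_measureI) (use cone_measure_finite in \<open>simp add: less_top\<close>)

lemma AE_cone_measure_sphere: "AE x in (cone_measure :: 'a::euclidean_space measure). x \<in> sphere 0 1"
proof (rule AE_I)
  have "{y::'a. norm y \<le> 1 \<and> y /\<^sub>R norm y \<in> - sphere 0 1} = {0}"
    by auto (metis left_inverse norm_eq_zero)
  then show "emeasure cone_measure (- sphere 0 1 :: 'a set) = 0"
    by (subst emeasure_cone_measure) auto
qed auto

lemma AE_sphere_measure_sphere: "AE x in (sphere_measure :: 'a::euclidean_space measure). x \<in> sphere 0 1"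
proof (rule AE_I)
  show "emeasure sphere_measure (- sphere 0 1 :: 'a set) = 0"
    by (subst emeasure_sphere_measure) (auto simp: hausdorff_outer_empty)
qed auto

text \<open>
  Reflections show that both measures are uniformly distributed on the sphere; the previous estimates show that the masses of balls are positive and finite.
\<close>

theorem sphere_measure_eq_scale_cone_measure:
  assumes n: "2 \<le> DIM('a::euclidean_space)"
  obtains c :: real where "0 < c" "(sphere_measure :: 'a measure) = scale_measure (ennreal c) cone_measure"
proof -
  let ?m = "sphere_measure :: 'a measure" and ?k = "cone_measure :: 'a measure"
  interpret M: finite_measure ?m by (rule finite_sphere_measure)
  interpret K: finite_measure ?k by (rule finite_cone_measure)
  obtain e :: 'a where "e \<in> Basis" using nonempty_Basis by blast
  then have e: "norm e = 1" by simp
  have pos: "0 < emeasure ?m (ball e d)" if "0 < d" for d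
  proof -
    have "0 < emeasure ?k (ball e d)" using e that by (rule cone_measure_ball_pos)
    also have "emeasure ?k (ball e d) = emeasure ?k (ball e d \<inter> sphere 0 1)"
      using AE_cone_measure_sphere[where 'a='a] by (intro emeasure_eq_AE) (auto elim!: eventually_mono)
    also have "\<dots> \<le> ennreal (3 * 2 ^ DIM('a) * unit_ball_vol (DIM('a)) / (unit_ball_vol (real (DIM('a) - 1)) / 2 ^ (DIM('a) - 1)))
       * hausdorff_outer (DIM('a) - 1) (ball e d \<inter> sphere 0 1)"
      by (rule cone_measure_le_hausdorff[OF n]) auto
    finally have "hausdorff_outer (DIM('a) - 1) (ball e d \<inter> sphere 0 1) \<noteq> 0" by auto
    then show ?thesis by (simp add: emeasure_sphere_measure zero_less_iff_neq_zero)
  qed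
  have cross: "emeasure ?m U * emeasure ?k V = emeasure ?k U * emeasure ?m V" if UV: "open U" "open V" for U V
  proof (rule uniform_measures_proportional[where X="sphere 0 1" and a="\<lambda>d. emeasure ?m (ball e d)" and b="\<lambda>d. emeasure ?k (ball e d)"])
    show "emeasure ?m (ball x d) = emeasure ?m (ball e d)" if "x \<in> sphere 0 1" for x d
      using that e by (intro sphere_measure_ball_eq) auto
    show "emeasure ?k (ball x d) = emeasure ?k (ball e d)" if "x \<in> sphere 0 1" for x d
      using that e by (intro cone_measure_ball_eq) auto
    show "0 < emeasure ?m (ball e d) \<and> emeasure ?m (ball e d) < top \<and> 0 < emeasure ?k (ball e d) \<and> emeasure ?k (ball e d) < top" if "0 < d" for d
      using pos[OF that] cone_measure_ball_pos[OF e that] sphere_measure_finite cone_measure_finite by blast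
  qed (use UV AE_cone_measure_sphere AE_sphere_measure_sphere in \<open>auto intro: M.sigma_finite_measure_axioms K.sigma_finite_measure_axioms\<close>)
  define a where "a = measure ?m UNIV"
  define b where "b = measure ?k UNIV"
  have "0 < emeasure ?m (ball e 1)" by (rule pos) simp
  also have "\<dots> \<le> emeasure ?m UNIV" by (rule emeasure_mono) auto
  finally have a: "0 < a" by (simp add: a_def M.emeasure_eq_measure)
  have "0 < emeasure ?k (ball e 1)" using e by (rule cone_measure_ball_pos) simp
  also have "\<dots> \<le> emeasure ?k UNIV" by (rule emeasure_mono) auto
  finally have b: "0 < b" by (simp add: b_def K.emeasure_eq_measure)
  have eq: "emeasure ?m U = ennreal (a / b) * emeasure ?k U" if "open U" for U
  proof -
    have "ennreal (measure ?m U * b) = ennreal (measure ?k U * a)"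
      using cross[OF that open_UNIV] by (simp add: a_def b_def M.emeasure_eq_measure K.emeasure_eq_measure ennreal_mult)
    then have "measure ?m U * b = measure ?k U * a" using a b by (subst (asm) ennreal_inj) auto
    then have "measure ?m U = a / b * measure ?k U" using b by (simp add: field_simps)
    then have "ennreal (measure ?m U) = ennreal (a / b * measure ?k U)" by (rule arg_cong)
    also have "\<dots> = ennreal (a / b) * ennreal (measure ?k U)" using a b by (intro ennreal_mult) auto
    finally show ?thesis by (simp only: M.emeasure_eq_measure K.emeasure_eq_measure)
  qed
  have "?m = scale_measure (ennreal (a / b)) ?k"
  proof (rule measure_eqI_generator_eq[where E="{S. open S}" and A="\<lambda>i::nat. UNIV" and \<Omega>=UNIV])
    show "Int_stable {S::'a set. open S}" by (auto simp: Int_stable_def)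
    show "emeasure ?m UNIV \<noteq> \<infinity>" for i :: nat using sphere_measure_finite[where A="UNIV::'a set"] by auto
  qed (auto simp: eq sigma_sets_open)
  with a b show ?thesis by (intro that[of "a / b"]) auto
qed

section \<open>Borel representatives\<close>

text \<open>
  Covering sets may be replaced by their closures without changing diameters; intersect the unions over coverings of mesh tending to \<open>0\<close>.
\<close>

lemma hausdorff_outer_Borel_regular:
  fixes A :: "'a::metric_space set"
  assumes fin: "hausdorff_outer k A < top"
  obtains G where "G \<in> sets borel" "A \<subseteq> G" "hausdorff_outer k G = hausdorff_outer k A"
proof -
  have "\<exists>U. A \<subseteq> (\<Union>i. U i) \<and> (\<forall>i. bounded (U i) \<and> diameter (U i) \<le> 1 / real (Suc m)) \<and>
          (\<Sum>i. hausdorff_gauge k (U i)) \<le> hausdorff_outer k A + ennreal (1 / real (Suc m))" for m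
  proof -
    have le: "hausdorff_pre k (1 / real (Suc m)) A \<le> hausdorff_outer k A"
      unfolding hausdorff_outer_def by (intro SUP_upper) auto
    also have "\<dots> < hausdorff_outer k A + ennreal (1 / real (Suc m))"
      using fin by (auto simp: less_top)
    finally obtain U where "A \<subseteq> (\<Union>i. U i)" "\<forall>i. bounded (U i) \<and> diameter (U i) \<le> 1 / real (Suc m)"
        "(\<Sum>i. hausdorff_gauge k (U i)) < hausdorff_outer k A + ennreal (1 / real (Suc m))"
      by (subst (asm) (1) hausdorff_pre_def) (auto simp: INF_less_iff)
    then show ?thesis by (blast intro: less_imp_le)
  qed
  then obtain U where U: "\<And>m. A \<subseteq> (\<Union>i. U m i)" "\<And>m i. bounded (U m i)" "\<And>m i. diameter (U m i) \<le> 1 / real (Suc m)"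
          "\<And>m. (\<Sum>i. hausdorff_gauge k (U m i)) \<le> hausdorff_outer k A + ennreal (1 / real (Suc m))" by metis
  define G where "G = (\<Inter>m::nat. \<Union>i::nat. closure (U m i))"
  have "G \<in> sets borel" unfolding G_def by (intro sets.countable_INT'' sets.countable_UN') auto
  moreover have AG: "A \<subseteq> G"
  proof
    fix x assume x: "x \<in> A"
    have "\<exists>i. x \<in> closure (U m i)" for m
    proof -
      obtain i where "x \<in> U m i" using U(1)[of m] x by blast
      then have "x \<in> closure (U m i)" by (rule subsetD[OF closure_subset])
      then show ?thesis ..
    qed
    then show "x \<in> G" unfolding G_def by simp
  qed
  moreover have "hausdorff_outer k G \<le> hausdorff_outer k A"
    unfolding hausdorff_outer_def[of k G]
  proof (rule SUP_least)
    fix \<delta> :: real assume "\<delta> \<in> {0<..}"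
    then have \<delta>: "\<delta> > 0" by simp
    show "hausdorff_pre k \<delta> G \<le> hausdorff_outer k A"
    proof (rule ennreal_le_epsilon)
      fix e :: real assume "0 < e"
      then obtain m where "inverse (real (Suc m)) < min \<delta> e" using reals_Archimedean[of "min \<delta> e"] \<delta> by auto
      then have m: "1 / real (Suc m) \<le> \<delta>" "1 / real (Suc m) \<le> e" by (auto simp: inverse_eq_divide)
      have "hausdorff_pre k \<delta> G \<le> (\<Sum>i. hausdorff_gauge k (closure (U m i)))"
      proof (rule hausdorff_pre_le)
        show "G \<subseteq> (\<Union>i. closure (U m i))" unfolding G_def by blast
        show "bounded (closure (U m i))" for i using U(2) by (rule bounded_closure)
        show "diameter (closure (U m i)) \<le> \<delta>" for i using U(2,3)[of m i] m by (simp add: diameter_closure)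
      qed
      also have "\<dots> = (\<Sum>i. hausdorff_gauge k (U m i))"
      proof -
        have "hausdorff_gauge k (closure (U m i)) = hausdorff_gauge k (U m i)" for i
          by (cases "U m i = {}") (simp_all add: hausdorff_gauge_def diameter_closure[OF U(2)])
        then show ?thesis by simp
      qed
      also have "\<dots> \<le> hausdorff_outer k A + ennreal (1 / real (Suc m))" by (rule U)
      also have "\<dots> \<le> hausdorff_outer k A + ennreal e" using m by (intro add_left_mono ennreal_leI)
      finally show "hausdorff_pre k \<delta> G \<le> hausdorff_outer k A + ennreal e" .
    qed
  qed
  ultimately show ?thesis using that[of G] hausdorff_outer_mono[OF AG] by (simp add: antisym)
qed

text \<open>
  The Caratheodory-measurable sets are more numerous than the Borel sets, but by Borel regularity and
  finiteness only by null sets.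
\<close>

lemma sets_surface_measure_subset_completion:
  "sets (surface_measure :: 'a::euclidean_space measure) \<subseteq> sets (completion (restrict_space sphere_measure (sphere 0 1)))"
proof
  let ?k = "DIM('a) - 1"
  let ?S = "sphere (0::'a) 1"
  fix A :: "'a set" assume "A \<in> sets surface_measure"
  then obtain B where B: "B \<in> sets (hausdorff_measure ?k)" "A = ?S \<inter> B"
    by (auto simp: surface_measure_def sets_restrict_space)
  have "?S \<in> sets (hausdorff_measure ?k)" by (rule borel_in_sets_hausdorff) simp
  then have A: "A \<in> sets (hausdorff_measure ?k)" "A \<subseteq> ?S" using B by auto
  have fin: "hausdorff_outer ?k B < top" if "B \<subseteq> ?S" for B :: "'a set"
    using hausdorff_outer_mono[OF that, of ?k] hausdorff_outer_sphere_finite[where 'a='a] by (rule le_less_trans)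
  obtain G where G: "G \<in> sets borel" "A \<subseteq> G" "hausdorff_outer ?k G = hausdorff_outer ?k A"
    using hausdorff_outer_Borel_regular[OF fin[OF A(2)]] by blast
  define G' where "G' = G \<inter> ?S"
  have G': "G' \<in> sets borel" "A \<subseteq> G'" "G' \<subseteq> ?S" using G A by (auto simp: G'_def)
  have G'eq: "hausdorff_outer ?k G' = hausdorff_outer ?k A"
    using hausdorff_outer_mono[of G' G ?k] hausdorff_outer_mono[OF G'(2), of ?k] G(3) by (auto simp: G'_def)
  have G'h: "G' \<in> sets (hausdorff_measure ?k)" using G'(1) by (rule borel_in_sets_hausdorff)
  have "hausdorff_outer ?k (G' - A) = emeasure (hausdorff_measure ?k) (G' - A)"
    using G'h A by (intro emeasure_hausdorff_measure[symmetric]) auto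
  also have "\<dots> = emeasure (hausdorff_measure ?k) G' - emeasure (hausdorff_measure ?k) A"
    using G'h A G' fin[OF A(2)] by (intro emeasure_Diff) (auto simp: emeasure_hausdorff_measure less_top)
  also have "\<dots> = 0"
    unfolding emeasure_hausdorff_measure[OF G'h] emeasure_hausdorff_measure[OF A(1)] G'eq
    using fin[OF A(2)] by (intro ennreal_diff_self) (simp add: less_top)
  finally have 0: "hausdorff_outer ?k (G' - A) = 0" .
  obtain N where N: "N \<in> sets borel" "G' - A \<subseteq> N" "hausdorff_outer ?k N = 0"
    using hausdorff_outer_Borel_regular[of ?k "G' - A"] 0 by auto
  show "A \<in> sets (completion (restrict_space sphere_measure ?S))"
  proof (rule sets_completionI)
    show "A = (G' - N) \<union> (A \<inter> N)" using N(2) G'(2) by auto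
    show "A \<inter> N \<subseteq> N \<inter> ?S" using A by auto
    have "emeasure sphere_measure (N \<inter> ?S) = 0"
      using N hausdorff_outer_mono[of "N \<inter> ?S" N ?k] by (subst emeasure_sphere_measure) auto
    then show "N \<inter> ?S \<in> null_sets (restrict_space sphere_measure ?S)"
      using N by (subst null_sets_restrict_space) (auto simp: null_sets_def)
    show "G' - N \<in> sets (restrict_space sphere_measure ?S)"
      using N G' by (auto simp: sets_restrict_space intro!: image_eqI[where x="G' - N"])
  qed
qed

theorem surface_measure_borel_representative:
  fixes \<Omega> :: "'a::euclidean_space \<Rightarrow> real"
  assumes "\<Omega> \<in> borel_measurable surface_measure"
  obtains \<Omega>' N where "\<Omega>' \<in> borel_measurable borel" "N \<in> sets borel" "emeasure sphere_measure N = 0"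
     "\<And>x. norm x = 1 \<Longrightarrow> x \<notin> N \<Longrightarrow> \<Omega> x = \<Omega>' x"
proof -
  let ?S = "sphere (0::'a) 1"
  let ?M = "restrict_space sphere_measure ?S"
  have "\<Omega> \<in> borel_measurable (completion ?M)"
  proof (rule measurableI)
    fix B :: "real set" assume "B \<in> sets borel"
    then have "\<Omega> -` B \<inter> space surface_measure \<in> sets surface_measure" using assms by (rule measurable_sets[rotated])
    then show "\<Omega> -` B \<inter> space (completion ?M) \<in> sets (completion ?M)"
      using sets_surface_measure_subset_completion[where 'a='a] by (auto simp: space_surface_measure space_restrict_space)
  qed simp
  from completion_ex_borel_measurable_real[OF this] obtain g where
    g: "g \<in> borel_measurable ?M" "AE x in ?M. \<Omega> x = g x" by blast
  from g(2) obtain N where N: "{x \<in> space ?M. \<not> \<Omega> x = g x} \<subseteq> N" "emeasure ?M N = 0" "N \<in> sets ?M"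
    by (rule AE_E)
  have N': "N \<in> sets borel" "N \<subseteq> ?S" using N(3) by (auto simp: sets_restrict_space)
  define \<Omega>' where "\<Omega>' x = (if x \<in> ?S then g x else 0)" for x
  show ?thesis
  proof (rule that[of \<Omega>' N])
    have "g \<in> borel_measurable (restrict_space borel ?S)"
      using g(1) by (subst measurable_cong_sets[of _ ?M borel borel]) (auto intro!: sets_restrict_space_cong)
    then show "\<Omega>' \<in> borel_measurable borel"
      unfolding \<Omega>'_def by (subst (asm) measurable_restrict_space_iff[where c=0]) auto
    show "emeasure sphere_measure N = 0"
      using N(2) N' by (subst (asm) emeasure_restrict_space) auto
    show "\<Omega> x = \<Omega>' x" if "norm x = 1" "x \<notin> N" for x
      using that N(1) by (auto simp: \<Omega>'_def space_restrict_space)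
  qed fact
qed

lemma homogeneous0_direction: "homogeneous0 (\<lambda>y::'a::real_normed_vector. f (y /\<^sub>R norm y))"
proof -
  have "(c *\<^sub>R y) /\<^sub>R norm (c *\<^sub>R y) = y /\<^sub>R norm y" if "0 < c" for c and y :: 'a
    using that by (simp add: field_simps)
  then show ?thesis unfolding homogeneous0_def by metis
qed

text \<open>
  Needed because the operator sees \<open>\<Omega>\<close> only through \<open>\<Omega>(y/|y|)\<close>: a null set on the sphere spans a Lebesgue-null cone.
\<close>

lemma AE_direction_notin_null:
  fixes N :: "'a::euclidean_space set"
  assumes "2 \<le> DIM('a)" and [measurable]: "N \<in> sets borel" and "emeasure sphere_measure N = 0"
  shows "AE y in lborel. y /\<^sub>R norm y \<notin> N"
proof -
  obtain c where c: "0 < c" "(sphere_measure :: 'a measure) = scale_measure (ennreal c) cone_measure"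
    using sphere_measure_eq_scale_cone_measure[OF assms(1)] by blast
  have "emeasure (scale_measure (ennreal c) cone_measure) N = 0" using assms(3) unfolding c(2) .
  then have "emeasure cone_measure N = 0" using c(1) by simp
  then have 0: "(\<integral>\<^sup>+y. indicator N (y /\<^sub>R norm y) * indicator {y::'a. norm y \<le> 1} y \<partial>lborel) = 0"
    using nn_integral_cone_measure[of "indicator N"] by (simp add: nn_integral_indicator)
  have "(\<integral>\<^sup>+y. indicator N (y /\<^sub>R norm y) * 1 \<partial>lborel) = 0"
    by (subst nn_integral_polar[where h="\<lambda>_. 1", OF _ _ homogeneous0_direction]) (auto simp: 0)
  then show ?thesis
    by (subst (asm) nn_integral_0_iff_AE) (auto elim!: eventually_mono simp: indicator_def split: if_splits)
qed

section \<open>Lorentz spaces\<close>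

text \<open>
  The distribution function \<open>d\<close> is decreasing, so the part of the Lorentz integral over \<open>t \<le> s\<close> is at least a
  multiple of \<open>(s^p d(s))^(q/p)\<close>. Thus \<open>d(s)\<close> is \<open>O(s^(-p))\<close>, and on a space of finite measure this suffices for every
  power below \<open>p\<close>.
\<close>

lemma lorentz_imp_power_integrable:
  assumes M: "finite_measure M" and [measurable]: "g \<in> borel_measurable M"
    and fin: "lorentz_norm M p q g < top" and pq: "0 < p" "0 < q" and \<rho>: "0 < \<rho>" "\<rho> < p"
  shows "(\<integral>\<^sup>+x. ennreal (\<bar>g x\<bar> powr \<rho>) \<partial>M) < top"
proof -
  interpret finite_measure M by fact
  interpret P: pair_sigma_finite M lborel ..
  define d where "d t = emeasure M {x\<in>space M. t < \<bar>g x\<bar>}" for t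
  have [measurable]: "d \<in> borel_measurable borel"
    unfolding d_def by measurable
  define I where "I = (\<integral>\<^sup>+t\<in>{0<..}. ennreal (t powr q) * ennpowr (d t) (q / p) * ennreal (1 / t) \<partial>lborel)"
  have "ennpowr (ennreal p * I) (1 / q) < top"
    using fin by (simp add: lorentz_norm_def I_def d_def)
  then have "ennreal p * I \<noteq> top" by (metis ennpowr_top less_irrefl)
  then have "ennreal p * I < top" by (simp add: less_top)
  then have "I < top" using pq by (auto simp: ennreal_mult_less_top)
  then obtain J where J: "I = ennreal J" "0 \<le> J" by (cases I) auto
  define K where "K = (q * J) powr (p / q)"
  have dK: "d s \<le> ennreal (K * s powr - p)" if s: "0 < s" for s
  proof -
    have mono: "d s \<le> d t" if "t \<le> s" for t
      unfolding d_def using that by (intro emeasure_mono) auto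
    have "ennpowr (d s) (q / p) * ennreal (s powr q / q) = (\<integral>\<^sup>+t. ennpowr (d s) (q / p) * (ennreal (t powr (q - 1)) * indicator {0..s} t) \<partial>lborel)"
      using nn_integral_powr_from_0[of "q - 1" s] s pq by (simp add: nn_integral_cmult)
    also have "\<dots> \<le> I"
      unfolding I_def
    proof (intro nn_integral_mono_AE, rule eventually_mono[OF AE_lborel_singleton[of 0]])
      fix t :: real assume t: "t \<noteq> 0"
      show "ennpowr (d s) (q / p) * (ennreal (t powr (q - 1)) * indicator {0..s} t) \<le> ennreal (t powr q) * ennpowr (d t) (q / p) * ennreal (1 / t) * indicator {0<..} t"
      proof (cases "t \<in> {0..s}")
        case True
        then have "t powr (q - 1) = t powr q * (1 / t)" using t by (simp add: powr_diff)
        then have "ennreal (t powr (q - 1)) = ennreal (t powr q) * ennreal (1 / t)" using True by (simp add: ennreal_mult[symmetric])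
        moreover have "ennpowr (d s) (q / p) \<le> ennpowr (d t) (q / p)" using mono True pq by (intro ennpowr_mono) auto
        ultimately show ?thesis using True t by (auto simp: mult_ac intro!: mult_left_mono)
      qed auto
    qed
    finally have "ennpowr (d s) (q / p) * ennreal (s powr q / q) * ennreal (q * s powr - q) \<le> I * ennreal (q * s powr - q)"
      by (rule mult_right_mono) simp
    moreover have "ennreal (s powr q / q) * ennreal (q * s powr - q) = 1"
      using s pq by (simp add: powr_minus flip: ennreal_mult)
    ultimately have "ennpowr (d s) (q / p) \<le> ennreal (J * (q * s powr - q))"
      using J pq by (simp add: mult.assoc ennreal_mult)
    then have "ennpowr (ennpowr (d s) (q / p)) (p / q) \<le> ennpowr (ennreal (J * (q * s powr - q))) (p / q)"
      using pq by (intro ennpowr_mono) auto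
    then have "d s \<le> ennreal ((J * (q * s powr - q)) powr (p / q))"
      using pq J by (simp add: ennpowr_ennpowr ennpowr_ennreal)
    also have "(J * (q * s powr - q)) powr (p / q) = K * s powr - p"
      using pq J by (simp add: K_def powr_mult powr_powr mult_ac)
    finally show ?thesis .
  qed
  have "(\<integral>\<^sup>+x. ennreal (\<bar>g x\<bar> powr \<rho>) \<partial>M) = (\<integral>\<^sup>+x. ennpowr (ennreal \<bar>g x\<bar>) \<rho> \<partial>M)"
    by (simp add: ennpowr_ennreal)
  also have "\<dots> = (\<integral>\<^sup>+x. \<integral>\<^sup>+t. ennreal (\<rho> * t powr (\<rho> - 1)) * indicator {t. 0 < t \<and> ennreal t < ennreal \<bar>g x\<bar>} t \<partial>lborel \<partial>M)"
    using \<rho> by (simp add: ennpowr_layer_cake)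
  also have "\<dots> = (\<integral>\<^sup>+t. \<integral>\<^sup>+x. ennreal (\<rho> * t powr (\<rho> - 1)) * indicator {t. 0 < t \<and> ennreal t < ennreal \<bar>g x\<bar>} t \<partial>M \<partial>lborel)"
    by (rule P.Fubini'[symmetric]) measurable
  also have "\<dots> = (\<integral>\<^sup>+t. ennreal (\<rho> * t powr (\<rho> - 1)) * indicator {0<..} t * d t \<partial>lborel)"
  proof (intro nn_integral_cong)
    fix t :: real
    have "(\<integral>\<^sup>+x. ennreal (\<rho> * t powr (\<rho> - 1)) * indicator {t. 0 < t \<and> ennreal t < ennreal \<bar>g x\<bar>} t \<partial>M) = 
      (\<integral>\<^sup>+x. (ennreal (\<rho> * t powr (\<rho> - 1)) * indicator {0<..} t) * indicator {x\<in>space M. t < \<bar>g x\<bar>} x \<partial>M)"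
      by (intro nn_integral_cong) (auto simp: indicator_def ennreal_less_iff)
    then show "(\<integral>\<^sup>+x. ennreal (\<rho> * t powr (\<rho> - 1)) * indicator {t. 0 < t \<and> ennreal t < ennreal \<bar>g x\<bar>} t \<partial>M) = ennreal (\<rho> * t powr (\<rho> - 1)) * indicator {0<..} t * d t"
      by (simp add: nn_integral_cmult d_def)
  qed
  also have "\<dots> \<le> (\<integral>\<^sup>+t. emeasure M (space M) * ennreal \<rho> * (ennreal (t powr (\<rho> - 1)) * indicator {0..1} t)
      + ennreal (\<rho> * K) * (ennreal (t powr (\<rho> - 1 - p)) * indicator {1..} t) \<partial>lborel)"
  proof (intro nn_integral_mono)
    fix t :: real
    consider "t \<le> 0" | "0 < t" "t \<le> 1" | "1 < t" by linarith
    then show "ennreal (\<rho> * t powr (\<rho> - 1)) * indicator {0<..} t * d t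
      \<le> emeasure M (space M) * ennreal \<rho> * (ennreal (t powr (\<rho> - 1)) * indicator {0..1} t)
      + ennreal (\<rho> * K) * (ennreal (t powr (\<rho> - 1 - p)) * indicator {1..} t)"
    proof cases
      case 2
      have "d t \<le> emeasure M (space M)" unfolding d_def by (intro emeasure_mono) auto
      then have "ennreal (\<rho> * t powr (\<rho> - 1)) * d t \<le> ennreal (\<rho> * t powr (\<rho> - 1)) * emeasure M (space M)" by (rule mult_left_mono) simp
      also have "\<dots> = emeasure M (space M) * ennreal \<rho> * ennreal (t powr (\<rho> - 1))"
        using \<rho> by (simp add: ennreal_mult mult_ac)
      finally show ?thesis using 2 by (auto intro: add_increasing2)
    next
      case 3
      have "ennreal (\<rho> * t powr (\<rho> - 1)) * d t \<le> ennreal (\<rho> * t powr (\<rho> - 1)) * ennreal (K * t powr - p)"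
        using dK[of t] 3 by (intro mult_left_mono) auto
      also have "\<dots> = ennreal (\<rho> * K * (t powr (\<rho> - 1) * t powr - p))"
        using \<rho> by (subst ennreal_mult[symmetric]) (auto simp: K_def mult_ac)
      also have "t powr (\<rho> - 1) * t powr - p = t powr (\<rho> - 1 - p)"
        by (simp flip: powr_add)
      finally show ?thesis using 3 \<rho> by (simp add: ennreal_mult K_def)
    qed auto
  qed
  also have "\<dots> = emeasure M (space M) * ennreal \<rho> * ennreal (1 / \<rho>) + ennreal (\<rho> * K) * ennreal (1 / (p - \<rho>))"
    using nn_integral_powr_from_0[of "\<rho> - 1" 1] nn_integral_powr_to_inf[of "\<rho> - 1 - p" 1] \<rho>
    by (simp add: nn_integral_add nn_integral_cmult)
  also have "\<dots> < top"
  proof -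
    have "emeasure M (space M) < top" using emeasure_finite[of "space M"] by (simp add: less_top[symmetric])
    then show ?thesis by (simp add: ennreal_mult_less_top)
  qed
  finally show ?thesis .
qed

section \<open>Test functions\<close>

lemma test_function_GDERIV:
  assumes "f \<in> test_functions"
  shows "GDERIV f x :> grad f x" "continuous_on UNIV (grad f)"
proof -
  have C: "C_diff (Suc 0) f" using assms by (auto simp: test_functions_def)
  then have diff: "f differentiable at x" and cont: "b \<in> Basis \<Longrightarrow> continuous_on UNIV (\<lambda>x. frechet_derivative f (at x) b)" for b x
    by auto
  define D where "D x = (\<Sum>b\<in>Basis. frechet_derivative f (at x) b *\<^sub>R b)" for x
  have G: "GDERIV f x :> D x" for x
  proof -
    have d: "(f has_derivative frechet_derivative f (at x)) (at x)"
      using diff frechet_derivative_works by blast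
    then have lin: "linear (frechet_derivative f (at x))" by (rule has_derivative_linear)
    have "frechet_derivative f (at x) h = h \<bullet> D x" for h
    proof -
      have "frechet_derivative f (at x) h = frechet_derivative f (at x) (\<Sum>b\<in>Basis. (h \<bullet> b) *\<^sub>R b)"
        by (simp add: euclidean_representation)
      also have "\<dots> = (\<Sum>b\<in>Basis. (h \<bullet> b) * frechet_derivative f (at x) b)"
        using lin by (simp add: linear_sum linear_scale)
      finally show ?thesis by (simp add: D_def inner_sum_right mult.commute)
    qed
    then have "frechet_derivative f (at x) = (\<lambda>h. h \<bullet> D x)" by auto
    then show ?thesis using d by (simp add: gderiv_def)
  qed
  have "grad f x = D x" for x
    unfolding grad_def
  proof (rule the_equality)
    fix D' assume "GDERIV f x :> D'"
    then have "(\<lambda>h. h \<bullet> D') = (\<lambda>h. h \<bullet> D x)"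
      using G[of x] unfolding gderiv_def by (rule has_derivative_unique)
    then have "h \<bullet> D' = h \<bullet> D x" for h by metis
    then have "(D' - D x) \<bullet> (D' - D x) = 0" by (metis inner_diff_right diff_self)
    then show "D' = D x" by simp
  qed (rule G)
  then have grad: "grad f = D" by auto
  show "GDERIV f x :> grad f x" using G by (simp add: grad)
  show "continuous_on UNIV (grad f)"
    unfolding grad D_def by (intro continuous_intros cont)
qed

lemma test_function_continuous:
  assumes "f \<in> test_functions"
  shows "continuous_on UNIV f"
proof -
  have "C_diff 0 f" using assms unfolding test_functions_def by blast
  then show ?thesis by simp
qed

lemma test_function_bounded:
  assumes "f \<in> test_functions"
  obtains R B where "0 < R" "0 < B" "\<And>x. R < norm x \<Longrightarrow> f x = 0" "\<And>x. \<bar>f x\<bar> \<le> B"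
proof -
  let ?K = "closure {x. f x \<noteq> 0}"
  have K: "compact ?K" using assms by (auto simp: test_functions_def)
  obtain R where R: "0 < R" "\<And>x. x \<in> ?K \<Longrightarrow> norm x \<le> R"
    using compact_imp_bounded[OF K] by (auto simp: bounded_pos)
  have "compact (f ` ?K)"
    using continuous_on_subset[OF test_function_continuous[OF assms] subset_UNIV] K by (rule compact_continuous_image)
  then obtain B where B: "0 < B" "\<And>y. y \<in> f ` ?K \<Longrightarrow> norm y \<le> B"
    using compact_imp_bounded bounded_pos by metis
  have nz: "x \<in> ?K" if "f x \<noteq> 0" for x using that closure_subset by fastforce
  show ?thesis
  proof (rule that[OF R(1) B(1)])
    show "f x = 0" if "R < norm x" for x using R(2)[of x] nz[of x] that by fastforce
    show "\<bar>f x\<bar> \<le> B" for x using B nz[of x] by (cases "f x = 0") auto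
  qed
qed

text \<open>
  The fundamental theorem of calculus along the segment from \<open>z\<close> to \<open>y\<close>.
\<close>

lemma test_function_increment:
  assumes "f \<in> test_functions"
  shows "ennreal \<bar>f z - f y\<bar> \<le> (\<integral>\<^sup>+t. ennreal (norm (grad f (z + t *\<^sub>R (y - z))) * norm (y - z)) * indicator {0..1} t \<partial>lborel)"
proof -
  define h where "h t = f (z + t *\<^sub>R (y - z))" for t
  define h' where "h' t = (y - z) \<bullet> grad f (z + t *\<^sub>R (y - z))" for t
  have deriv: "(h has_vector_derivative h' t) (at t within {0..1})" for t
  proof -
    have "(f has_derivative (\<lambda>k. k \<bullet> grad f (z + t *\<^sub>R (y - z)))) (at (z + t *\<^sub>R (y - z)))"
      using test_function_GDERIV(1)[OF assms] by (simp add: gderiv_def)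
    moreover have "((\<lambda>t. z + t *\<^sub>R (y - z)) has_derivative (\<lambda>s. s *\<^sub>R (y - z))) (at t within {0..1})"
      by (auto intro!: derivative_eq_intros)
    ultimately have "(h has_derivative (\<lambda>s. (s *\<^sub>R (y - z)) \<bullet> grad f (z + t *\<^sub>R (y - z)))) (at t within {0..1})"
      unfolding h_def by (rule has_derivative_compose[rotated])
    then show ?thesis by (simp add: has_vector_derivative_def h'_def mult.commute)
  qed
  have cont: "continuous_on {0..1} h'"
    unfolding h'_def
    by (intro continuous_intros continuous_on_compose2[OF test_function_GDERIV(2)[OF assms]]) auto
  have int: "integrable lborel (\<lambda>t. indicator {0..1} t *\<^sub>R h' t)"
    using borel_integrable_atLeastAtMost'[OF cont] by (simp add: set_integrable_def)
  have "(\<integral>t. indicator {0..1} t *\<^sub>R h' t \<partial>lborel) = h 1 - h 0"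
    by (rule integral_FTC_Icc[OF _ deriv cont]) auto
  then have "ennreal \<bar>f z - f y\<bar> = ennreal (norm (\<integral>t. indicator {0..1} t *\<^sub>R h' t \<partial>lborel))"
    by (simp add: h_def abs_minus_commute)
  also have "\<dots> \<le> (\<integral>\<^sup>+t. ennreal (norm (indicator {0..1} t *\<^sub>R h' t)) \<partial>lborel)"
    by (rule integral_norm_bound_ennreal[OF int])
  also have "\<dots> \<le> (\<integral>\<^sup>+t. ennreal (norm (grad f (z + t *\<^sub>R (y - z))) * norm (y - z)) * indicator {0..1} t \<partial>lborel)"
  proof (intro nn_integral_mono)
    fix t :: real
    have "\<bar>h' t\<bar> \<le> norm (grad f (z + t *\<^sub>R (y - z))) * norm (y - z)"
      unfolding h'_def using Cauchy_Schwarz_ineq2[of "y - z" "grad f (z + t *\<^sub>R (y - z))"] by (simp add: mult.commute)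
    then show "ennreal (norm (indicator {0..1} t *\<^sub>R h' t)) \<le> ennreal (norm (grad f (z + t *\<^sub>R (y - z))) * norm (y - z)) * indicator {0..1} t"
      by (auto simp: indicator_def ennreal_leI)
  qed
  finally show ?thesis .
qed

section \<open>A Poincare inequality\<close>

text \<open>
  Integrate the increment along segments from \<open>y\<close> over all endpoints \<open>z\<close> in the ball and substitute
  \<open>v = y + t (z - y)\<close> for fixed \<open>t\<close>. The point \<open>v\<close> stays in the ball by convexity, and it is reached only for \<open>t \<ge> |v - y| / (2 \<rho>)\<close>;
  integrating \<open>t^(-n-1)\<close> over these \<open>t\<close> produces the factor \<open>|v - y|^(-n)\<close>.
\<close>

lemma Poincare_potential:
  fixes f g :: "'a::euclidean_space \<Rightarrow> real"
  assumes [measurable]: "f \<in> borel_measurable borel" "g \<in> borel_measurable borel"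
    and g: "\<And>x. 0 \<le> g x"
    and fg: "\<And>y z. ennreal \<bar>f y - f z\<bar> \<le> (\<integral>\<^sup>+t. ennreal (g (y + t *\<^sub>R (z - y)) * norm (z - y)) * indicator {0..1} t \<partial>lborel)"
    and y: "norm y \<le> \<rho>" and "0 < \<rho>"
  shows "(\<integral>\<^sup>+z. ennreal \<bar>f y - f z\<bar> * indicator {z. norm z \<le> \<rho>} z \<partial>lborel)
    \<le> ennreal ((2 * \<rho>) ^ DIM('a) / real DIM('a)) *
      (\<integral>\<^sup>+v. ennreal (g v * norm (v - y) powr (1 - real DIM('a))) * indicator {v. norm v \<le> \<rho>} v \<partial>lborel)"
proof -
  let ?n = "real DIM('a)"
  have n: "?n \<ge> 1" using DIM_positive[where 'a='a] by linarith
  let ?V = "\<lambda>t v. ennreal (g v * norm (v - y)) * indicator {v. norm v \<le> \<rho>} v * (ennreal (t powr (- ?n - 1)) * indicator {s. norm (v - y) / (2 * \<rho>) \<le> s} t)"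
  let ?Z = "\<lambda>t z. ennreal (g (y + t *\<^sub>R (z - y)) * norm (z - y)) * indicator {0..1} t * indicator {z. norm z \<le> \<rho>} z"
  have "(\<integral>\<^sup>+z. ennreal \<bar>f y - f z\<bar> * indicator {z. norm z \<le> \<rho>} z \<partial>lborel)
     \<le> (\<integral>\<^sup>+z. (\<integral>\<^sup>+t. ?Z t z \<partial>lborel) \<partial>lborel)"
    by (intro nn_integral_mono) (simp add: nn_integral_multc fg mult_right_mono)
  also have "\<dots> = (\<integral>\<^sup>+t. (\<integral>\<^sup>+z. ?Z t z \<partial>lborel) \<partial>lborel)"
    by (subst lborel_pair.Fubini') auto
  also have "\<dots> \<le> (\<integral>\<^sup>+t. (\<integral>\<^sup>+v. ?V t v \<partial>lborel) \<partial>lborel)"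
  proof (intro nn_integral_mono_AE, rule eventually_mono[OF AE_lborel_singleton[of 0]])
    fix t :: real assume "t \<noteq> 0"
    show "(\<integral>\<^sup>+z. ?Z t z \<partial>lborel)
      \<le> (\<integral>\<^sup>+v. ?V t v \<partial>lborel)"
    proof (cases "t \<in> {0..1}")
      case True
      with \<open>t \<noteq> 0\<close> have t: "0 < t" "t \<le> 1" by auto
      let ?F = "\<lambda>z. ennreal (g (y + t *\<^sub>R (z - y)) * norm (z - y)) * indicator {z. norm z \<le> \<rho>} z"
      have "(\<integral>\<^sup>+z. ?Z t z \<partial>lborel) = (\<integral>\<^sup>+z. ?F z \<partial>lborel)"
        using True by simp
      also have "\<dots> = ennreal (\<bar>1 / t\<bar> ^ DIM('a)) * (\<integral>\<^sup>+v. ?F ((y - (1 / t) *\<^sub>R y) + (1 / t) *\<^sub>R v) \<partial>lborel)"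
        using t by (intro nn_integral_lborel_affine) auto
      also have "\<dots> = (\<integral>\<^sup>+v. ennreal (\<bar>1 / t\<bar> ^ DIM('a)) * ?F ((y - (1 / t) *\<^sub>R y) + (1 / t) *\<^sub>R v) \<partial>lborel)"
        by (subst nn_integral_cmult) auto
      also have "\<dots> \<le> (\<integral>\<^sup>+v. ?V t v \<partial>lborel)"
      proof (intro nn_integral_mono)
        fix v :: 'a
        define z where "z = (y - (1 / t) *\<^sub>R y) + (1 / t) *\<^sub>R v"
        have zy: "z - y = (1 / t) *\<^sub>R (v - y)" by (simp add: z_def algebra_simps)
        then have tz: "y + t *\<^sub>R (z - y) = v" using t by simp
        have v: "v = (1 - t) *\<^sub>R y + t *\<^sub>R z" using tz by (simp add: algebra_simps)
        have nzy: "norm (z - y) = norm (v - y) / t" using t by (simp add: zy)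
        show "ennreal (\<bar>1 / t\<bar> ^ DIM('a)) * ?F ((y - (1 / t) *\<^sub>R y) + (1 / t) *\<^sub>R v)
          \<le> ?V t v"
        proof (cases "norm z \<le> \<rho>")
          case z: True
          have "norm v \<le> norm ((1 - t) *\<^sub>R y) + norm (t *\<^sub>R z)" unfolding v by (rule norm_triangle_ineq)
          also have "\<dots> = (1 - t) * norm y + t * norm z" using t by simp
          also have "\<dots> \<le> (1 - t) * \<rho> + t * \<rho>" using t y z by (intro add_mono mult_left_mono) auto
          finally have nv: "norm v \<le> \<rho>" by (simp add: algebra_simps)
          have "norm (z - y) \<le> 2 * \<rho>" using norm_triangle_ineq4[of z y] y z by linarith
          then have nvy: "norm (v - y) / (2 * \<rho>) \<le> t" using t \<open>0 < \<rho>\<close> by (simp add: nzy field_simps)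
          have "(1 / t) ^ DIM('a) * (g v * (norm (v - y) / t)) = g v * norm (v - y) * t powr (- ?n - 1)"
            using t by (simp add: powr_diff powr_minus powr_realpow power_one_over divide_inverse power_inverse)
          then show ?thesis using z nv nvy t g[of v]
            unfolding z_def[symmetric] tz nzy by (simp flip: ennreal_mult)
        next
          case False
          then show ?thesis unfolding z_def[symmetric] by simp
        qed
      qed
      finally show ?thesis .
    qed auto
  qed
  also have "\<dots> = (\<integral>\<^sup>+v. (\<integral>\<^sup>+t. ?V t v \<partial>lborel) \<partial>lborel)"
    by (subst lborel_pair.Fubini') auto
  also have "\<dots> = (\<integral>\<^sup>+v. ennreal ((2 * \<rho>) ^ DIM('a) / ?n) * (ennreal (g v * norm (v - y) powr (1 - ?n)) * indicator {v. norm v \<le> \<rho>} v) \<partial>lborel)"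
  proof (intro nn_integral_cong_AE, rule eventually_mono[OF AE_lborel_singleton[of y]])
    fix v assume "v \<noteq> y"
    then have d: "0 < norm (v - y)" by simp
    let ?d = "norm (v - y)"
    have "(\<integral>\<^sup>+t. ennreal (g v * ?d) * indicator {v. norm v \<le> \<rho>} v * (ennreal (t powr (- ?n - 1)) * indicator {s. ?d / (2 * \<rho>) \<le> s} t) \<partial>lborel)
      = ennreal (g v * ?d) * indicator {v. norm v \<le> \<rho>} v * ennreal ((?d / (2 * \<rho>)) powr - ?n / ?n)"
      using nn_integral_powr_to_inf[of "- ?n - 1" "?d / (2 * \<rho>)"] n d \<open>0 < \<rho>\<close>
      by (simp add: nn_integral_cmult atLeast_def)
    also have "(?d / (2 * \<rho>)) powr - ?n / ?n = (2 * \<rho>) ^ DIM('a) / ?n * ?d powr - ?n"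
    proof -
      have e: "(2 * \<rho>) ^ DIM('a) = (2 * \<rho>) powr ?n" using \<open>0 < \<rho>\<close> by (simp add: powr_realpow)
      have "(?d / (2 * \<rho>)) powr - ?n = ?d powr - ?n / (2 * \<rho>) powr - ?n"
        using d \<open>0 < \<rho>\<close> by (intro powr_divide)
      also have "\<dots> = ?d powr - ?n * (2 * \<rho>) powr ?n"
        by (simp only: powr_minus divide_inverse inverse_inverse_eq)
      finally have e2: "(?d / (2 * \<rho>)) powr - ?n = ?d powr - ?n * (2 * \<rho>) powr ?n" .
      show ?thesis unfolding e e2 by simp
    qed
    also have "ennreal (g v * ?d) * indicator {v. norm v \<le> \<rho>} v * ennreal ((2 * \<rho>) ^ DIM('a) / ?n * ?d powr - ?n)
      = ennreal ((2 * \<rho>) ^ DIM('a) / ?n) * (ennreal (g v * (?d powr 1 * ?d powr - ?n)) * indicator {v. norm v \<le> \<rho>} v)"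
      using g[of v] d n \<open>0 < \<rho>\<close> by (auto simp: indicator_def mult_ac simp flip: ennreal_mult)
    also have "?d powr 1 * ?d powr - ?n = ?d powr (1 - ?n)"
      by (simp only: powr_add[symmetric]) simp
    finally show "(\<integral>\<^sup>+t. ennreal (g v * ?d) * indicator {v. norm v \<le> \<rho>} v * (ennreal (t powr (- ?n - 1)) * indicator {s. ?d / (2 * \<rho>) \<le> s} t) \<partial>lborel)
      = ennreal ((2 * \<rho>) ^ DIM('a) / ?n) * (ennreal (g v * ?d powr (1 - ?n)) * indicator {v. norm v \<le> \<rho>} v)" .
  qed
  also have "\<dots> = ennreal ((2 * \<rho>) ^ DIM('a) / ?n) * (\<integral>\<^sup>+v. ennreal (g v * norm (v - y) powr (1 - ?n)) * indicator {v. norm v \<le> \<rho>} v \<partial>lborel)"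
    by (subst nn_integral_cmult) auto
  finally show ?thesis .
qed

section \<open>A pointwise bound by a homogeneous kernel\<close>

text \<open>
  A Borel function that is integrable with mean zero on the sphere. The conditions are expressed on the
  unit ball by polar coordinates, and the mean-zero condition by the equality of the two one-sided integrals.
\<close>

locale rough_kernel =
  fixes \<Omega> :: "'a::euclidean_space \<Rightarrow> real" and \<alpha> :: real
  assumes \<Omega>[measurable]: "\<Omega> \<in> borel_measurable borel"
    and int: "(\<integral>\<^sup>+y. ennreal \<bar>\<Omega> (y /\<^sub>R norm y)\<bar> * indicator {y. norm y \<le> 1} y \<partial>lborel) < top"
    and mean: "(\<integral>\<^sup>+y. ennreal (\<Omega> (y /\<^sub>R norm y)) * indicator {y. norm y \<le> 1} y \<partial>lborel)
             = (\<integral>\<^sup>+y. ennreal (- \<Omega> (y /\<^sub>R norm y)) * indicator {y. norm y \<le> 1} y \<partial>lborel)"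
begin

lemma integrable_shell:
  assumes [measurable]: "h \<in> borel_measurable borel" and B: "\<And>t. \<bar>h t\<bar> \<le> B" and N: "0 < N" "\<And>t. N < t \<Longrightarrow> h t = 0"
  shows "integrable lborel (\<lambda>y. \<Omega> (y /\<^sub>R norm y) * h (norm y))"
proof (rule integrableI_bounded)
  have "(\<integral>\<^sup>+y. ennreal (norm (\<Omega> (y /\<^sub>R norm y) * h (norm y))) \<partial>lborel)
     \<le> (\<integral>\<^sup>+y. ennreal B * (ennreal \<bar>\<Omega> (y /\<^sub>R norm y)\<bar> * indicator {y. norm y \<le> N} y) \<partial>lborel)"
  proof (intro nn_integral_mono)
    fix y :: 'a
    have B0: "0 \<le> B" using B[of 0] by simp
    show "ennreal (norm (\<Omega> (y /\<^sub>R norm y) * h (norm y))) \<le> ennreal B * (ennreal \<bar>\<Omega> (y /\<^sub>R norm y)\<bar> * indicator {y. norm y \<le> N} y)"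
    proof (cases "norm y \<le> N")
      case True
      have "\<bar>\<Omega> (y /\<^sub>R norm y)\<bar> * \<bar>h (norm y)\<bar> \<le> \<bar>\<Omega> (y /\<^sub>R norm y)\<bar> * B" using B by (intro mult_left_mono) auto
      then show ?thesis using True B0 by (simp add: abs_mult mult.commute ennreal_leI flip: ennreal_mult)
    qed (use N in auto)
  qed
  also have "\<dots> = ennreal B * (ennreal (N ^ DIM('a)) * (\<integral>\<^sup>+y. ennreal \<bar>\<Omega> (y /\<^sub>R norm y)\<bar> * indicator {y. norm y \<le> 1} y \<partial>lborel))"
    using N by (subst nn_integral_cmult, simp, subst nn_integral_homogeneous_cball[OF _ homogeneous0_direction]) auto
  also have "\<dots> < \<infinity>" using int by (simp add: ennreal_mult_less_top)
  finally show "(\<integral>\<^sup>+y. ennreal (norm (\<Omega> (y /\<^sub>R norm y) * h (norm y))) \<partial>lborel) < \<infinity>" .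
qed measurable

text \<open>
  The positive and the negative part of \<open>\<Omega>\<close> have the same mass, hence by \<open>distr_norm_homogeneous\<close> the same radial distribution.
\<close>

lemma integral_radial_eq_0:
  assumes [measurable]: "h \<in> borel_measurable borel" and B: "\<And>t. \<bar>h t\<bar> \<le> B" and N: "0 < N" "\<And>t. N < t \<Longrightarrow> h t = 0"
  shows "(\<integral>y. \<Omega> (y /\<^sub>R norm y) * h (norm y) \<partial>lborel) = 0"
proof -
  let ?P = "\<lambda>y. max 0 (\<Omega> (y /\<^sub>R norm y))" and ?N = "\<lambda>y. max 0 (- \<Omega> (y /\<^sub>R norm y))"
  have int0: "integrable lborel (\<lambda>y. \<Omega> (y /\<^sub>R norm y) * h (norm y))" by (rule integrable_shell[OF assms])
  have iP: "integrable lborel (\<lambda>y. ?P y * h (norm y))"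
    by (rule Bochner_Integration.integrable_bound[OF int0]) (auto simp: abs_mult intro!: mult_right_mono)
  have iN: "integrable lborel (\<lambda>y. ?N y * h (norm y))"
    by (rule Bochner_Integration.integrable_bound[OF int0]) (auto simp: abs_mult intro!: mult_right_mono)
  have e1: "ennreal (?P y) = ennreal (\<Omega> (y /\<^sub>R norm y))" and e2: "ennreal (?N y) = ennreal (- \<Omega> (y /\<^sub>R norm y))" for y
    by (auto simp: max_def ennreal_neg)
  have fP: "(\<integral>\<^sup>+y. ennreal (?P y) * indicator {y. norm y \<le> 1} y \<partial>lborel) < top"
  proof -
    have "(\<integral>\<^sup>+y. ennreal (?P y) * indicator {y. norm y \<le> 1} y \<partial>lborel) \<le> (\<integral>\<^sup>+y. ennreal \<bar>\<Omega> (y /\<^sub>R norm y)\<bar> * indicator {y. norm y \<le> 1} y \<partial>lborel)"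
      by (intro nn_integral_mono mult_right_mono ennreal_leI) auto
    then show ?thesis using int by (rule le_less_trans)
  qed
  then have fN: "(\<integral>\<^sup>+y. ennreal (?N y) * indicator {y. norm y \<le> 1} y \<partial>lborel) < top"
    unfolding e1 e2 mean .
  have eq: "distr (density lborel (\<lambda>y. ennreal (?P y))) borel norm = distr (density lborel (\<lambda>y. ennreal (?N y))) borel norm"
    using distr_norm_homogeneous[OF _ homogeneous0_direction fP] distr_norm_homogeneous[OF _ homogeneous0_direction fN]
    by (simp only: e1 e2 mean) (simp add: mean)
  have "(\<integral>y. ?P y * h (norm y) \<partial>lborel) = (\<integral>t. h t \<partial>distr (density lborel (\<lambda>y. ennreal (?P y))) borel norm)"
    by (subst integral_distr, measurable, subst integral_density) auto
  also have "\<dots> = (\<integral>y. ?N y * h (norm y) \<partial>lborel)"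
    unfolding eq by (subst integral_distr, measurable, subst integral_density) auto
  finally have "(\<integral>y. ?P y * h (norm y) \<partial>lborel) - (\<integral>y. ?N y * h (norm y) \<partial>lborel) = 0" by simp
  moreover have "(\<integral>y. ?P y * h (norm y) \<partial>lborel) - (\<integral>y. ?N y * h (norm y) \<partial>lborel) = (\<integral>y. ?P y * h (norm y) - ?N y * h (norm y) \<partial>lborel)"
    using iP iN by simp
  moreover have "(\<lambda>y. ?P y * h (norm y) - ?N y * h (norm y)) = (\<lambda>y. \<Omega> (y /\<^sub>R norm y) * h (norm y))"
    by (auto simp: fun_eq_iff max_def algebra_simps)
  ultimately show ?thesis by simp
qed

text \<open>
  The kernel called \<open>H\<close> in the outline of the proof. It arises from \<open>|K(y)| |v - y|^(1-n)\<close> by integrating over those \<open>y\<close> whose ball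
  of radius \<open>|y|\<close> contains \<open>v\<close>.
\<close>

definition majorant :: "'a \<Rightarrow> ennreal" where
  "majorant v = (\<integral>\<^sup>+y. ennreal (\<bar>\<Omega> (y /\<^sub>R norm y)\<bar> * norm y powr (\<alpha> - real DIM('a) - 1) * norm (v - y) powr (1 - real DIM('a)))
      * indicator {y. norm v \<le> norm y} y \<partial>lborel)"

lemma majorant_measurable [measurable]: "majorant \<in> borel_measurable borel"
  unfolding majorant_def by measurable

text \<open>
  If the right-hand side is finite, then \<open>K(y) (f(x - y) - m(|y|))\<close> is absolutely integrable, so the truncated
  integrals converge by dominated convergence and the limit inherits the bound. If it is
  infinite, there is nothing to prove.
\<close>

theorem rough_op_le_majorant:
  assumes f: "f \<in> test_functions"
  shows "ennreal \<bar>rough_op \<Omega> \<alpha> f x\<bar> \<le> ennreal (2 ^ DIM('a) / (real DIM('a) * unit_ball_vol DIM('a)))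
    * (\<integral>\<^sup>+v. ennreal (norm (grad f (x - v))) * majorant v \<partial>lborel)"
proof -
  let ?n = "real DIM('a)"
  define V where "V = unit_ball_vol ?n"
  have V: "0 < V" by (simp add: V_def)
  have eV: "emeasure lborel (cball (0::'a) 1) = ennreal V" by (simp add: emeasure_cball V_def)
  define C0 where "C0 = 2 ^ DIM('a) / (?n * V)"
  have C0: "0 < C0" using V by (simp add: C0_def)
  define G where "G = (\<integral>\<^sup>+v. ennreal (norm (grad f (x - v))) * majorant v \<partial>lborel)"
  have [measurable]: "f \<in> borel_measurable borel" "grad f \<in> borel_measurable borel"
    using test_function_continuous[OF f] test_function_GDERIV(2)[OF f] by (auto intro: borel_measurable_continuous_onI)
  obtain R B where R: "0 < R" "\<And>x. R < norm x \<Longrightarrow> f x = 0" and B: "0 < B" "\<And>x. \<bar>f x\<bar> \<le> B"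
    using test_function_bounded[OF f] by metis
  \<comment> \<open>Beyond radius \<open>N\<close> the translate of \<open>f\<close> vanishes, so only shells \<open>\<epsilon> < |y| \<le> N\<close> matter.\<close>
  define N where "N = norm x + R"
  have N: "0 < N" using R by (simp add: N_def add_nonneg_pos)
  have fN: "f (x - y) = 0" if "N < norm y" for y
    using that norm_triangle_ineq2[of y x] by (intro R(2)) (auto simp: N_def norm_minus_commute)
  define m where "m t = (\<integral>u. indicator (cball 0 1) u * f (x - t *\<^sub>R u) \<partial>lborel) / V" for t :: real
  have [measurable]: "m \<in> borel_measurable borel"
  proof -
    have "(\<lambda>t. \<integral>u. indicator {u. norm u \<le> 1} u * f (x - t *\<^sub>R u) \<partial>lborel) \<in> borel_measurable borel"
      by (rule lborel.borel_measurable_lebesgue_integral) measurable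
    then show ?thesis unfolding m_def norm_le_eq_cball by simp
  qed
  have ball_int: "integrable lborel (\<lambda>u::'a. indicator (cball 0 1) u * F u)"
    if [measurable]: "F \<in> borel_measurable borel" and "\<And>u. \<bar>F u\<bar> \<le> b" for F and b :: real
  proof (rule Bochner_Integration.integrable_bound)
    show "integrable lborel (\<lambda>u::'a. b * indicator (cball 0 1) u)"
      using eV by (intro integrable_mult_right integrable_real_indicator) auto
    have "0 \<le> b" using that(2) abs_ge_zero order_trans by blast
    then show "AE u in lborel. norm (indicator (cball 0 1) u * F u) \<le> norm (b * indicator (cball 0 1) u)"
      using that(2) by (intro AE_I2) (auto simp: indicator_def)
    show "(\<lambda>u. indicator (cball 0 1) u * F u) \<in> borel_measurable lborel"
      using that(1) by (intro borel_measurable_times borel_measurable_indicator) auto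
  qed
  have mB: "\<bar>m t\<bar> \<le> B" for t
  proof -
    have "norm (\<integral>u. indicator (cball 0 1) u * f (x - t *\<^sub>R u) \<partial>lborel) \<le> (\<integral>u. B * indicator (cball (0::'a) 1) u \<partial>lborel)"
    proof (rule order_trans[OF Bochner_Integration.integral_norm_bound], rule Bochner_Integration.integral_mono)
      have "integrable lborel (\<lambda>u. indicator (cball 0 1) u * f (x - t *\<^sub>R u))" using B by (intro ball_int[where b=B]) auto
      then show "integrable lborel (\<lambda>u. norm (indicator (cball 0 1) u * f (x - t *\<^sub>R u)))" by (rule integrable_norm)
      show "integrable lborel (\<lambda>u. B * indicator (cball (0::'a) 1) u)"
        using eV by (intro integrable_mult_right integrable_real_indicator) auto
    qed (use B in \<open>auto simp: indicator_def\<close>)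
    also have "\<dots> = B * V" using eV V by (simp add: measure_def)
    finally show ?thesis using V by (simp add: m_def field_simps)
  qed
  define k where "k y = \<Omega> (y /\<^sub>R norm y) * norm y powr (\<alpha> - ?n - 1)" for y
  have [measurable]: "k \<in> borel_measurable borel" unfolding k_def by measurable
  define \<Phi> where "\<Phi> y = k y * (f (x - y) - m (norm y))" for y
  have [measurable]: "\<Phi> \<in> borel_measurable borel" unfolding \<Phi>_def by measurable
  let ?P = "\<lambda>\<rho> y. \<integral>\<^sup>+v. ennreal (norm (grad f (x - v)) * norm (v - y) powr (1 - ?n)) * indicator {v. norm v \<le> \<rho>} v \<partial>lborel"
  let ?J = "\<lambda>y v. ennreal (\<bar>k y\<bar> * norm (v - y) powr (1 - ?n)) * indicator {v. norm v \<le> norm y} v"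
  let ?L = "\<integral>y. indicator {y. norm y \<le> N} y * \<Phi> y \<partial>lborel"
  have osc: "ennreal \<bar>f (x - y) - m (norm y)\<bar> \<le> ennreal C0 *
      ?P (norm y) y"
    if "y \<noteq> 0" for y
  proof -
    define \<rho> where "\<rho> = norm y"
    have \<rho>: "0 < \<rho>" using that by (simp add: \<rho>_def)
    have i1: "integrable lborel (\<lambda>u. indicator (cball 0 1) u * f (x - \<rho> *\<^sub>R u))"
      by (rule ball_int[where b=B]) (use B in auto)
    have i2: "integrable lborel (\<lambda>u::'a. indicator (cball 0 1) u * f (x - y))"
      by (rule ball_int[where b=B]) (use B in auto)
    have "f (x - y) = (\<integral>u. indicator (cball (0::'a) 1) u * f (x - y) \<partial>lborel) / V"
      using V eV by (simp add: measure_def)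
    then have "f (x - y) - m \<rho> = (\<integral>u. indicator (cball (0::'a) 1) u * f (x - y) - indicator (cball 0 1) u * f (x - \<rho> *\<^sub>R u) \<partial>lborel) / V"
      using i1 i2 by (simp add: m_def diff_divide_distrib)
    then have "ennreal \<bar>f (x - y) - m \<rho>\<bar> = ennreal (1 / V) * ennreal (norm (\<integral>u. indicator (cball (0::'a) 1) u * f (x - y) - indicator (cball 0 1) u * f (x - \<rho> *\<^sub>R u) \<partial>lborel))"
      using V by (simp add: abs_divide flip: ennreal_mult)
    also have "\<dots> \<le> ennreal (1 / V) * (\<integral>\<^sup>+u. ennreal (norm (indicator (cball (0::'a) 1) u * f (x - y) - indicator (cball 0 1) u * f (x - \<rho> *\<^sub>R u))) \<partial>lborel)"
      using i1 i2 by (intro mult_left_mono integral_norm_bound_ennreal) auto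
    also have "(\<integral>\<^sup>+u. ennreal (norm (indicator (cball (0::'a) 1) u * f (x - y) - indicator (cball 0 1) u * f (x - \<rho> *\<^sub>R u))) \<partial>lborel)
       = (\<integral>\<^sup>+u. ennreal \<bar>f (x - y) - f (x - \<rho> *\<^sub>R u)\<bar> * indicator {z. norm z \<le> \<rho>} (\<rho> *\<^sub>R u) \<partial>lborel)"
      using \<rho> by (intro nn_integral_cong) (auto simp: indicator_def)
    also have "ennreal (1 / V) * \<dots> = ennreal (1 / (V * \<rho> ^ DIM('a))) * (ennreal (\<rho> ^ DIM('a)) * \<dots>)"
      using V \<rho> by (simp add: mult.assoc[symmetric] flip: ennreal_mult)
    also have "ennreal (\<rho> ^ DIM('a)) * (\<integral>\<^sup>+u. ennreal \<bar>f (x - y) - f (x - \<rho> *\<^sub>R u)\<bar> * indicator {z. norm z \<le> \<rho>} (\<rho> *\<^sub>R u) \<partial>lborel)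
      = (\<integral>\<^sup>+z. ennreal \<bar>f (x - y) - f (x - z)\<bar> * indicator {z. norm z \<le> \<rho>} z \<partial>lborel)"
      using \<rho> by (subst (2) nn_integral_lborel_affine[of _ \<rho> 0]) auto
    also have "\<dots> \<le> ennreal ((2 * \<rho>) ^ DIM('a) / ?n) *
      ?P \<rho> y"
    proof (rule Poincare_potential)
      fix y z
      show "ennreal \<bar>f (x - y) - f (x - z)\<bar> \<le> (\<integral>\<^sup>+t. ennreal (norm (grad f (x - (y + t *\<^sub>R (z - y)))) * norm (z - y)) * indicator {0..1} t \<partial>lborel)"
        using test_function_increment[OF f, of "x - y" "x - z"] by (simp add: norm_minus_commute algebra_simps)
    qed (use \<rho> in \<open>auto simp: \<rho>_def\<close>)
    finally have "ennreal \<bar>f (x - y) - m \<rho>\<bar> \<le> ennreal (1 / (V * \<rho> ^ DIM('a))) * (ennreal ((2 * \<rho>) ^ DIM('a) / ?n) *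
      ?P \<rho> y)"
      by (simp add: mult_left_mono)
    also have "\<dots> = ennreal C0 * ?P \<rho> y"
    proof -
      have "ennreal (1 / (V * \<rho> ^ DIM('a))) * ennreal ((2 * \<rho>) ^ DIM('a) / ?n) = ennreal C0"
        using V \<rho> by (simp add: C0_def power_mult_distrib flip: ennreal_mult)
      then show ?thesis by (simp add: mult.assoc[symmetric])
    qed
    finally show ?thesis by (simp add: \<rho>_def)
  qed
  have bound: "(\<integral>\<^sup>+y. ennreal \<bar>\<Phi> y\<bar> \<partial>lborel) \<le> ennreal C0 * G"
  proof -
    have "(\<integral>\<^sup>+y. ennreal \<bar>\<Phi> y\<bar> \<partial>lborel) \<le> (\<integral>\<^sup>+y. ennreal C0 * (\<integral>\<^sup>+v. ennreal (norm (grad f (x - v))) * ?J y v \<partial>lborel) \<partial>lborel)"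
    proof (intro nn_integral_mono_AE, rule eventually_mono[OF AE_lborel_singleton[of 0]])
      fix y :: 'a assume "y \<noteq> 0"
      have "ennreal \<bar>\<Phi> y\<bar> = ennreal \<bar>k y\<bar> * ennreal \<bar>f (x - y) - m (norm y)\<bar>"
        by (simp add: \<Phi>_def abs_mult ennreal_mult)
      also have "\<dots> \<le> ennreal \<bar>k y\<bar> * (ennreal C0 *
        ?P (norm y) y)"
        using osc[OF \<open>y \<noteq> 0\<close>] by (rule mult_left_mono) simp
      also have "\<dots> = ennreal C0 * (\<integral>\<^sup>+v. ennreal \<bar>k y\<bar> * (ennreal (norm (grad f (x - v)) * norm (v - y) powr (1 - ?n)) * indicator {v. norm v \<le> norm y} v) \<partial>lborel)"
        by (subst nn_integral_cmult) (auto simp: mult_ac)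
      also have "\<dots> = ennreal C0 * (\<integral>\<^sup>+v. ennreal (norm (grad f (x - v))) * ?J y v \<partial>lborel)"
        by (simp add: ennreal_mult mult_ac)
      finally show "ennreal \<bar>\<Phi> y\<bar> \<le> ennreal C0 * (\<integral>\<^sup>+v. ennreal (norm (grad f (x - v))) * ?J y v \<partial>lborel)" .
    qed
    also have "\<dots> = ennreal C0 * (\<integral>\<^sup>+y. (\<integral>\<^sup>+v. ennreal (norm (grad f (x - v))) * ?J y v \<partial>lborel) \<partial>lborel)"
      by (rule nn_integral_cmult) measurable
    also have "(\<integral>\<^sup>+y. (\<integral>\<^sup>+v. ennreal (norm (grad f (x - v))) * ?J y v \<partial>lborel) \<partial>lborel)
       = (\<integral>\<^sup>+v. (\<integral>\<^sup>+y. ennreal (norm (grad f (x - v))) * ?J y v \<partial>lborel) \<partial>lborel)"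
      by (rule lborel_pair.Fubini') measurable
    also have "\<dots> = G"
      unfolding G_def majorant_def
    proof (intro nn_integral_cong)
      fix v
      have "(\<integral>\<^sup>+y. ennreal (norm (grad f (x - v))) * ?J y v \<partial>lborel)
        = ennreal (norm (grad f (x - v))) * (\<integral>\<^sup>+y. ?J y v \<partial>lborel)"
        by (rule nn_integral_cmult) measurable
      also have "(\<integral>\<^sup>+y. ?J y v \<partial>lborel)
        = (\<integral>\<^sup>+y. ennreal (\<bar>\<Omega> (y /\<^sub>R norm y)\<bar> * norm y powr (\<alpha> - ?n - 1) * norm (v - y) powr (1 - ?n)) * indicator {y. norm v \<le> norm y} y \<partial>lborel)"
        by (intro nn_integral_cong) (auto simp: k_def abs_mult indicator_def)
      finally show "(\<integral>\<^sup>+y. ennreal (norm (grad f (x - v))) * ?J y v \<partial>lborel) = ennreal (norm (grad f (x - v))) *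
         (\<integral>\<^sup>+y. ennreal (\<bar>\<Omega> (y /\<^sub>R norm y)\<bar> * norm y powr (\<alpha> - ?n - 1) * norm (v - y) powr (1 - ?n)) * indicator {y. norm v \<le> norm y} y \<partial>lborel)" .
    qed
    finally show ?thesis .
  qed
  have "ennreal \<bar>rough_op \<Omega> \<alpha> f x\<bar> \<le> ennreal C0 * G"
  proof (cases "G = top")
    case True
    then show ?thesis using C0 by (simp add: ennreal_mult_top)
  next
    case False
    then have "(\<integral>\<^sup>+y. ennreal (norm (\<Phi> y)) \<partial>lborel) < \<infinity>"
      using bound by (auto simp: ennreal_mult_less_top less_top intro: le_less_trans)
    then have int\<Phi>: "integrable lborel \<Phi>" by (intro integrableI_bounded) auto
    define T where "T \<epsilon> = (LINT y:{y. \<epsilon> < norm y}|lebesgue. \<Omega> (y /\<^sub>R norm y) / norm y powr (?n + 1 - \<alpha>) * f (x - y))" for \<epsilon>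
    have T: "T \<epsilon> = (\<integral>y. indicator {y. \<epsilon> < norm y \<and> norm y \<le> N} y * \<Phi> y \<partial>lborel)" if "0 < \<epsilon>" for \<epsilon>
    proof -
      \<comment> \<open>The radial function by which the integrand is changed; its integral against \<open>\<Omega>\<close> vanishes.\<close>
      define h where "h t = indicator {t. \<epsilon> < t \<and> t \<le> N} t * (t powr (\<alpha> - ?n - 1) * m t)" for t
      have [measurable]: "h \<in> borel_measurable borel" unfolding h_def by measurable
      define D where "D = max (\<epsilon> powr (\<alpha> - ?n - 1)) (N powr (\<alpha> - ?n - 1))"
      have hB: "\<bar>h t\<bar> \<le> D * B" for t
      proof (cases "\<epsilon> < t \<and> t \<le> N")
        case True
        have "t powr (\<alpha> - ?n - 1) \<le> D"
        proof (cases "0 \<le> \<alpha> - ?n - 1")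
          case nonneg: True
          have "t powr (\<alpha> - ?n - 1) \<le> N powr (\<alpha> - ?n - 1)" using True that nonneg by (intro powr_mono2) auto
          then show ?thesis by (simp add: D_def)
        next
          case neg: False
          have "t powr (\<alpha> - ?n - 1) \<le> \<epsilon> powr (\<alpha> - ?n - 1)" using True that neg by (intro powr_mono2') auto
          then show ?thesis by (simp add: D_def)
        qed
        moreover have "0 \<le> D" by (simp add: D_def le_max_iff_disj)
        ultimately show ?thesis using True mB[of t] by (auto simp: h_def abs_mult intro!: mult_mono)
      next
        case False
        then show ?thesis using B by (simp add: h_def D_def le_max_iff_disj)
      qed
      have hN: "h t = 0" if "N < t" for t using that by (simp add: h_def)
      have "T \<epsilon> = (\<integral>y. indicator {y. \<epsilon> < norm y} y *\<^sub>R (\<Omega> (y /\<^sub>R norm y) / norm y powr (?n + 1 - \<alpha>) * f (x - y)) \<partial>lborel)"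
        unfolding T_def set_lebesgue_integral_def by (rule integral_completion) measurable
      also have "\<dots> = (\<integral>y. indicator {y. \<epsilon> < norm y \<and> norm y \<le> N} y * \<Phi> y + \<Omega> (y /\<^sub>R norm y) * h (norm y) \<partial>lborel)"
      proof (rule Bochner_Integration.integral_cong[OF refl])
        fix y :: 'a
        have "1 / norm y powr (?n + 1 - \<alpha>) = norm y powr (\<alpha> - ?n - 1)"
          using powr_minus_divide[of "norm y" "?n + 1 - \<alpha>"] by (simp add: algebra_simps)
        then have "\<Omega> (y /\<^sub>R norm y) / norm y powr (?n + 1 - \<alpha>) = k y"
          by (simp add: k_def divide_inverse)
        then show "indicator {y. \<epsilon> < norm y} y *\<^sub>R (\<Omega> (y /\<^sub>R norm y) / norm y powr (?n + 1 - \<alpha>) * f (x - y))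
          = indicator {y. \<epsilon> < norm y \<and> norm y \<le> N} y * \<Phi> y + \<Omega> (y /\<^sub>R norm y) * h (norm y)"
          using fN[of y] by (auto simp: indicator_def \<Phi>_def h_def k_def algebra_simps)
      qed
      also have "\<dots> = (\<integral>y. indicator {y. \<epsilon> < norm y \<and> norm y \<le> N} y * \<Phi> y \<partial>lborel) + (\<integral>y. \<Omega> (y /\<^sub>R norm y) * h (norm y) \<partial>lborel)"
      proof (rule Bochner_Integration.integral_add)
        show "integrable lborel (\<lambda>y. indicator {y. \<epsilon> < norm y \<and> norm y \<le> N} y * \<Phi> y)"
          by (rule Bochner_Integration.integrable_bound[OF int\<Phi>]) (auto simp: indicator_def)
        show "integrable lborel (\<lambda>y. \<Omega> (y /\<^sub>R norm y) * h (norm y))"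
          using hB N hN by (intro integrable_shell[where B="D * B" and N=N]) auto
      qed
      also have "(\<integral>y. \<Omega> (y /\<^sub>R norm y) * h (norm y) \<partial>lborel) = 0"
        using hB N hN by (intro integral_radial_eq_0[where B="D * B" and N=N]) auto
      finally show ?thesis by simp
    qed
    have lim: "(T \<longlongrightarrow> ?L) (at_right 0)"
    proof (rule tendsto_at_right_sequentially[of 0 1])
      fix S :: "nat \<Rightarrow> real" assume S: "\<And>n. 0 < S n" "S \<longlonglongrightarrow> 0"
      have "(\<lambda>n. \<integral>y. indicator {y. S n < norm y \<and> norm y \<le> N} y * \<Phi> y \<partial>lborel) \<longlonglongrightarrow> ?L"
      proof (rule integral_dominated_convergence[where w="\<lambda>y. \<bar>\<Phi> y\<bar>"])
        show "integrable lborel (\<lambda>y. \<bar>\<Phi> y\<bar>)" using int\<Phi> by simp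
        show "AE y in lborel. (\<lambda>n. indicator {y. S n < norm y \<and> norm y \<le> N} y * \<Phi> y) \<longlonglongrightarrow> indicator {y. norm y \<le> N} y * \<Phi> y"
        proof (rule eventually_mono[OF AE_lborel_singleton[of 0]])
          fix y :: 'a assume "y \<noteq> 0"
          then have "eventually (\<lambda>n. S n < norm y) sequentially" using order_tendstoD(2)[OF S(2), of "norm y"] by simp
          then have "eventually (\<lambda>n. indicator {y. S n < norm y \<and> norm y \<le> N} y * \<Phi> y = indicator {y. norm y \<le> N} y * \<Phi> y) sequentially"
            by eventually_elim (auto simp: indicator_def)
          then show "(\<lambda>n. indicator {y. S n < norm y \<and> norm y \<le> N} y * \<Phi> y) \<longlonglongrightarrow> indicator {y. norm y \<le> N} y * \<Phi> y"
            by (rule tendsto_eventually)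
        qed
      qed (auto simp: indicator_def)
      then show "(\<lambda>n. T (S n)) \<longlonglongrightarrow> ?L"
        using S(1) by (simp add: T)
    qed simp
    have "rough_op \<Omega> \<alpha> f x = ?L"
      using tendsto_Lim[OF _ lim] unfolding rough_op_def T_def[abs_def] by simp
    then have "ennreal \<bar>rough_op \<Omega> \<alpha> f x\<bar> = ennreal (norm ?L)" by simp
    also have "\<dots> \<le> (\<integral>\<^sup>+y. ennreal (norm (indicator {y. norm y \<le> N} y * \<Phi> y)) \<partial>lborel)"
    proof (rule integral_norm_bound_ennreal)
      show "integrable lborel (\<lambda>y. indicator {y. norm y \<le> N} y * \<Phi> y)"
        by (rule Bochner_Integration.integrable_bound[OF int\<Phi>]) (auto simp: indicator_def)
    qed
    also have "\<dots> \<le> (\<integral>\<^sup>+y. ennreal \<bar>\<Phi> y\<bar> \<partial>lborel)"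
      by (intro nn_integral_mono) (auto simp: indicator_def)
    also have "\<dots> \<le> ennreal C0 * G" by (rule bound)
    finally show ?thesis .
  qed
  then show ?thesis by (simp add: C0_def V_def G_def)
qed

end

section \<open>Integrability of the kernel\<close>

lemma powr_mult_le_add:
  fixes x y \<theta> :: real
  assumes "0 \<le> x" "0 \<le> y" "0 \<le> \<theta>" "\<theta> \<le> 1"
  shows "x powr \<theta> * y powr (1 - \<theta>) \<le> x + y"
proof (cases "max x y = 0")
  case True
  then show ?thesis using assms by (auto simp: max_def split: if_splits)
next
  case False
  have "x powr \<theta> * y powr (1 - \<theta>) \<le> max x y powr \<theta> * max x y powr (1 - \<theta>)"
    using assms by (intro mult_mono powr_mono2) auto
  also have "\<dots> = max x y" using assms False by (simp flip: powr_add)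
  also have "\<dots> \<le> x + y" using assms by auto
  finally show ?thesis .
qed

text \<open>
  The proof of Young's convolution inequality without its constant: write
  \<open>F N = (F^(\<rho>/S) N^(t/S)) (F^(1-\<rho>/S) N^(1-t/S))\<close> and apply Hoelder's inequality. By the relation between the exponents, the
  second factor to the power dual to \<open>S\<close> is a geometric mean of \<open>F^\<rho>\<close> and \<open>N^t\<close>, so its integral is bounded uniformly in \<open>v\<close>.
\<close>

lemma Young_convolution_finite:
  fixes F N :: "'a::euclidean_space \<Rightarrow> real"
  assumes [measurable]: "F \<in> borel_measurable borel" "N \<in> borel_measurable borel"
    and nn: "\<And>x. 0 \<le> F x" "\<And>x. 0 \<le> N x"
    and e: "1 < S" "0 < \<rho>" "\<rho> \<le> S" "0 < t" "t \<le> S" "1 / \<rho> + 1 / t = 1 + 1 / S"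
    and fin: "(\<integral>\<^sup>+x. ennreal (F x powr \<rho>) \<partial>lborel) < top" "(\<integral>\<^sup>+x. ennreal (N x powr t) \<partial>lborel) < top"
  shows "(\<integral>\<^sup>+v. ennpowr (\<integral>\<^sup>+y. ennreal (F y * N (v - y)) \<partial>lborel) S \<partial>lborel) < top"
proof -
  \<comment> \<open>The exponent dual to \<open>S\<close>; \<open>\<theta>\<close> and \<open>1 - \<theta>\<close> are the weights of the geometric mean.\<close>
  define s where "s = S / (S - 1)"
  have s: "1 / S + 1 / s = 1" "0 < s" using e by (auto simp: s_def field_simps)
  define \<theta> where "\<theta> = s * (1 / \<rho> - 1 / S)"
  have s1: "s * (1 - 1 / S) = 1" using e by (simp add: s_def field_simps)
  have \<theta>1: "1 - \<theta> = s * (1 / t - 1 / S)"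
  proof -
    have "\<theta> + s * (1 / t - 1 / S) = s * ((1 / \<rho> + 1 / t) - 2 / S)" by (simp add: \<theta>_def algebra_simps)
    also have "\<dots> = s * (1 - 1 / S)" unfolding e(6) by simp
    finally show ?thesis using s1 by simp
  qed
  have i1: "1 / S \<le> 1 / \<rho>" "1 / S \<le> 1 / t" using e by (auto simp: field_simps)
  have \<theta>: "0 \<le> \<theta>" "\<theta> \<le> 1"
  proof -
    show "0 \<le> \<theta>" unfolding \<theta>_def using s i1 by (intro mult_nonneg_nonneg) auto
    have "0 \<le> 1 - \<theta>" unfolding \<theta>1 using s i1 by (intro mult_nonneg_nonneg) auto
    then show "\<theta> \<le> 1" by simp
  qed
  define f where "f = (\<integral>\<^sup>+x. ennreal (F x powr \<rho>) \<partial>lborel)"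
  define k where "k = (\<integral>\<^sup>+x. ennreal (N x powr t) \<partial>lborel)"
  have shiftN: "(\<integral>\<^sup>+y. ennreal (N (v - y) powr t) \<partial>lborel) = k" for v
    unfolding k_def by (rule nn_integral_lborel_reflect) measurable
  have shiftN': "(\<integral>\<^sup>+v. ennreal (N (v - y) powr t) \<partial>lborel) = k" for y
    unfolding k_def using nn_integral_lborel_affine[of "\<lambda>v. ennreal (N v powr t)" 1 "-y"] by simp
  let ?A = "\<lambda>v. \<integral>\<^sup>+y. ennreal (F y powr \<rho>) * ennreal (N (v - y) powr t) \<partial>lborel"
  let ?B = "\<lambda>v. \<integral>\<^sup>+y. ennreal (F y * N (v - y)) \<partial>lborel"
  have pt: "ennpowr (?B v) S
     \<le> (?A v) * ennpowr (f + k) (S / s)" for v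
  proof -
    let ?a = "\<lambda>y. F y powr (\<rho> / S) * N (v - y) powr (t / S)"
    let ?b = "\<lambda>y. F y powr (1 - \<rho> / S) * N (v - y) powr (1 - t / S)"
    have ab: "?a y * ?b y = F y * N (v - y)" for y
    proof -
      have "?a y * ?b y = (F y powr (\<rho> / S) * F y powr (1 - \<rho> / S)) * (N (v - y) powr (t / S) * N (v - y) powr (1 - t / S))" by simp
      also have "\<dots> = F y * N (v - y)" using nn by (simp flip: powr_add)
      finally show ?thesis .
    qed
    have "(?B v) = (\<integral>\<^sup>+y. ennreal (?a y * ?b y) \<partial>lborel)"
      by (simp only: ab)
    also have "\<dots> \<le> ennpowr (\<integral>\<^sup>+y. ennreal (?a y powr S) \<partial>lborel) (1 / S) * ennpowr (\<integral>\<^sup>+y. ennreal (?b y powr s) \<partial>lborel) (1 / s)"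
      using e s by (intro nn_integral_Holder) auto
    also have "(\<integral>\<^sup>+y. ennreal (?a y powr S) \<partial>lborel) = (?A v)"
      using e by (intro nn_integral_cong) (simp add: powr_mult powr_powr ennreal_mult)
    also have "ennpowr (\<integral>\<^sup>+y. ennreal (?b y powr s) \<partial>lborel) (1 / s) \<le> ennpowr (f + k) (1 / s)"
    proof (rule ennpowr_mono)
      have "(\<integral>\<^sup>+y. ennreal (?b y powr s) \<partial>lborel) \<le> (\<integral>\<^sup>+y. ennreal (F y powr \<rho>) + ennreal (N (v - y) powr t) \<partial>lborel)"
      proof (intro nn_integral_mono)
        fix y
        have ex: "(1 - \<rho> / S) * s = \<rho> * \<theta>" "(1 - t / S) * s = t * (1 - \<theta>)"
          unfolding \<theta>1 unfolding \<theta>_def using e by (auto simp: field_simps)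
        have "?b y powr s = (F y powr \<rho>) powr \<theta> * (N (v - y) powr t) powr (1 - \<theta>)"
          by (simp only: powr_mult powr_powr ex)
        also have "\<dots> \<le> F y powr \<rho> + N (v - y) powr t" using \<theta> by (intro powr_mult_le_add) auto
        finally show "ennreal (?b y powr s) \<le> ennreal (F y powr \<rho>) + ennreal (N (v - y) powr t)"
          by (simp add: ennreal_leI flip: ennreal_plus)
      qed
      also have "\<dots> = f + k" by (simp add: nn_integral_add shiftN f_def)
      finally show "(\<integral>\<^sup>+y. ennreal (?b y powr s) \<partial>lborel) \<le> f + k" .
    qed (use s in auto)
    finally have "(?B v)
        \<le> ennpowr (?A v) (1 / S) * ennpowr (f + k) (1 / s)"
      by (simp add: mult_left_mono)
    then have "ennpowr (?B v) S \<le> ennpowr (ennpowr (?A v) (1 / S) * ennpowr (f + k) (1 / s)) S"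
      using e by (intro ennpowr_mono) auto
    also have "\<dots> = (?A v) * ennpowr (f + k) (S / s)"
      using e by (simp add: ennpowr_mult ennpowr_ennpowr)
    finally show ?thesis .
  qed
  have "(\<integral>\<^sup>+v. ennpowr (?B v) S \<partial>lborel)
    \<le> (\<integral>\<^sup>+v. (?A v) * ennpowr (f + k) (S / s) \<partial>lborel)"
    by (intro nn_integral_mono pt)
  also have "\<dots> = (\<integral>\<^sup>+v. (?A v) \<partial>lborel) * ennpowr (f + k) (S / s)"
    by (subst nn_integral_multc) auto
  also have "(\<integral>\<^sup>+v. (?A v) \<partial>lborel)
    = (\<integral>\<^sup>+y. (\<integral>\<^sup>+v. ennreal (F y powr \<rho>) * ennreal (N (v - y) powr t) \<partial>lborel) \<partial>lborel)"
    by (rule lborel_pair.Fubini') measurable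
  also have "\<dots> = f * k"
    by (simp add: nn_integral_cmult shiftN' nn_integral_multc f_def)
  also have "f * k * ennpowr (f + k) (S / s) < top"
    using fin by (simp add: f_def[symmetric] k_def[symmetric] ennreal_mult_less_top ennpowr_less_top)
  finally show ?thesis .
qed

context rough_kernel
begin

lemma majorant_scale:
  assumes "0 < c"
  shows "majorant (c *\<^sub>R v) = ennreal (c powr (\<alpha> - real DIM('a))) * majorant v"
proof -
  let ?n = "real DIM('a)"
  let ?I = "\<lambda>v y. ennreal (\<bar>\<Omega> (y /\<^sub>R norm y)\<bar> * norm y powr (\<alpha> - ?n - 1) * norm (v - y) powr (1 - ?n)) * indicator {y. norm v \<le> norm y} y"
  have "majorant (c *\<^sub>R v) = ennreal (c ^ DIM('a)) * (\<integral>\<^sup>+y. ?I (c *\<^sub>R v) (0 + c *\<^sub>R y) \<partial>lborel)"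
    unfolding majorant_def using assms by (subst nn_integral_lborel_affine[of _ c 0]) auto
  also have "\<dots> = ennreal (c ^ DIM('a)) * (\<integral>\<^sup>+y. ennreal (c powr (\<alpha> - 2 * ?n)) * ?I v y \<partial>lborel)"
  proof -
    have "?I (c *\<^sub>R v) (0 + c *\<^sub>R y) = ennreal (c powr (\<alpha> - 2 * ?n)) * ?I v y" for y
    proof -
      have d: "(c *\<^sub>R y) /\<^sub>R norm (c *\<^sub>R y) = y /\<^sub>R norm y" using assms by (simp add: field_simps)
      have n1: "norm (c *\<^sub>R y) = c * norm y" using assms by simp
      have n2: "norm (c *\<^sub>R v - c *\<^sub>R y) = c * norm (v - y)" using assms by (simp flip: scaleR_diff_right)
      have cc: "c powr (\<alpha> - ?n - 1) * c powr (1 - ?n) = c powr (\<alpha> - 2 * ?n)" by (simp flip: powr_add)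
      have "\<bar>\<Omega> (y /\<^sub>R norm y)\<bar> * (c * norm y) powr (\<alpha> - ?n - 1) * (c * norm (v - y)) powr (1 - ?n)
        = (c powr (\<alpha> - ?n - 1) * c powr (1 - ?n)) * (\<bar>\<Omega> (y /\<^sub>R norm y)\<bar> * norm y powr (\<alpha> - ?n - 1) * norm (v - y) powr (1 - ?n))"
        by (simp add: powr_mult)
      then have "ennreal (\<bar>\<Omega> (y /\<^sub>R norm y)\<bar> * (c * norm y) powr (\<alpha> - ?n - 1) * (c * norm (v - y)) powr (1 - ?n))
        = ennreal (c powr (\<alpha> - 2 * ?n)) * ennreal (\<bar>\<Omega> (y /\<^sub>R norm y)\<bar> * norm y powr (\<alpha> - ?n - 1) * norm (v - y) powr (1 - ?n))"
        unfolding cc by (simp only: ennreal_mult powr_ge_zero mult_nonneg_nonneg abs_ge_zero)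
      moreover have "indicator {y. norm (c *\<^sub>R v) \<le> norm y} (c *\<^sub>R y) = (indicator {y. norm v \<le> norm y} y :: ennreal)"
        using assms by (simp add: indicator_def)
      moreover have "(c *\<^sub>R y) /\<^sub>R (c * norm y) = y /\<^sub>R norm y" using d by (simp only: n1)
      ultimately show ?thesis unfolding add_0 n1 n2 by (simp only: mult.assoc)
    qed
    then show ?thesis by simp
  qed
  also have "\<dots> = ennreal (c ^ DIM('a)) * (ennreal (c powr (\<alpha> - 2 * ?n)) * majorant v)"
    unfolding majorant_def by (subst nn_integral_cmult) auto
  also have "\<dots> = ennreal (c powr ?n * c powr (\<alpha> - 2 * ?n)) * majorant v"
    using assms by (simp add: ennreal_mult powr_realpow mult.assoc)
  also have "c powr ?n * c powr (\<alpha> - 2 * ?n) = c powr (\<alpha> - ?n)" by (simp flip: powr_add)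
  finally show ?thesis .
qed

text \<open>
  On the shell \<open>1 \<le> |v| \<le> 2\<close> the part of the kernel with \<open>|y| > 4\<close> is bounded, because \<open>|v - y| \<sim> |y|\<close> and the
  integrand decays like \<open>|y|^(\<alpha>-2n)\<close>. For \<open>|y| \<le> 4\<close> the restriction \<open>|y| \<ge> |v| \<ge> 1\<close> removes the singularity at the origin,
  and a convolution of \<open>\<Omega>\<close> with \<open>|\<cdot>|^(1-n)\<close> remains, which is locally in \<open>L^t\<close> for \<open>t < n/(n-1)\<close>.
\<close>

lemma majorant_shell_power_integrable:
  assumes n: "2 \<le> DIM('a)" and \<alpha>: "\<alpha> < real DIM('a)"
    and \<rho>: "1 < \<rho>" "\<rho> < S" "1 / \<rho> < 1 / S + 1 / real DIM('a)"
    and fin: "(\<integral>\<^sup>+y. ennreal (\<bar>\<Omega> (y /\<^sub>R norm y)\<bar> powr \<rho>) * indicator {y. norm y \<le> 1} y \<partial>lborel) < top"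
  shows "(\<integral>\<^sup>+v. ennpowr (majorant v) S * indicator {1..2} (norm v) \<partial>lborel) < top"
proof -
  let ?n = "real DIM('a)"
  have n2: "2 \<le> ?n" using n by simp
  have S: "1 < S" using \<rho> by simp
  define F where "F y = \<bar>\<Omega> (y /\<^sub>R norm y)\<bar> * indicator {y. norm y \<le> 4} y" for y
  define N where "N z = norm z powr (1 - ?n) * indicator {z. norm z \<le> 6} z" for z :: 'a
  have [measurable]: "F \<in> borel_measurable borel" "N \<in> borel_measurable borel"
    unfolding F_def N_def by measurable
  \<comment> \<open>The exponent that Young's inequality prescribes for \<open>|\<cdot>|^(1-n)\<close>; \<open>tn\<close> says that it is below \<open>n/(n-1)\<close>. The radius 6 is that of the differences of \<open>|v| \<le> 2\<close> and \<open>|y| \<le> 4\<close>.\<close>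
  define t where "t = 1 / (1 + 1 / S - 1 / \<rho>)"
  have it: "1 / t = 1 + 1 / S - 1 / \<rho>" by (simp add: t_def)
  have "1 / \<rho> < 1" using \<rho> by simp
  then have it1: "1 / S < 1 / t" unfolding it by linarith
  have S0: "0 < 1 / S" using S by simp
  have t0: "0 < t" using it1 S0 by (metis order_less_trans zero_less_divide_1_iff)
  have tS: "t \<le> S" using it1 t0 S by (simp add: field_simps)
  have tn: "- ?n < (1 - ?n) * t"
  proof -
    have "1 - 1 / ?n < 1 / t" unfolding it using \<rho>(3) by linarith
    then have "(1 - 1 / ?n) * (?n * t) < 1 / t * (?n * t)" using t0 n2 by (intro mult_strict_right_mono) auto
    moreover have "(1 - 1 / ?n) * (?n * t) = (?n - 1) * t" using n2 by (simp add: algebra_simps)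
    moreover have "1 / t * (?n * t) = ?n" using t0 by simp
    ultimately show ?thesis by (simp add: algebra_simps)
  qed
  have finF: "(\<integral>\<^sup>+x. ennreal (F x powr \<rho>) \<partial>lborel) < top"
  proof -
    have "(\<integral>\<^sup>+x. ennreal (F x powr \<rho>) \<partial>lborel) = (\<integral>\<^sup>+y. ennreal (\<bar>\<Omega> (y /\<^sub>R norm y)\<bar> powr \<rho>) * indicator {y. norm y \<le> 4} y \<partial>lborel)"
      by (intro nn_integral_cong) (auto simp: F_def indicator_def)
    also have "\<dots> = ennreal (4 ^ DIM('a)) * (\<integral>\<^sup>+y. ennreal (\<bar>\<Omega> (y /\<^sub>R norm y)\<bar> powr \<rho>) * indicator {y. norm y \<le> 1} y \<partial>lborel)"
      by (subst nn_integral_homogeneous_cball[OF _ homogeneous0_direction]) auto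
    also have "\<dots> < top" using fin by (simp add: ennreal_mult_less_top)
    finally show ?thesis .
  qed
  have finN: "(\<integral>\<^sup>+x. ennreal (N x powr t) \<partial>lborel) < top"
  proof -
    have "(\<integral>\<^sup>+x. ennreal (N x powr t) \<partial>lborel) = (\<integral>\<^sup>+z. ennreal (norm (z::'a) powr ((1 - ?n) * t)) * indicator {..6} (norm z) \<partial>lborel)"
      by (intro nn_integral_cong) (auto simp: N_def indicator_def powr_powr)
    also have "\<dots> < top"
      using tn emeasure_lborel_cball_finite[of "0::'a" 1] by (subst nn_integral_norm_powr_le) (auto simp: ennreal_mult_less_top)
    finally show ?thesis .
  qed
  define far where "far = ennreal (2 powr (?n - 1)) * (\<integral>\<^sup>+y. ennreal \<bar>\<Omega> (y /\<^sub>R norm y)\<bar> * (ennreal (norm y powr (\<alpha> - 2 * ?n)) * indicator {4..} (norm y)) \<partial>lborel)"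
  have far: "far < top"
  proof -
    have "(\<integral>\<^sup>+y. ennreal \<bar>\<Omega> (y /\<^sub>R norm y)\<bar> * (ennreal (norm y powr (\<alpha> - 2 * ?n)) * indicator {4..} (norm y)) \<partial>lborel) < top"
      using int \<alpha> by (subst nn_integral_homogeneous_powr_ge[OF _ homogeneous0_direction]) (auto simp: ennreal_mult_less_top)
    then show ?thesis by (simp add: far_def ennreal_mult_less_top)
  qed
  let ?near = "\<lambda>v. \<integral>\<^sup>+y. ennreal (F y * N (v - y)) \<partial>lborel"
  have pt: "majorant v \<le> ?near v + far" if v: "1 \<le> norm v" "norm v \<le> 2" for v
  proof -
    have "majorant v \<le> (\<integral>\<^sup>+y. ennreal (F y * N (v - y)) + ennreal (2 powr (?n - 1)) * (ennreal \<bar>\<Omega> (y /\<^sub>R norm y)\<bar> * (ennreal (norm y powr (\<alpha> - 2 * ?n)) * indicator {4..} (norm y))) \<partial>lborel)"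
      unfolding majorant_def
    proof (intro nn_integral_mono)
      fix y
      show "ennreal (\<bar>\<Omega> (y /\<^sub>R norm y)\<bar> * norm y powr (\<alpha> - ?n - 1) * norm (v - y) powr (1 - ?n)) * indicator {y. norm v \<le> norm y} y
        \<le> ennreal (F y * N (v - y)) + ennreal (2 powr (?n - 1)) * (ennreal \<bar>\<Omega> (y /\<^sub>R norm y)\<bar> * (ennreal (norm y powr (\<alpha> - 2 * ?n)) * indicator {4..} (norm y)))"
      proof -
        consider "norm y < norm v" | "norm v \<le> norm y" "norm y \<le> 4" | "norm v \<le> norm y" "4 < norm y" by linarith
        then show ?thesis
        proof cases
          case 2
          have "norm y powr (\<alpha> - ?n - 1) \<le> 1 powr (\<alpha> - ?n - 1)" using 2 v \<alpha> by (intro powr_mono2') auto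
          then have "\<bar>\<Omega> (y /\<^sub>R norm y)\<bar> * norm y powr (\<alpha> - ?n - 1) * norm (v - y) powr (1 - ?n) \<le> \<bar>\<Omega> (y /\<^sub>R norm y)\<bar> * 1 * norm (v - y) powr (1 - ?n)"
            by (intro mult_right_mono mult_left_mono) auto
          also have "\<dots> = F y * N (v - y)"
            using 2 v norm_triangle_ineq4[of v y] by (simp add: F_def N_def)
          finally have "ennreal (\<bar>\<Omega> (y /\<^sub>R norm y)\<bar> * norm y powr (\<alpha> - ?n - 1) * norm (v - y) powr (1 - ?n)) \<le> ennreal (F y * N (v - y))"
            by (rule ennreal_leI)
          then show ?thesis using 2 by (auto intro: add_increasing2)
        next
          case 3
          have "norm y / 2 \<le> norm (v - y)" using 3 v norm_triangle_ineq2[of y v] by (simp add: norm_minus_commute)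
          then have "norm (v - y) powr (1 - ?n) \<le> (norm y / 2) powr (1 - ?n)" using 3 n2 by (intro powr_mono2') auto
          also have "\<dots> = 2 powr (?n - 1) * norm y powr (1 - ?n)"
          proof -
            have "(norm y / 2) powr (1 - ?n) = norm y powr (1 - ?n) / 2 powr - (?n - 1)" by (simp add: powr_divide)
            also have "\<dots> = 2 powr (?n - 1) * norm y powr (1 - ?n)" by (simp only: powr_minus divide_inverse inverse_inverse_eq mult.commute)
            finally show ?thesis .
          qed
          finally have "\<bar>\<Omega> (y /\<^sub>R norm y)\<bar> * norm y powr (\<alpha> - ?n - 1) * norm (v - y) powr (1 - ?n) \<le> \<bar>\<Omega> (y /\<^sub>R norm y)\<bar> * norm y powr (\<alpha> - ?n - 1) * (2 powr (?n - 1) * norm y powr (1 - ?n))"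
            by (intro mult_left_mono) auto
          also have "\<dots> = 2 powr (?n - 1) * (\<bar>\<Omega> (y /\<^sub>R norm y)\<bar> * (norm y powr (\<alpha> - ?n - 1) * norm y powr (1 - ?n)))" by simp
          also have "norm y powr (\<alpha> - ?n - 1) * norm y powr (1 - ?n) = norm y powr (\<alpha> - 2 * ?n)" by (simp flip: powr_add)
          finally have "ennreal (\<bar>\<Omega> (y /\<^sub>R norm y)\<bar> * norm y powr (\<alpha> - ?n - 1) * norm (v - y) powr (1 - ?n)) \<le> ennreal (2 powr (?n - 1) * (\<bar>\<Omega> (y /\<^sub>R norm y)\<bar> * norm y powr (\<alpha> - 2 * ?n)))"
            by (rule ennreal_leI)
          then show ?thesis using 3 by (simp add: ennreal_mult add_increasing)
        qed auto
      qed
    qed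
    also have "\<dots> = ?near v + far"
      unfolding far_def by (subst nn_integral_add, measurable, subst nn_integral_cmult, measurable)
    finally show ?thesis .
  qed
  have "(\<integral>\<^sup>+v. ennpowr (majorant v) S * indicator {1..2} (norm v) \<partial>lborel)
     \<le> (\<integral>\<^sup>+v. ennreal (2 powr S) * (ennpowr (?near v) S + ennpowr far S * indicator (cball 0 2) v) \<partial>lborel)"
  proof (intro nn_integral_mono)
    fix v
    show "ennpowr (majorant v) S * indicator {1..2} (norm v) \<le> ennreal (2 powr S) * (ennpowr (?near v) S + ennpowr far S * indicator (cball 0 2) v)"
    proof (cases "norm v \<in> {1..2}")
      case True
      then have "ennpowr (majorant v) S \<le> ennpowr (?near v + far) S" using S by (intro ennpowr_mono pt) auto
      also have "\<dots> \<le> ennreal (2 powr S) * (ennpowr (?near v) S + ennpowr far S)" using S by (intro ennpowr_add_le) auto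
      finally show ?thesis using True by simp
    qed auto
  qed
  also have "\<dots> = ennreal (2 powr S) * ((\<integral>\<^sup>+v. ennpowr (?near v) S \<partial>lborel) + ennpowr far S * emeasure lborel (cball (0::'a) 2))"
    by (subst nn_integral_cmult, measurable, subst nn_integral_add, measurable, subst nn_integral_cmult_indicator) auto
  also have "\<dots> < top"
  proof -
    have "(\<integral>\<^sup>+v. ennpowr (?near v) S \<partial>lborel) < top"
      using S \<rho> t0 tS it finF finN by (intro Young_convolution_finite[where \<rho>=\<rho> and t=t]) (auto simp: F_def N_def)
    then show ?thesis using far emeasure_lborel_cball_finite[of "0::'a" 2] by (simp add: ennreal_mult_less_top ennpowr_less_top)
  qed
  finally show ?thesis .
qed

text \<open>
  By homogeneity the integral over the unit ball is at most the integral over the shell, and the kernel is finite almost everywhere.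
\<close>

theorem majorant_power_integrable:
  assumes n: "2 \<le> DIM('a)" and \<alpha>: "\<alpha> < real DIM('a)"
    and \<rho>: "1 < \<rho>" "\<rho> < S" "1 / \<rho> < 1 / S + 1 / real DIM('a)"
    and fin: "(\<integral>\<^sup>+y. ennreal (\<bar>\<Omega> (y /\<^sub>R norm y)\<bar> powr \<rho>) * indicator {y. norm y \<le> 1} y \<partial>lborel) < top"
  shows "(\<integral>\<^sup>+v. ennreal ((norm v powr (real DIM('a) - \<alpha>) * enn2real (majorant v)) powr S) * indicator {v. norm v \<le> 1} v \<partial>lborel) < top"
    and "AE v in lborel. majorant v = ennreal (enn2real (majorant v))"
proof -
  let ?n = "real DIM('a)"
  have S: "0 < S" using \<rho> by simp
  define \<Phi> where "\<Phi> v = ennpowr (ennreal (norm v powr (?n - \<alpha>)) * majorant v) S" for v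
  have [measurable]: "\<Phi> \<in> borel_measurable borel" unfolding \<Phi>_def by measurable
  have hom: "homogeneous0 \<Phi>"
  proof -
    have "ennreal (norm (c *\<^sub>R v) powr (?n - \<alpha>)) * majorant (c *\<^sub>R v) = ennreal (norm v powr (?n - \<alpha>)) * majorant v" if "0 < c" for c v
    proof -
      have "norm (c *\<^sub>R v) powr (?n - \<alpha>) * c powr (\<alpha> - ?n) = norm v powr (?n - \<alpha>) * (c powr (?n - \<alpha>) * c powr (\<alpha> - ?n))"
        using that by (simp add: powr_mult)
      also have "c powr (?n - \<alpha>) * c powr (\<alpha> - ?n) = 1" using that by (simp flip: powr_add)
      finally have "ennreal (norm (c *\<^sub>R v) powr (?n - \<alpha>)) * ennreal (c powr (\<alpha> - ?n)) = ennreal (norm v powr (?n - \<alpha>))"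
        by (simp flip: ennreal_mult)
      then show ?thesis unfolding majorant_scale[OF that] by (simp add: mult.assoc[symmetric])
    qed
    then show ?thesis unfolding homogeneous0_def \<Phi>_def by metis
  qed
  define \<Lambda> where "\<Lambda> = (\<integral>\<^sup>+v. \<Phi> v * indicator {v. norm v \<le> 1} v \<partial>lborel)"
  have "\<Lambda> \<le> (\<integral>\<^sup>+v. \<Phi> v * indicator {1..2} (norm v) \<partial>lborel)"
  proof -
    have "(\<integral>\<^sup>+t. indicator {1..2::real} t \<partial>lborel) \<le> (\<integral>\<^sup>+t. ennreal (?n * t powr (?n - 1)) * indicator {0<..} t * indicator {1..2::real} t \<partial>lborel)"
    proof (intro nn_integral_mono)
      fix t :: real
      have "1 \<le> ?n * t powr (?n - 1)" if "1 \<le> t"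
      proof -
        have "1 * 1 \<le> ?n * t powr (?n - 1)" using n that by (intro mult_mono ge_one_powr_ge_zero) auto
        then show ?thesis by simp
      qed
      then show "indicator {1..2} t \<le> ennreal (?n * t powr (?n - 1)) * indicator {0<..} t * indicator {1..2::real} t"
        by (auto simp: indicator_def)
    qed
    then have "\<Lambda> * 1 \<le> \<Lambda> * (\<integral>\<^sup>+t. ennreal (?n * t powr (?n - 1)) * indicator {0<..} t * indicator {1..2::real} t \<partial>lborel)"
      by (intro mult_left_mono) auto
    also have "\<dots> = (\<integral>\<^sup>+v. \<Phi> v * indicator {1..2} (norm v) \<partial>lborel)"
      unfolding \<Lambda>_def by (subst nn_integral_polar[OF _ _ hom]) auto
    finally show ?thesis by simp
  qed
  also have "\<dots> \<le> (\<integral>\<^sup>+v. ennreal ((2 powr (?n - \<alpha>)) powr S) * (ennpowr (majorant v) S * indicator {1..2} (norm v)) \<partial>lborel)"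
  proof (intro nn_integral_mono)
    fix v :: 'a
    show "\<Phi> v * indicator {1..2} (norm v) \<le> ennreal ((2 powr (?n - \<alpha>)) powr S) * (ennpowr (majorant v) S * indicator {1..2} (norm v))"
    proof (cases "norm v \<in> {1..2}")
      case True
      then have "norm v powr (?n - \<alpha>) \<le> 2 powr (?n - \<alpha>)" using \<alpha> by (intro powr_mono2) auto
      then have le: "(norm v powr (?n - \<alpha>)) powr S \<le> (2 powr (?n - \<alpha>)) powr S" using S by (simp only: powr_mono2 powr_ge_zero less_imp_le)
      show ?thesis using True mult_right_mono[OF ennreal_leI[OF le], of "ennpowr (majorant v) S"]
        by (simp add: \<Phi>_def ennpowr_mult ennpowr_ennreal)
    qed auto
  qed
  also have "\<dots> = ennreal ((2 powr (?n - \<alpha>)) powr S) * (\<integral>\<^sup>+v. ennpowr (majorant v) S * indicator {1..2} (norm v) \<partial>lborel)"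
    by (rule nn_integral_cmult) measurable
  also have "\<dots> < top" using majorant_shell_power_integrable[OF assms] by (simp add: ennreal_mult_less_top)
  finally have \<Lambda>: "\<Lambda> < top" .
  have "AE v in lborel. \<Phi> v * indicator {v. norm v \<le> real (Suc i)} v \<noteq> \<infinity>" for i
  proof (rule nn_integral_PInf_AE)
    have "(\<integral>\<^sup>+v. \<Phi> v * indicator {v. norm v \<le> real (Suc i)} v \<partial>lborel) = ennreal (real (Suc i) ^ DIM('a)) * \<Lambda>"
      unfolding \<Lambda>_def by (intro nn_integral_homogeneous_cball hom) auto
    also have "\<dots> < top" using \<Lambda> by (simp add: ennreal_mult_less_top)
    finally show "(\<integral>\<^sup>+v. \<Phi> v * indicator {v. norm v \<le> real (Suc i)} v \<partial>lborel) \<noteq> \<infinity>" by auto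
  qed measurable
  then have "AE v in lborel. \<forall>i. \<Phi> v * indicator {v. norm v \<le> real (Suc i)} v \<noteq> \<infinity>"
    by (simp only: AE_all_countable) blast
  moreover have "AE v in lborel. v \<noteq> (0::'a)" by (rule AE_lborel_singleton)
  ultimately show "AE v in lborel. majorant v = ennreal (enn2real (majorant v))"
  proof eventually_elim
    fix v :: 'a assume v: "\<forall>i. \<Phi> v * indicator {v. norm v \<le> real (Suc i)} v \<noteq> \<infinity>" "v \<noteq> 0"
    obtain i where "norm v < 1 + real i" using norm_less_Suc by blast
    then have "norm v \<le> real (Suc i)" by simp
    then have "\<Phi> v \<noteq> top" using v(1)[rule_format, of i] by (simp add: indicator_def)
    then have "majorant v \<noteq> top" using v(2) by (auto simp: \<Phi>_def ennreal_mult_top)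
    then show "majorant v = ennreal (enn2real (majorant v))" by (simp add: less_top)
  qed
  have "(\<integral>\<^sup>+v. ennreal ((norm v powr (?n - \<alpha>) * enn2real (majorant v)) powr S) * indicator {v. norm v \<le> 1} v \<partial>lborel) \<le> \<Lambda>"
    unfolding \<Lambda>_def
  proof (intro nn_integral_mono mult_right_mono)
    fix v :: 'a
    have "ennreal ((norm v powr (?n - \<alpha>) * enn2real (majorant v)) powr S) = ennpowr (ennreal (norm v powr (?n - \<alpha>)) * ennreal (enn2real (majorant v))) S"
      by (simp add: ennpowr_ennreal flip: ennreal_mult)
    also have "\<dots> \<le> \<Phi> v"
      unfolding \<Phi>_def using S by (intro ennpowr_mono mult_left_mono) (cases "majorant v"; simp)+
    finally show "ennreal ((norm v powr (?n - \<alpha>) * enn2real (majorant v)) powr S) \<le> \<Phi> v" .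
  qed auto
  then show "(\<integral>\<^sup>+v. ennreal ((norm v powr (?n - \<alpha>) * enn2real (majorant v)) powr S) * indicator {v. norm v \<le> 1} v \<partial>lborel) < top"
    using \<Lambda> by (rule le_less_trans)
qed

end

section \<open>The weighted inequality\<close>

lemma measurable_lebesgue_cong_AE:
  fixes f g :: "'a::euclidean_space \<Rightarrow> real"
  assumes g: "g \<in> borel_measurable lebesgue" and ae: "AE x in lebesgue. f x = g x"
  shows "f \<in> borel_measurable lebesgue"
proof (rule measurableI)
  obtain N where N: "N \<in> null_sets lebesgue" "{x. f x \<noteq> g x} \<subseteq> N"
    using ae by (auto simp: eventually_ae_filter)
  fix B :: "real set" assume "B \<in> sets borel"
  then have 1: "g -` B \<in> sets lebesgue" using measurable_sets[OF g, of B] by simp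
  have 2: "f -` B \<inter> N \<in> sets lebesgue"
    using null_sets_completion_subset[of "f -` B \<inter> N" N lborel] N(1) by (auto simp: null_sets_def)
  have eq: "f -` B \<inter> space lebesgue = (g -` B - N) \<union> (f -` B \<inter> N)" using N(2) by auto
  show "f -` B \<inter> space lebesgue \<in> sets lebesgue"
    unfolding eq by (intro sets.Un sets.Diff 1 2 null_setsD2[OF N(1)])
qed simp

lemma rough_op_cong_AE:
  fixes \<Omega> \<Omega>' :: "'a::euclidean_space \<Rightarrow> real"
  assumes [measurable]: "\<Omega>' \<in> borel_measurable borel" and ae: "AE y in lborel. \<Omega> (y /\<^sub>R norm y) = \<Omega>' (y /\<^sub>R norm y)"
    and f: "f \<in> test_functions"
  shows "rough_op \<Omega> \<alpha> f x = rough_op \<Omega>' \<alpha> f x"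
proof -
  have [measurable]: "f \<in> borel_measurable borel"
    using test_function_continuous[OF f] by (rule borel_measurable_continuous_onI)
  have "(LINT y:{y. \<epsilon> < norm y}|lebesgue. \<Omega> (y /\<^sub>R norm y) / norm y powr (real DIM('a) + 1 - \<alpha>) * f (x - y))
      = (LINT y:{y. \<epsilon> < norm y}|lebesgue. \<Omega>' (y /\<^sub>R norm y) / norm y powr (real DIM('a) + 1 - \<alpha>) * f (x - y))" for \<epsilon>
    unfolding set_lebesgue_integral_def
  proof (rule integral_cong_AE)
    let ?F = "\<lambda>\<Omega> y. indicator {y. \<epsilon> < norm y} y *\<^sub>R (\<Omega> (y /\<^sub>R norm y) / norm y powr (real DIM('a) + 1 - \<alpha>) * f (x - y))"
    have "?F \<Omega>' \<in> borel_measurable lborel" by measurable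
    then show m: "?F \<Omega>' \<in> borel_measurable lebesgue" by (rule measurable_completion)
    have "AE y in lborel. ?F \<Omega> y = ?F \<Omega>' y" using ae by (auto elim!: eventually_mono)
    then show ae': "AE y in lebesgue. ?F \<Omega> y = ?F \<Omega>' y" by (rule AE_completion)
    show "?F \<Omega> \<in> borel_measurable lebesgue" by (rule measurable_lebesgue_cong_AE[OF m ae'])
  qed
  then show ?thesis by (simp add: rough_op_def)
qed

lemma emeasure_sphere_measure_eq_surface:
  "A \<in> sets borel \<Longrightarrow> emeasure sphere_measure (A :: 'a::euclidean_space set) = emeasure surface_measure {x \<in> space surface_measure. x \<in> A}"
  unfolding sphere_measure_def
  by (subst emeasure_distr[OF measurable_id_surface]) (auto intro!: arg_cong[where f="emeasure _"])

text \<open>The inequality in an arbitrary Euclidean space.\<close>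

theorem rough_op_weighted_bound:
  fixes \<Omega> :: "'a::euclidean_space \<Rightarrow> real"
    and n r r' r_star \<alpha> p q lam :: real
  assumes n: "n = real DIM('a)" and n2: "2 \<le> DIM('a)"
    and r: "1 < r" "r < n"
    and r': "r' = r / (r - 1)" and rs: "r_star = n * r / (n - r)"
    and \<Omega>: "\<Omega> \<in> lorentz_space surface_measure r r_star"
    and mean: "(\<integral>y. \<Omega> y \<partial>surface_measure) = 0"
    and \<alpha>: "0 < \<alpha>"
    and p: "r' * n / (r' + n) < p" "p < n / \<alpha>"
    and q: "1 / q = 1 / p - \<alpha> / n"
    and lam: "\<alpha> - n / p < lam" "lam < 1 + n / r' - n / p"
  shows "\<exists>C::real. \<forall>f\<in>test_functions.
    ennpowr (\<integral>\<^sup>+x. ennreal ((norm x powr lam * \<bar>rough_op \<Omega> \<alpha> f x\<bar>) powr q) \<partial>lebesgue) (1 / q)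
    \<le> ennreal C * ennpowr (\<integral>\<^sup>+x. ennreal ((norm x powr lam * norm (grad f x)) powr p) \<partial>lebesgue) (1 / p)"
proof -
  have n0: "2 \<le> n" using n n2 by simp
  have ir': "1 / r' = 1 - 1 / r" and r'0: "0 < r'" using r by (auto simp: r' field_simps)
  have s0: "0 < r' * n / (r' + n)" using r'0 n0 by simp
  have p0: "0 < p" using p(1) s0 by linarith
  have ip: "1 / p < 1 - 1 / r + 1 / n"
  proof -
    have "1 / p < 1 / (r' * n / (r' + n))"
      by (rule divide_strict_left_mono[OF p(1) _ mult_pos_pos[OF p0 s0]]) simp
    also have "\<dots> = 1 / r' + 1 / n" using r'0 n0 by (simp add: field_simps)
    finally show ?thesis unfolding ir' by simp
  qed
  have irn: "1 / n < 1 / r" using r n0 by (intro divide_strict_left_mono) auto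
  have "1 / p < 1" using ip irn by linarith
  then have p1: "1 < p" using p0 by (simp add: divide_less_eq)
  define p' where "p' = p / (p - 1)"
  have pp': "1 / p + 1 / p' = 1" using p1 by (simp add: p'_def field_simps)
  have ap: "\<alpha> * p < n" using p(2) \<alpha> by (simp add: field_simps)
  have \<alpha>n: "\<alpha> < n"
  proof -
    have "\<alpha> * 1 < \<alpha> * p" using p1 \<alpha> by (intro mult_strict_left_mono) auto
    then show ?thesis using ap by simp
  qed
  have q0: "0 < q"
  proof -
    have "\<alpha> / n < 1 / p" using ap n0 p0 by (simp add: field_simps)
    then have "0 < 1 / q" using q by simp
    then show ?thesis by (simp only: zero_less_divide_1_iff)
  qed

  \<comment> \<open>The lower bound \<open>1/r - 1/n\<close> for \<open>b = 1/S\<close> is the limit of Young's inequality, the upper bounds are \<open>S > r\<close>, \<open>S > p'\<close> and the condition on \<open>lam\<close>; the hypotheses leave a gap between them. The exponent \<open>\<rho> < r\<close> is taken so close to \<open>r\<close> that \<open>1/\<rho> < 1/S + 1/n\<close>.\<close>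
  define bu where "bu = min (1 / r) (min (1 - 1 / p) (1 - 1 / p - lam / n))"
  define b where "b = (1 / r - 1 / n + bu) / 2"
  have lam': "lam / n < 1 / n + 1 - 1 / r - 1 / p"
  proof -
    have "lam < n * (1 / n + 1 / r' - 1 / p)" using lam(2) n0 by (simp add: algebra_simps)
    then have "lam / n < 1 / n + 1 / r' - 1 / p" using n0 by (simp add: divide_less_eq mult.commute)
    then show ?thesis unfolding ir' by simp
  qed
  have "1 / r - 1 / n < bu" using ip lam' n0 by (auto simp: bu_def)
  then have b: "1 / r - 1 / n < b" "b < bu" by (auto simp: b_def)
  have b0: "0 < b" using b irn by simp
  have bup: "b < 1 / r" "b < 1 - 1 / p" "b < 1 - 1 / p - lam / n" using b(2) by (auto simp: bu_def)
  define S where "S = 1 / b"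
  have iS: "1 / S = b" by (simp add: S_def)
  define \<beta> where "\<beta> = (1 / r + min 1 (b + 1 / n)) / 2"
  have "1 / r < min 1 (b + 1 / n)" using b(1) r by simp
  then have \<beta>: "1 / r < \<beta>" "\<beta> < 1" "\<beta> < b + 1 / n" by (auto simp: \<beta>_def)
  have "0 < 1 / r" using r by simp
  then have \<beta>0: "0 < \<beta>" using \<beta>(1) by linarith
  define \<rho> where "\<rho> = 1 / \<beta>"
  have \<rho>: "1 < \<rho>" "\<rho> < r" "\<rho> < S" "1 / \<rho> < 1 / S + 1 / n"
  proof -
    show "1 < \<rho>" using \<beta>(2) \<beta>0 by (simp add: \<rho>_def less_divide_eq)
    have "1 < \<beta> * r" using \<beta>(1) r by (simp add: divide_less_eq)
    then show "\<rho> < r" using \<beta>0 by (simp add: \<rho>_def divide_less_eq mult.commute)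
    have "b < \<beta>" using bup(1) \<beta>(1) by linarith
    then show "\<rho> < S" unfolding \<rho>_def S_def using b0 \<beta>0 by (intro divide_strict_left_mono) auto
    show "1 / \<rho> < 1 / S + 1 / n" unfolding iS using \<beta>(3) by (simp add: \<rho>_def)
  qed
  have p'S: "p' < S"
  proof -
    have "b < 1 / p'" using bup(2) pp' by simp
    then show ?thesis using b0 p1 by (simp add: S_def p'_def field_simps)
  qed
  have lamS: "lam < n * (1 / p' - 1 / S)"
  proof -
    have "lam / n < 1 - 1 / p - b" using bup(3) by simp
    also have "\<dots> = 1 / p' - 1 / S" using pp' iS by simp
    finally show ?thesis using n0 by (simp add: divide_less_eq mult.commute)
  qed

  \<comment> \<open>Only the Borel representative \<open>\<Omega>'\<close> can be composed with \<open>y/|y|\<close>; it has the same Lorentz norm and integral and defines the same operator.\<close>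
  have \<Omega>m: "\<Omega> \<in> borel_measurable surface_measure" and \<Omega>n: "lorentz_norm surface_measure r r_star \<Omega> < top"
    using \<Omega> by (auto simp: lorentz_space_def)
  obtain \<Omega>' N where \<Omega>'[measurable]: "\<Omega>' \<in> borel_measurable borel" and N[measurable]: "N \<in> sets borel"
    and N0: "emeasure sphere_measure N = 0" and eqN: "\<And>x. norm x = 1 \<Longrightarrow> x \<notin> N \<Longrightarrow> \<Omega> x = \<Omega>' x"
    using surface_measure_borel_representative[OF \<Omega>m] by blast
  have \<Omega>'s: "\<Omega>' \<in> borel_measurable surface_measure"
    using measurable_compose[OF measurable_id_surface \<Omega>'] by simp
  have aes: "AE x in surface_measure. \<Omega> x = \<Omega>' x"
  proof (rule AE_I[where N="{x \<in> space surface_measure. x \<in> N}"])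
    show "emeasure surface_measure {x \<in> space surface_measure. x \<in> N} = 0"
      using N0 emeasure_sphere_measure_eq_surface[OF N] by simp
    show "{x \<in> space surface_measure. x \<in> N} \<in> sets surface_measure"
      using measurable_sets[OF measurable_id_surface N] by (simp add: vimage_def Int_def conj_commute)
  qed (use eqN in \<open>auto simp: space_surface_measure\<close>)
  have aed: "AE y in lborel. \<Omega> (y /\<^sub>R norm y) = \<Omega>' (y /\<^sub>R norm y)"
    using AE_direction_notin_null[OF n2 N N0] AE_lborel_singleton[of "0::'a"]
    by eventually_elim (auto intro!: eqN)
  have "lorentz_norm sphere_measure r r_star \<Omega>' = lorentz_norm surface_measure r r_star \<Omega>"
  proof -
    have "emeasure sphere_measure {x \<in> space sphere_measure. t < \<bar>\<Omega>' x\<bar>} = emeasure surface_measure {x \<in> space surface_measure. t < \<bar>\<Omega> x\<bar>}" for t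
    proof -
      have "emeasure sphere_measure {x \<in> space sphere_measure. t < \<bar>\<Omega>' x\<bar>} = emeasure surface_measure {x \<in> space surface_measure. t < \<bar>\<Omega>' x\<bar>}"
        using emeasure_sphere_measure_eq_surface[of "{x. t < \<bar>\<Omega>' x\<bar>}"] by simp
      also have "\<dots> = emeasure surface_measure {x \<in> space surface_measure. t < \<bar>\<Omega> x\<bar>}"
      proof (rule emeasure_eq_AE)
        show "AE x in surface_measure. x \<in> {x \<in> space surface_measure. t < \<bar>\<Omega>' x\<bar>} \<longleftrightarrow> x \<in> {x \<in> space surface_measure. t < \<bar>\<Omega> x\<bar>}"
          using aes by eventually_elim auto
        show "{x \<in> space surface_measure. t < \<bar>\<Omega>' x\<bar>} \<in> sets surface_measure" "{x \<in> space surface_measure. t < \<bar>\<Omega> x\<bar>} \<in> sets surface_measure"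
          using \<Omega>'s \<Omega>m by measurable
      qed
      finally show ?thesis .
    qed
    then show ?thesis unfolding lorentz_norm_def by simp
  qed
  then have norm': "lorentz_norm sphere_measure r r_star \<Omega>' < top" using \<Omega>n by simp
  have rs0: "0 < r_star" using r n0 by (simp add: rs)
  have pow: "(\<integral>\<^sup>+x. ennreal (\<bar>\<Omega>' x\<bar> powr \<rho>) \<partial>sphere_measure) < top"
    using r \<rho> rs0 by (intro lorentz_imp_power_integrable[OF finite_sphere_measure _ norm']) auto
  obtain c where c: "0 < c" "(sphere_measure :: 'a measure) = scale_measure (ennreal c) cone_measure"
    using sphere_measure_eq_scale_cone_measure[OF n2] by blast
  have transfer: "(\<integral>\<^sup>+x. h x \<partial>sphere_measure) = ennreal c * (\<integral>\<^sup>+y. h (y /\<^sub>R norm y) * indicator {y. norm y \<le> 1} y \<partial>lborel)"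
    if "h \<in> borel_measurable borel" for h :: "'a \<Rightarrow> ennreal"
    using that by (subst c(2)) (simp add: nn_integral_scale_measure nn_integral_cone_measure)
  have fin\<rho>: "(\<integral>\<^sup>+y. ennreal (\<bar>\<Omega>' (y /\<^sub>R norm y)\<bar> powr \<rho>) * indicator {y. norm y \<le> 1} y \<partial>lborel) < top"
    using pow c(1) by (subst (asm) transfer) (auto simp: ennreal_mult_less_top)
  have fin1s: "(\<integral>\<^sup>+x. ennreal \<bar>\<Omega>' x\<bar> \<partial>sphere_measure) < top"
  proof -
    have "(\<integral>\<^sup>+x. ennreal \<bar>\<Omega>' x\<bar> \<partial>sphere_measure) \<le> (\<integral>\<^sup>+x. 1 + ennreal (\<bar>\<Omega>' x\<bar> powr \<rho>) \<partial>sphere_measure)"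
    proof (intro nn_integral_mono)
      fix x
      have "\<bar>\<Omega>' x\<bar> \<le> 1 + \<bar>\<Omega>' x\<bar> powr \<rho>"
      proof (cases "\<bar>\<Omega>' x\<bar> \<le> 1")
        case False
        then have "\<bar>\<Omega>' x\<bar> powr 1 \<le> \<bar>\<Omega>' x\<bar> powr \<rho>" using \<rho> by (intro powr_mono) auto
        then show ?thesis by simp
      qed (simp add: add_increasing2)
      then show "ennreal \<bar>\<Omega>' x\<bar> \<le> 1 + ennreal (\<bar>\<Omega>' x\<bar> powr \<rho>)"
        using ennreal_leI[of "\<bar>\<Omega>' x\<bar>" "1 + \<bar>\<Omega>' x\<bar> powr \<rho>"] by simp
    qed
    also have "\<dots> = emeasure sphere_measure (UNIV::'a set) + (\<integral>\<^sup>+x. ennreal (\<bar>\<Omega>' x\<bar> powr \<rho>) \<partial>sphere_measure)"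
      by (subst nn_integral_add) auto
    also have "\<dots> < top" using pow sphere_measure_finite[where A="UNIV::'a set"] by simp
    finally show ?thesis .
  qed
  have fin1: "(\<integral>\<^sup>+y. ennreal \<bar>\<Omega>' (y /\<^sub>R norm y)\<bar> * indicator {y. norm y \<le> 1} y \<partial>lborel) < top"
    using fin1s c(1) by (subst (asm) transfer) (auto simp: ennreal_mult_less_top)
  have mean': "(\<integral>\<^sup>+y. ennreal (\<Omega>' (y /\<^sub>R norm y)) * indicator {y. norm y \<le> 1} y \<partial>lborel)
             = (\<integral>\<^sup>+y. ennreal (- \<Omega>' (y /\<^sub>R norm y)) * indicator {y. norm y \<le> 1} y \<partial>lborel)"
  proof -
    have "(\<integral>x. \<Omega>' x \<partial>sphere_measure) = (\<integral>x. \<Omega>' x \<partial>surface_measure)"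
      unfolding sphere_measure_def by (rule integral_distr[OF measurable_id_surface \<Omega>'])
    also have "\<dots> = (\<integral>x. \<Omega> x \<partial>surface_measure)"
      by (rule integral_cong_AE[OF \<Omega>'s \<Omega>m]) (use aes in \<open>auto elim!: eventually_mono\<close>)
    finally have 0: "(\<integral>x. \<Omega>' x \<partial>sphere_measure) = 0" using mean by simp
    have i: "integrable sphere_measure \<Omega>'" using fin1s by (intro integrableI_bounded) auto
    have fp: "(\<integral>\<^sup>+x. ennreal (\<Omega>' x) \<partial>sphere_measure) < top" "(\<integral>\<^sup>+x. ennreal (- \<Omega>' x) \<partial>sphere_measure) < top"
      by (rule le_less_trans[OF nn_integral_mono fin1s], simp add: ennreal_leI)+
    have "enn2real (\<integral>\<^sup>+x. ennreal (\<Omega>' x) \<partial>sphere_measure) = enn2real (\<integral>\<^sup>+x. ennreal (- \<Omega>' x) \<partial>sphere_measure)"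
      using 0 real_lebesgue_integral_def[OF i] by simp
    then have "(\<integral>\<^sup>+x. ennreal (\<Omega>' x) \<partial>sphere_measure) = (\<integral>\<^sup>+x. ennreal (- \<Omega>' x) \<partial>sphere_measure)"
      using fp by (metis ennreal_enn2real)
    then show ?thesis using c(1) by (subst (asm) (1 2) transfer) (auto simp: ennreal_mult_cancel_left)
  qed
  interpret K: rough_kernel \<Omega>' \<alpha>
    by standard (use fin1 mean' in auto)
  define H where "H v = enn2real (K.majorant v)" for v
  have [measurable]: "H \<in> borel_measurable borel" unfolding H_def by measurable
  have maj: "(\<integral>\<^sup>+v. ennreal ((norm v powr (n - \<alpha>) * H v) powr S) * indicator {v. norm v \<le> 1} v \<partial>lborel) < top"
    and majH: "AE v in lborel. K.majorant v = ennreal (H v)"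
    using K.majorant_power_integrable[OF n2 _ \<rho>(1,3) _ fin\<rho>] \<alpha>n \<rho>(4) unfolding H_def n by auto
  interpret W: homogeneous_kernel H n \<alpha> p p' q S
  proof
    show "H (c *\<^sub>R v) = c powr (\<alpha> - n) * H v" if "0 < c" for c v
      unfolding H_def K.majorant_scale[OF that] n by (simp add: enn2real_mult)
  qed (use n p1 pp' \<alpha> q q0 p'S maj in \<open>auto simp: H_def\<close>)
  obtain C1 where C1: "0 \<le> C1" "\<And>g. g \<in> borel_measurable borel \<Longrightarrow> (\<forall>x. 0 \<le> g x) \<Longrightarrow>
     (\<integral>\<^sup>+x. ennpowr (\<integral>\<^sup>+w. ennreal (g w * (norm x powr lam * norm w powr - lam * H (x - w))) \<partial>lborel) q \<partial>lborel)
       \<le> ennreal C1 * ennpowr (\<integral>\<^sup>+w. ennreal (g w powr p) \<partial>lborel) (q / p)"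
    using W.weighted_bound[OF lam(1) lamS] by blast
  define C0 where "C0 = 2 ^ DIM('a) / (real DIM('a) * unit_ball_vol DIM('a))"
  have C0: "0 \<le> C0" by (simp add: C0_def)
  show ?thesis
  proof (intro exI[of _ "(C0 powr q * C1) powr (1 / q)"] ballI)
    fix f :: "'a \<Rightarrow> real" assume f: "f \<in> test_functions"
    have [measurable]: "grad f \<in> borel_measurable borel"
      using test_function_GDERIV(2)[OF f] by (rule borel_measurable_continuous_onI)
    define g where "g w = norm w powr lam * norm (grad f w)" for w
    have g[measurable]: "g \<in> borel_measurable borel" unfolding g_def by measurable
    define I where "I x = (\<integral>\<^sup>+w. ennreal (g w * (norm x powr lam * norm w powr - lam * H (x - w))) \<partial>lborel)" for x
    have [measurable]: "I \<in> borel_measurable borel" unfolding I_def by measurable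
    have pt: "ennreal ((norm x powr lam * \<bar>rough_op \<Omega> \<alpha> f x\<bar>) powr q) \<le> ennreal (C0 powr q) * ennpowr (I x) q" for x
    proof -
      have "ennreal \<bar>rough_op \<Omega> \<alpha> f x\<bar> \<le> ennreal C0 * (\<integral>\<^sup>+v. ennreal (norm (grad f (x - v))) * K.majorant v \<partial>lborel)"
        unfolding rough_op_cong_AE[OF \<Omega>' aed f] C0_def by (rule K.rough_op_le_majorant[OF f])
      also have "(\<integral>\<^sup>+v. ennreal (norm (grad f (x - v))) * K.majorant v \<partial>lborel) = (\<integral>\<^sup>+v. ennreal (norm (grad f (x - v))) * ennreal (H (x - (x - v))) \<partial>lborel)"
        using majH by (intro nn_integral_cong_AE) (auto elim!: eventually_mono)
      also have "\<dots> = (\<integral>\<^sup>+w. ennreal (norm (grad f w)) * ennreal (H (x - w)) \<partial>lborel)"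
        by (rule nn_integral_lborel_reflect) measurable
      finally have "ennreal (norm x powr lam) * ennreal \<bar>rough_op \<Omega> \<alpha> f x\<bar>
          \<le> ennreal (norm x powr lam) * (ennreal C0 * (\<integral>\<^sup>+w. ennreal (norm (grad f w)) * ennreal (H (x - w)) \<partial>lborel))"
        by (rule mult_left_mono) simp
      also have "\<dots> = ennreal C0 * (\<integral>\<^sup>+w. ennreal (norm x powr lam) * (ennreal (norm (grad f w)) * ennreal (H (x - w))) \<partial>lborel)"
        by (subst nn_integral_cmult) (auto simp: mult_ac)
      also have "(\<integral>\<^sup>+w. ennreal (norm x powr lam) * (ennreal (norm (grad f w)) * ennreal (H (x - w))) \<partial>lborel) = I x"
        unfolding I_def
      proof (intro nn_integral_cong_AE, rule eventually_mono[OF AE_lborel_singleton[of 0]])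
        fix w :: 'a assume "w \<noteq> 0"
        then have 1: "norm w powr lam * norm w powr - lam = 1" by (simp flip: powr_add)
        have "g w * (norm x powr lam * norm w powr - lam * H (x - w)) = (norm w powr lam * norm w powr - lam) * (norm x powr lam * (norm (grad f w) * H (x - w)))"
          by (simp add: g_def)
        also have "\<dots> = norm x powr lam * (norm (grad f w) * H (x - w))" unfolding 1 by simp
        finally have eq: "g w * (norm x powr lam * norm w powr - lam * H (x - w)) = norm x powr lam * (norm (grad f w) * H (x - w))" .
        show "ennreal (norm x powr lam) * (ennreal (norm (grad f w)) * ennreal (H (x - w))) = ennreal (g w * (norm x powr lam * norm w powr - lam * H (x - w)))"
          unfolding eq by (simp add: H_def ennreal_mult)
      qed
      finally have "ennreal (norm x powr lam * \<bar>rough_op \<Omega> \<alpha> f x\<bar>) \<le> ennreal C0 * I x" by (simp add: ennreal_mult)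
      then have "ennpowr (ennreal (norm x powr lam * \<bar>rough_op \<Omega> \<alpha> f x\<bar>)) q \<le> ennpowr (ennreal C0 * I x) q"
        using q0 by (intro ennpowr_mono) auto
      then show ?thesis using C0 by (simp add: ennpowr_mult ennpowr_ennreal)
    qed
    let ?U = "\<integral>\<^sup>+x. ennreal ((norm x powr lam * \<bar>rough_op \<Omega> \<alpha> f x\<bar>) powr q) \<partial>lebesgue"
    have "?U \<le> (\<integral>\<^sup>+x. ennreal (C0 powr q) * ennpowr (I x) q \<partial>lebesgue)"
      by (intro nn_integral_mono pt)
    also have "\<dots> = ennreal (C0 powr q) * (\<integral>\<^sup>+x. ennpowr (I x) q \<partial>lborel)"
      by (simp add: nn_integral_completion nn_integral_cmult)
    also have "\<dots> \<le> ennreal (C0 powr q) * (ennreal C1 * ennpowr (\<integral>\<^sup>+w. ennreal (g w powr p) \<partial>lborel) (q / p))"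
      unfolding I_def by (intro mult_left_mono C1(2) g) (auto simp: g_def)
    also have "\<dots> = ennreal (C0 powr q * C1) * ennpowr (\<integral>\<^sup>+w. ennreal (g w powr p) \<partial>lebesgue) (q / p)"
      using C1(1) by (simp add: nn_integral_completion ennreal_mult mult.assoc)
    finally have "ennpowr ?U (1 / q)
      \<le> ennpowr (ennreal (C0 powr q * C1) * ennpowr (\<integral>\<^sup>+w. ennreal (g w powr p) \<partial>lebesgue) (q / p)) (1 / q)"
      using q0 by (intro ennpowr_mono) auto
    also have "\<dots> = ennreal ((C0 powr q * C1) powr (1 / q)) * ennpowr (\<integral>\<^sup>+w. ennreal (g w powr p) \<partial>lebesgue) (1 / p)"
      using q0 C1(1) by (simp only: ennpowr_mult ennpowr_ennpowr) (simp add: ennpowr_ennreal)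
    finally show "ennpowr ?U (1 / q)
      \<le> ennreal ((C0 powr q * C1) powr (1 / q)) * ennpowr (\<integral>\<^sup>+x. ennreal ((norm x powr lam * norm (grad f x)) powr p) \<partial>lebesgue) (1 / p)"
      by (simp add: g_def)
  qed
qed

theorem theorem1p6:
  fixes \<Omega> :: "real ^ 'n \<Rightarrow> real"
    and n :: nat and r r' r_star \<alpha> p q lam :: real
  assumes "n = CARD('n)" and "2 \<le> n"
    and "1 < r" and "r < real n"
    and "r' = r / (r - 1)" and "r_star = real n * r / (real n - r)"
    and "\<Omega> \<in> lorentz_space surface_measure r r_star"
    and "(\<integral>y. \<Omega> y \<partial>surface_measure) = 0"
    and "0 < \<alpha>" and "\<alpha> < 1 + real n / r'"
    and "r' * real n / (r' + real n) < p" and "p < real n / \<alpha>"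
    and "1 / q = 1 / p - \<alpha> / real n"
    and "\<alpha> - real n / p < lam" and "lam < 1 + real n / r' - real n / p"
  shows "\<exists>C::real. \<forall>f\<in>test_functions.
    ennpowr (\<integral>\<^sup>+x. ennreal ((norm x powr lam * \<bar>rough_op \<Omega> \<alpha> f x\<bar>) powr q) \<partial>lebesgue) (1 / q)
    \<le> ennreal C * ennpowr (\<integral>\<^sup>+x. ennreal ((norm x powr lam * norm (grad f x)) powr p) \<partial>lebesgue) (1 / p)"
proof (rule rough_op_weighted_bound[OF _ _ assms(3-9) assms(11-15)])
  show "real n = real DIM(real ^ 'n)" "2 \<le> DIM(real ^ 'n)" using assms(1,2) by simp_all
qed

end
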